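(* In the setting described in the context, let $\widehat{B}_1,\widehat{B}_2$ be disjoint bases of $\widehat{M}$ and let $I=\{i_1,i_2,i_3,i_4\}\subseteq\{1,\dots,m\}$. Let $\widehat{F}_i=\widehat{F}_I(\widehat{B}_i)$, $i=1,2$, and assume $\widehat{e}_{i_1i_2}\in\widehat{F}_1$ and $\widehat{e}_{i_3i_4}\in\widehat{F}_2$. Suppose $(\widehat{B}_1,\widehat{B}_2)$ is not $\widehat{e}_{i_1i_2},\widehat{e}_{i_3i_4}$-switchable. Let $(\widehat{B}_1',\widehat{B}_2')$ be a pair of bases obtained by performing one symmetric exchange between $\widehat{B}_1$ and $\widehat{B}_2$, and let $\widehat{F}_i'=\widehat{F}_I(\widehat{B}_i')$, $i=1,2$. Then either $\{\widehat{F}_1',\widehat{F}_2'\}=\{\widehat{F}_1,\widehat{F}_2\}$ or $\widehat{F}_1'=\widehat{F}_2'=\emptyset$.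
   Context: Graphs may have loops and parallel edges. A biased graph $(G,\mathcal{C})$ is a graph with a set $\mathcal{C}$ of cycles (balanced; others unbalanced) such that if two cycles of a theta graph (three cycles $C_1,C_2,C_3$ with $C_i\triangle C_j=C_k$) lie in $\mathcal{C}$ so does the third; it is linear if every cycle that is a symmetric difference of cycles of $\mathcal{C}$ lies in $\mathcal{C}$. The frame matroid $M(\Omega)$ on $E(G)$ has bases the maximal edge sets $A$ such that each component of $G[A]$ has at most one cycle, which if present is unbalanced; $\mathcal{B}(\cdot)$ is the set of bases. Setting: $\Omega=(G,\mathcal{C})$ linear, no balanced loops, $v\in V(G)$, $e_1,\dots,e_m$ the edges at $v$, $e_i=v\,v(e_i)$. The $v$-deleted biased graph $\widehat{\Omega}=(\widehat{G},\widehat{\mathcal{C}})$: $V(\widehat{G})=V(G)\setminus\{v\}$, $E(\widehat{G})=E(G-v)\cup\widehat{E}$, where for $i\ne j$ with not both $e_i,e_j$ loops there is an edge $\widehat{e}_{ij}=\widehat{e}_{ji}$ joining $v(e_i),v(e_j)$ if neither is a loop and a loop (stem loop) at $v(e_i)$ if exactly $e_j$ is a loop. Pull-backs: $\mathfrak{E}(\widehat{e})=\{\widehat{e}\}$ for $\widehat{e}\notin\widehat{E}$, $\mathfrak{E}(\widehat{e}_{ij})=\{e_i,e_j\}$, extended to sets by symmetric difference. For a cycle $\widehat{C}$ meeting $\widehat{E}$ (not a stem loop) with $\mathfrak{E}(\widehat{C})\neq\emptyset$, the pull-back splits uniquely into cycles (petals) pairwise meeting only at $v$. $\widehat{\mathcal{A}}$: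 cycles $\widehat{C}$, not stem loops, with $\widehat{C}\in\mathcal{C}$, or $\mathfrak{E}(\widehat{C})=\emptyset$, or ($\widehat{C}$ meets $\widehat{E}$, $\mathfrak{E}(\widehat{C})\ne\emptyset$, all petals balanced). $\widehat{\mathcal{C}}$ = cycles expressible as symmetric differences of cycles of $\widehat{\mathcal{A}}$ minus its loops; $\widehat{M}=M(\widehat{\Omega})$. For $I\subseteq\{1,\dots,m\}$, $\widehat{H}=\widehat{H}_I$ is the subgraph induced by $\{\widehat{e}_{ij}:i,j\in I\}$, $\widehat{F}_I(\widehat{B})=\{\widehat{e}\in E(\widehat{H}):(\widehat{B}\setminus E(\widehat{H}))\cup\{\widehat{e}\}\in\mathcal{B}(\widehat{M})\}$. Edges $\widehat{e}_{ij},\widehat{e}_{kl}$ of $\widehat{H}$ are non-incident when $\{i,j\}\cap\{k,l\}=\emptyset$. A pair of disjoint bases $(\widehat{A}_1,\widehat{A}_2)$ with $(\widehat{A}_1\cup\widehat{A}_2)\cap E(\widehat{H})=\{\widehat{a},\widehat{b}\}$ is $\widehat{H}$-viable if $\widehat{a},\widehat{b}$ are non-incident or both lie in the same $\widehat{A}_i$. It is $\widehat{e}',\widehat{f}'$-amenable (distinct $\widehat{e}',\widehat{f}'\in E(\widehat{H})$) if there are disjoint bases $\widehat{A}_1',\widehat{A}_2'$ with $\widehat{A}_i'\setminus E(\widehat{H})=\widehat{A}_i\setminus E(\widehat{H})$ and $(\widehat{A}_1'\cup\widehat{A}_2')\cap E(\widehat{H})=\{\widehat{e}',\widehat{f}'\}$;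 write $(\widehat{A}_1,\widehat{A}_2)\to_{\widehat{e}',\widehat{f}'}(\widehat{A}_1',\widehat{A}_2')$. For $\widehat{H}$-viable pairs $(\widehat{A}_1,\widehat{A}_2)$, $(\widehat{B}_1,\widehat{B}_2)$, write $(\widehat{A}_1,\widehat{A}_2)\curvearrowright_1(\widehat{B}_1,\widehat{B}_2)$ if for some $\widehat{c}_1,\widehat{c}_2$ there are $\widehat{H}$-viable pairs with $(\widehat{A}_1,\widehat{A}_2)\to_{\widehat{c}_1,\widehat{c}_2}(\widehat{A}_1',\widehat{A}_2')$, $(\widehat{B}_1,\widehat{B}_2)\to_{\widehat{c}_1,\widehat{c}_2}(\widehat{B}_1',\widehat{B}_2')$, and $(\widehat{B}_1',\widehat{B}_2')$ obtained from $(\widehat{A}_1',\widehat{A}_2')$ by one symmetric exchange; $\curvearrowright$ denotes a finite chain of $\curvearrowright_1$ steps. If $\widehat{e}\in\widehat{F}_I(\widehat{B}_1)$ and $\widehat{f}\in\widehat{F}_I(\widehat{B}_2)$ are non-incident (for disjoint bases $\widehat{B}_1,\widehat{B}_2$), then $(\widehat{B}_1,\widehat{B}_2)$ is $\widehat{e},\widehat{f}$-switchable if there exists $(\widehat{B}_1',\widehat{B}_2')$ with $(\widehat{B}_1,\widehat{B}_2)\curvearrowright(\widehat{B}_1',\widehat{B}_2')$ and $(\widehat{B}_1',\widehat{B}_2')$ is $\widehat{e}',\widehat{f}'$-amenable for some non-incident $\widehat{e}',\widehat{f}'\in E(\widehat{H})\setminus\{\widehat{e},\widehat{f}\}$.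
   Formalization: Loops ê_ij lying in Â (where {e_i,e_j} is a balanced cycle) are deleted from Ω̂ instead of staying as unbalanced loops, and ↷_1 requires Ĥ-viability only of the rerouted pairs (A'), (B'), not of (A), (B); read literally, either point makes the claim false. *)

theory Defs
  imports Main
begin

text \<open>An edge is a name together with its set of ends, which has one element (a loop) or two.\<close>

record ('v, 'e) mgraph =
  verts :: "'v set"
  edges :: "'e set"
  ends :: "'e \<Rightarrow> 'v set"

definition graph :: "('v, 'e) mgraph \<Rightarrow> bool" where
  "graph G \<longleftrightarrow> finite (verts G) \<and> finite (edges G) \<and>
     (\<forall>x\<in>edges G. ends G x \<subseteq> verts G \<and> (card (ends G x) = 1 \<or> card (ends G x) = 2))"

definition loop :: "('v, 'e) mgraph \<Rightarrow> 'e \<Rightarrow> bool" where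
  "loop G x \<longleftrightarrow> card (ends G x) = 1"

definition edges_at :: "('v, 'e) mgraph \<Rightarrow> 'v \<Rightarrow> 'e set" where
  "edges_at G u = {x \<in> edges G. u \<in> ends G x}"

definition vertices_of :: "('v, 'e) mgraph \<Rightarrow> 'e set \<Rightarrow> 'v set" where
  "vertices_of G A = (\<Union>x\<in>A. ends G x)"

text \<open>The second summand makes a loop count twice.\<close>

definition degree_in :: "('v, 'e) mgraph \<Rightarrow> 'e set \<Rightarrow> 'v \<Rightarrow> nat" where
  "degree_in G A u = card {x \<in> A. u \<in> ends G x} + card {x \<in> A. ends G x = {u}}"

definition adjacent_in :: "('v, 'e) mgraph \<Rightarrow> 'e set \<Rightarrow> ('e \<times> 'e) set" where
  "adjacent_in G A = {(x, y) \<in> A \<times> A. ends G x \<inter> ends G y \<noteq> {}}"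

text \<open>The edge sets of the components of \<open>G[A]\<close>. Every edge is adjacent to itself, so the
  transitive closure is an equivalence relation on \<open>A\<close>.\<close>

definition components_in :: "('v, 'e) mgraph \<Rightarrow> 'e set \<Rightarrow> 'e set set" where
  "components_in G A = A // (adjacent_in G A)\<^sup>+"

text \<open>Cycles are edge sets of connected 2-regular subgraphs, including loops and pairs of
  parallel edges.\<close>

definition cycle :: "('v, 'e) mgraph \<Rightarrow> 'e set \<Rightarrow> bool" where
  "cycle G X \<longleftrightarrow> X \<subseteq> edges G \<and> components_in G X = {X} \<and>
     (\<forall>u\<in>vertices_of G X. degree_in G X u = 2)"

definition symm_diff_of :: "'a set set \<Rightarrow> 'a set" where
  "symm_diff_of S = {x. odd (card {X \<in> S. x \<in> X})}"

definition spanned_cycles :: "('v, 'e) mgraph \<Rightarrow> 'e set set \<Rightarrow> 'e set set" where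
  "spanned_cycles G \<A> = {X. cycle G X \<and> (\<exists>S. finite S \<and> S \<subseteq> \<A> \<and> X = symm_diff_of S)}"

definition theta :: "('v, 'e) mgraph \<Rightarrow> 'e set \<Rightarrow> 'e set \<Rightarrow> 'e set \<Rightarrow> bool" where
  "theta G X Y Z \<longleftrightarrow> cycle G X \<and> cycle G Y \<and> cycle G Z \<and>
     sym_diff X Y = Z \<and> sym_diff Y Z = X \<and> sym_diff X Z = Y"

definition biased_graph :: "('v, 'e) mgraph \<Rightarrow> 'e set set \<Rightarrow> bool" where
  "biased_graph G \<C> \<longleftrightarrow> graph G \<and> (\<forall>X\<in>\<C>. cycle G X) \<and>
     (\<forall>X Y Z. theta G X Y Z \<longrightarrow> X \<in> \<C> \<longrightarrow> Y \<in> \<C> \<longrightarrow> Z \<in> \<C>)"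

definition linear_biased_graph :: "('v, 'e) mgraph \<Rightarrow> 'e set set \<Rightarrow> bool" where
  "linear_biased_graph G \<C> \<longleftrightarrow> biased_graph G \<C> \<and> spanned_cycles G \<C> \<subseteq> \<C>"

definition frame_indep :: "('v, 'e) mgraph \<Rightarrow> 'e set set \<Rightarrow> 'e set \<Rightarrow> bool" where
  "frame_indep G \<C> A \<longleftrightarrow> A \<subseteq> edges G \<and>
     (\<forall>K\<in>components_in G A.
        (\<forall>X Y. cycle G X \<and> X \<subseteq> K \<and> cycle G Y \<and> Y \<subseteq> K \<longrightarrow> X = Y) \<and>
        (\<forall>X. cycle G X \<and> X \<subseteq> K \<longrightarrow> X \<notin> \<C>))"

definition frame_bases :: "('v, 'e) mgraph \<Rightarrow> 'e set set \<Rightarrow> 'e set set" where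
  "frame_bases G \<C> =
     {B. frame_indep G \<C> B \<and> (\<forall>A. frame_indep G \<C> A \<and> B \<subseteq> A \<longrightarrow> A = B)}"

text \<open>The vertex \<open>v\<close> has incident edges \<open>e 1, \<dots>, e m\<close>; \<open>Hat {i, j}\<close> is the edge
  \<open>e\<^sub>i\<^sub>j\<close> with a hat, and \<open>Old x\<close> is the edge \<open>x\<close> of \<open>G - v\<close>.\<close>

datatype 'e hat_edge = Old 'e | Hat "nat set"

definition new_edges :: "('v, 'e) mgraph \<Rightarrow> nat \<Rightarrow> (nat \<Rightarrow> 'e) \<Rightarrow> 'e hat_edge set" where
  "new_edges G m e = {Hat {i, j} | i j.
     i \<in> {1..m} \<and> j \<in> {1..m} \<and> i \<noteq> j \<and> \<not> (loop G (e i) \<and> loop G (e j))}"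

definition stem_loops :: "('v, 'e) mgraph \<Rightarrow> nat \<Rightarrow> (nat \<Rightarrow> 'e) \<Rightarrow> 'e hat_edge set" where
  "stem_loops G m e = {Hat {i, j} | i j.
     i \<in> {1..m} \<and> j \<in> {1..m} \<and> \<not> loop G (e i) \<and> loop G (e j)}"

text \<open>Removing \<open>v\<close> from the ends of \<open>e i\<close> leaves the other end \<open>v(e i)\<close>, and nothing if
  \<open>e i\<close> is a loop. So the formula for \<open>Hat {i, j}\<close> gives \<open>{v(e i), v(e j)}\<close> if neither is a
  loop, and the stem loop at \<open>v(e i)\<close> if only \<open>e j\<close> is.\<close>

primrec hat_ends :: "('v, 'e) mgraph \<Rightarrow> 'v \<Rightarrow> (nat \<Rightarrow> 'e) \<Rightarrow> 'e hat_edge \<Rightarrow> 'v set" where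
  "hat_ends G v e (Old x) = ends G x"
| "hat_ends G v e (Hat P) = (\<Union>i\<in>P. ends G (e i)) - {v}"

definition hat_graph ::
  "('v, 'e) mgraph \<Rightarrow> 'v \<Rightarrow> nat \<Rightarrow> (nat \<Rightarrow> 'e) \<Rightarrow> ('v, 'e hat_edge) mgraph" where
  "hat_graph G v m e =
     \<lparr>verts = verts G - {v},
      edges = Old ` (edges G - edges_at G v) \<union> new_edges G m e,
      ends = hat_ends G v e\<rparr>"

primrec pull_back_edge :: "(nat \<Rightarrow> 'e) \<Rightarrow> 'e hat_edge \<Rightarrow> 'e set" where
  "pull_back_edge e (Old x) = {x}"
| "pull_back_edge e (Hat P) = e ` P"

definition pull_back :: "(nat \<Rightarrow> 'e) \<Rightarrow> 'e hat_edge set \<Rightarrow> 'e set" where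
  "pull_back e A = {x. odd (card {a \<in> A. x \<in> pull_back_edge e a})}"

text \<open>If a cycle other than a stem loop meets the new edges and has a nonempty pull-back, then
  that pull-back has exactly one splitting into petals.\<close>

definition petals :: "('v, 'e) mgraph \<Rightarrow> 'v \<Rightarrow> 'e set \<Rightarrow> 'e set set \<Rightarrow> bool" where
  "petals G v A \<P> \<longleftrightarrow> \<Union> \<P> = A \<and> (\<forall>X\<in>\<P>. cycle G X) \<and>
     (\<forall>X\<in>\<P>. \<forall>Y\<in>\<P>. X \<noteq> Y \<longrightarrow>
        X \<inter> Y = {} \<and> vertices_of G X \<inter> vertices_of G Y = {v})"

definition hat_generators ::
  "('v, 'e) mgraph \<Rightarrow> 'e set set \<Rightarrow> 'v \<Rightarrow> nat \<Rightarrow> (nat \<Rightarrow> 'e) \<Rightarrow> 'e hat_edge set set" where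
  "hat_generators G \<C> v m e =
     {X. cycle (hat_graph G v m e) X \<and> (\<forall>a\<in>stem_loops G m e. X \<noteq> {a}) \<and>
         ((\<exists>Y\<in>\<C>. X = Old ` Y) \<or>
          pull_back e X = {} \<or>
          X \<inter> new_edges G m e \<noteq> {} \<and> pull_back e X \<noteq> {} \<and>
            (\<exists>\<P>. petals G v (pull_back e X) \<P> \<and> \<P> \<subseteq> \<C>))}"

definition hat_cycles ::
  "('v, 'e) mgraph \<Rightarrow> 'e set set \<Rightarrow> 'v \<Rightarrow> nat \<Rightarrow> (nat \<Rightarrow> 'e) \<Rightarrow> 'e hat_edge set set" where
  "hat_cycles G \<C> v m e = spanned_cycles (hat_graph G v m e)
     {X \<in> hat_generators G \<C> v m e. \<not> (\<exists>a. X = {a})}"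

text \<open>The loops among the generators are the edges \<open>Hat {i, j}\<close> for which \<open>{e i, e j}\<close> is a
  balanced cycle, hence a circuit of the frame matroid of \<open>G\<close>. They are removed from the graph as
  well as from the generators, so that the v-deleted biased graph again has no balanced loops. If
  they stayed in the graph, they would be unbalanced there and bases could contain them.\<close>

definition deleted_graph ::
  "('v, 'e) mgraph \<Rightarrow> 'e set set \<Rightarrow> 'v \<Rightarrow> nat \<Rightarrow> (nat \<Rightarrow> 'e) \<Rightarrow> ('v, 'e hat_edge) mgraph" where
  "deleted_graph G \<C> v m e = (hat_graph G v m e)
     \<lparr>edges := edges (hat_graph G v m e) - {a. {a} \<in> hat_generators G \<C> v m e}\<rparr>"

definition hat_bases ::
  "('v, 'e) mgraph \<Rightarrow> 'e set set \<Rightarrow> 'v \<Rightarrow> nat \<Rightarrow> (nat \<Rightarrow> 'e) \<Rightarrow> 'e hat_edge set set" where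
  "hat_bases G \<C> v m e = frame_bases (deleted_graph G \<C> v m e) (hat_cycles G \<C> v m e)"

definition hat_subgraph_edges ::
  "('v, 'e) mgraph \<Rightarrow> nat \<Rightarrow> (nat \<Rightarrow> 'e) \<Rightarrow> nat set \<Rightarrow> 'e hat_edge set" where
  "hat_subgraph_edges G m e I = {Hat {i, j} | i j. i \<in> I \<and> j \<in> I} \<inter> new_edges G m e"

text \<open>Here \<open>\<B>\<close> stands for the set of bases of the v-deleted biased graph and \<open>H\<close> for the edge set
  of the subgraph induced by an index set.\<close>

definition completions :: "'a set set \<Rightarrow> 'a set \<Rightarrow> 'a set \<Rightarrow> 'a set" where
  "completions \<B> H B = {a \<in> H. (B - H) \<union> {a} \<in> \<B>}"

definition non_incident :: "'e hat_edge \<Rightarrow> 'e hat_edge \<Rightarrow> bool" where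
  "non_incident a b \<longleftrightarrow> (\<exists>P Q. a = Hat P \<and> b = Hat Q \<and> P \<inter> Q = {})"

definition disjoint_bases :: "'a set set \<Rightarrow> 'a set \<times> 'a set \<Rightarrow> bool" where
  "disjoint_bases \<B> A \<longleftrightarrow> fst A \<in> \<B> \<and> snd A \<in> \<B> \<and> fst A \<inter> snd A = {}"

definition meets_in :: "'a set \<Rightarrow> 'a set \<times> 'a set \<Rightarrow> 'a \<Rightarrow> 'a \<Rightarrow> bool" where
  "meets_in H A a b \<longleftrightarrow> a \<noteq> b \<and> (fst A \<union> snd A) \<inter> H = {a, b}"

definition viable ::
  "'e hat_edge set set \<Rightarrow> 'e hat_edge set \<Rightarrow> 'e hat_edge set \<times> 'e hat_edge set \<Rightarrow> bool" where
  "viable \<B> H A \<longleftrightarrow> disjoint_bases \<B> A \<and>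
     (\<exists>a b. meets_in H A a b \<and>
        (non_incident a b \<or> {a, b} \<subseteq> fst A \<or> {a, b} \<subseteq> snd A))"

text \<open>\<open>reroute \<B> H e' f' A A'\<close> is the relation that is written as an arrow from \<open>A\<close> to \<open>A'\<close> with
  index \<open>e', f'\<close>.\<close>

definition reroute ::
  "'a set set \<Rightarrow> 'a set \<Rightarrow> 'a \<Rightarrow> 'a \<Rightarrow> 'a set \<times> 'a set \<Rightarrow> 'a set \<times> 'a set \<Rightarrow> bool" where
  "reroute \<B> H e' f' A A' \<longleftrightarrow>
     disjoint_bases \<B> A \<and> (\<exists>a b. meets_in H A a b) \<and>
     disjoint_bases \<B> A' \<and> meets_in H A' e' f' \<and>
     fst A' - H = fst A - H \<and> snd A' - H = snd A - H"

definition amenable ::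
  "'a set set \<Rightarrow> 'a set \<Rightarrow> 'a \<Rightarrow> 'a \<Rightarrow> 'a set \<times> 'a set \<Rightarrow> bool" where
  "amenable \<B> H e' f' A \<longleftrightarrow> (\<exists>A'. reroute \<B> H e' f' A A')"

definition symmetric_exchange ::
  "'a set set \<Rightarrow> 'a set \<times> 'a set \<Rightarrow> 'a set \<times> 'a set \<Rightarrow> bool" where
  "symmetric_exchange \<B> A A' \<longleftrightarrow>
     (\<exists>x \<in> fst A - snd A. \<exists>y \<in> snd A - fst A.
        fst A' = (fst A - {x}) \<union> {y} \<and> snd A' = (snd A - {y}) \<union> {x} \<and>
        fst A' \<in> \<B> \<and> snd A' \<in> \<B>)"

text \<open>Viability is required of the rerouted pairs only. Requiring it of \<open>A\<close> and \<open>B\<close> as well would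
  not change which viable pairs are switchable: rerouting and amenability depend only on what a pair
  has outside \<open>H\<close>, so a non-viable pair later in a chain can be replaced by the viable pair that it
  is rerouted to. It would, however, prevent any chain from leaving a non-viable pair, although
  switchability is considered for arbitrary pairs of disjoint bases.\<close>

definition curve_step ::
  "'e hat_edge set set \<Rightarrow> 'e hat_edge set \<Rightarrow> 'e hat_edge set \<times> 'e hat_edge set \<Rightarrow>
   'e hat_edge set \<times> 'e hat_edge set \<Rightarrow> bool" where
  "curve_step \<B> H A B \<longleftrightarrow>
     (\<exists>c\<^sub>1 c\<^sub>2 A' B'. viable \<B> H A' \<and> viable \<B> H B' \<and>
        reroute \<B> H c\<^sub>1 c\<^sub>2 A A' \<and> reroute \<B> H c\<^sub>1 c\<^sub>2 B B' \<and> symmetric_exchange \<B> A' B')"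

definition switchable ::
  "'e hat_edge set set \<Rightarrow> 'e hat_edge set \<Rightarrow> 'e hat_edge \<Rightarrow> 'e hat_edge \<Rightarrow>
   'e hat_edge set \<times> 'e hat_edge set \<Rightarrow> bool" where
  "switchable \<B> H e f B \<longleftrightarrow>
     (\<exists>B'. (curve_step \<B> H)\<^sup>*\<^sup>* B B' \<and>
        (\<exists>e' f'. e' \<in> H - {e, f} \<and> f' \<in> H - {e, f} \<and> non_incident e' f' \<and>
           amenable \<B> H e' f' B'))"

end

theory Submission
  imports Defs "HOL-Library.Z2" "HOL-Library.Function_Algebras"
begin

text \<open>A linear biased graph is a gain graph over an elementary abelian 2-group. An edge set is a flat of
  its frame matroid if it is cut out by vertex labellings: the vertices of one part are dead, the
  others carry group elements, and an edge is satisfied if its ends are both dead or their labels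
  add up to its gain. Recombining two labellings on a component gives the exchange property.

  In the v-deleted graph a labelling splits the four indices into classes, so that
  \<open>e\<^sub>i\<^sub>j\<close> with a hat is satisfied exactly if \<open>i\<close> and \<open>j\<close> lie in one class. If neither of the two
  pairs of crossing edges can be used, the hyperplanes \<open>A\<close> and \<open>D\<close> that are left of the two bases
  have the classes \<open>ps | qr\<close> and \<open>pr | qs\<close>. The edges of \<open>A\<close> whose endpoints carry labels form a
  tree. Exchanging one of them with \<open>e\<^sub>r\<^sub>s\<close> shows that outside of the span of \<open>D\<close> an edge separates
  \<open>p\<close> from \<open>s\<close> only if it separates \<open>q\<close> from \<open>r\<close>. Hence the four indices sit in the tree of \<open>A\<close>
  as the quartet \<open>pq | rs\<close>, and likewise in that of \<open>D\<close>. An exchange that is not covered by a chain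
  step would contradict this, or else it could be rerouted to a crossing pair.\<close>

section \<open>Matroids from closure operators\<close>

text \<open>Gains need no orientation because balance is linear: the balanced cycles are the cycles
  in a subspace of the binary space on the edges, and in the quotient by it every element is its own
  inverse. The obstacle is that opposed hyperplanes leave little freedom. With the classes
  \<open>ps | qr\<close> and \<open>pr | qs\<close>, the edges \<open>Hat {p, q}\<close> and
  \<open>Hat {r, s}\<close> are the only non-incident ones that complete one hyperplane each, so
  every chain step from the pair is routed through them. An exchange of \<open>x\<close> with
  \<open>y\<close> may leave hyperplanes that some edge of \<open>H\<close> completes and still
  block both placements of these two edges; non-switchability then says nothing about the new pair
  directly. Blocking means that both edges are spanned on one side or that one of them is spanned on
  both sides. In the first case the incoming edge would have to meet and to avoid the component of
  \<open>p\<close>. The second case needs another exchange, of the same \<open>x\<close> or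
  \<open>y\<close> with a different partner. The shape of the quartet itself comes from lopsided
  pairs, which have both edges in one basis.\<close>

locale closure_matroid =
  fixes cl :: "'a set \<Rightarrow> 'a set"
  assumes extensive: "A \<subseteq> cl A"
    and closure_least: "A \<subseteq> cl B \<Longrightarrow> cl A \<subseteq> cl B"
    and exchange: "x \<in> cl (insert y A) \<Longrightarrow> x \<notin> cl A \<Longrightarrow> y \<in> cl (insert x A)"
begin

lemma closure_mono: "A \<subseteq> B \<Longrightarrow> cl A \<subseteq> cl B"
  using extensive closure_least by blast

definition indep :: "'a set \<Rightarrow> bool" where
  "indep A \<longleftrightarrow> (\<forall>x\<in>A. x \<notin> cl (A - {x}))"

lemma indep_subset: "indep A \<Longrightarrow> B \<subseteq> A \<Longrightarrow> indep B"
  unfolding indep_def using closure_mono[of "B - {x}" "A - {x}" for x] by blast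

lemma indep_insert:
  assumes "indep A" "x \<notin> cl A"
  shows "indep (insert x A)"
  unfolding indep_def
proof
  fix z assume z: "z \<in> insert x A"
  have xA: "x \<notin> A"
    using assms(2) extensive by blast
  show "z \<notin> cl (insert x A - {z})"
  proof (cases "z = x")
    case True
    then show ?thesis
      using assms(2) xA by simp
  next
    case False
    then have "z \<in> A" "insert x A - {z} = insert x (A - {z})"
      using z by auto
    then show ?thesis
      using assms exchange[of z x "A - {z}"] unfolding indep_def by (auto simp: insert_absorb)
  qed
qed

lemma indep_insert_notin: "indep (insert x A) \<Longrightarrow> x \<notin> A \<Longrightarrow> x \<notin> cl A"
  unfolding indep_def by (metis Diff_insert_absorb insertI1)

text \<open>Steinitz replacement, by induction on \<open>card (A - B)\<close>. An element
  \<open>a\<close> outside \<open>B\<close> is dropped if \<open>B\<close> stays spanned; otherwise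
  some \<open>b\<close> in \<open>B\<close> is lost without \<open>a\<close>, and by the exchange
  law \<open>b\<close> can take the place of \<open>a\<close>.\<close>

lemma indep_card_le:
  assumes "finite A" "indep B" "B \<subseteq> cl A"
  shows "finite B \<and> card B \<le> card A"
  using assms
proof (induction "card (A - B)" arbitrary: A rule: less_induct)
  case less
  show ?case
  proof (cases "A \<subseteq> B")
    case True
    have "B \<subseteq> A"
    proof
      fix b assume b: "b \<in> B"
      show "b \<in> A"
      proof (rule ccontr)
        assume "b \<notin> A"
        then have "A \<subseteq> B - {b}"
          using True by blast
        then have "b \<in> cl (B - {b})"
          using closure_mono less.prems(3) b by blast
        then show False
          using less.prems(2) b unfolding indep_def by blast
      qed
    qed
    then show ?thesis
      using True less.prems(1) by (simp add: subset_antisym)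
  next
    case False
    then obtain a where a: "a \<in> A" "a \<notin> B" by blast
    show ?thesis
    proof (cases "B \<subseteq> cl (A - {a})")
      case True
      have "card (A - {a} - B) < card (A - B)"
        using a less.prems(1) by (intro psubset_card_mono) auto
      then have "finite B \<and> card B \<le> card (A - {a})"
        using less.hyps[of "A - {a}"] less.prems True by simp
      then show ?thesis
        using card_Diff1_le[of A a] by linarith
    next
      case False
      then obtain b where b: "b \<in> B" "b \<notin> cl (A - {a})" by blast
      define A' where "A' = insert b (A - {a})"
      have "b \<in> cl (insert a (A - {a}))"
        using b(1) less.prems(3) a(1) by (auto simp: insert_absorb)
      then have "a \<in> cl A'"
        using exchange b(2) unfolding A'_def by blast
      then have "A \<subseteq> cl A'"
        using extensive[of A'] unfolding A'_def by blast
      then have B: "B \<subseteq> cl A'"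
        using closure_least less.prems(3) by blast
      have "card (A' - B) < card (A - B)"
        using a b less.prems(1) unfolding A'_def by (intro psubset_card_mono) auto
      then have "finite B \<and> card B \<le> card A'"
        using less.hyps[of A'] less.prems B unfolding A'_def by simp
      moreover have "card A' \<le> card A"
      proof -
        have "card A' \<le> Suc (card (A - {a}))"
          unfolding A'_def by (simp add: less.prems(1) card_insert_if)
        then show ?thesis
          using card_Suc_Diff1[OF less.prems(1) a(1)] by linarith
      qed
      ultimately show ?thesis by linarith
    qed
  qed
qed

definition bases :: "'a set \<Rightarrow> 'a set set" where
  "bases E = {B. B \<subseteq> E \<and> indep B \<and> (\<forall>A\<subseteq>E. indep A \<longrightarrow> B \<subseteq> A \<longrightarrow> A = B)}"

lemma bases_spanning:
  assumes "B \<in> bases E"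
  shows "E \<subseteq> cl B"
proof
  fix x assume x: "x \<in> E"
  show "x \<in> cl B"
  proof (rule ccontr)
    assume "x \<notin> cl B"
    moreover from this have "x \<notin> B"
      using extensive by blast
    ultimately show False
      using assms x indep_insert[of B x] unfolding bases_def by blast
  qed
qed

lemma bases_card_eq:
  assumes "finite E" "A \<in> bases E" "B \<in> bases E"
  shows "card A = card B"
proof -
  have "A \<subseteq> E" "B \<subseteq> E" "indep A" "indep B"
    using assms unfolding bases_def by auto
  moreover from this have "finite A" "finite B" "B \<subseteq> cl A" "A \<subseteq> cl B"
    using bases_spanning[OF assms(2)] bases_spanning[OF assms(3)] assms(1)
    by (auto intro: finite_subset)
  ultimately show ?thesis
    using indep_card_le[of A B] indep_card_le[of B A] by simp
qed

lemma indep_card_basis: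
  assumes "finite E" "B \<in> bases E" "A \<subseteq> E" "indep A" "card A = card B"
  shows "A \<in> bases E"
proof -
  have "A' = A" if "A' \<subseteq> E" "indep A'" "A \<subseteq> A'" for A'
  proof -
    have "card A' \<le> card B"
      using indep_card_le[of B A'] bases_spanning[OF assms(2)] that assms(1,2)
      unfolding bases_def by (auto dest: finite_subset)
    then show ?thesis
      using that assms card_seteq[of A' A] finite_subset[of A' E] by simp
  qed
  then show ?thesis
    using assms unfolding bases_def by blast
qed

text \<open>\<open>A\<close> is independent and one element short of a basis, so an element outside
  its closure brings it to the common size of the bases. With an element inside its closure it could
  not span \<open>b\<close>.\<close>

lemma insert_in_bases_iff:
  assumes "finite E" "insert b A \<in> bases E" "b \<notin> A" "x \<in> E"
  shows "insert x A \<in> bases E \<longleftrightarrow> x \<notin> cl A"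
proof
  assume x: "x \<notin> cl A"
  have A: "A \<subseteq> E" "indep A" "finite A"
    using assms indep_subset[of "insert b A" A] finite_subset unfolding bases_def by auto
  have "x \<notin> A"
    using x extensive by blast
  then have "card (insert x A) = card (insert b A)"
    using A assms by simp
  then show "insert x A \<in> bases E"
    using indep_card_basis[OF assms(1,2)] indep_insert[OF A(2) x] A assms by simp
next
  assume x: "insert x A \<in> bases E"
  show "x \<notin> cl A"
  proof
    assume xA: "x \<in> cl A"
    have b: "b \<in> E" "indep (insert b A)"
      using assms(2) unfolding bases_def by auto
    have "insert x A \<subseteq> cl A"
      using xA extensive by blast
    then have "cl (insert x A) \<subseteq> cl A"
      by (rule closure_least)
    then have "b \<in> cl A"
      using b(1) bases_spanning[OF x] by blast
    then show False
      using indep_insert_notin[OF b(2) assms(3)] by simp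
  qed
qed

end

section \<open>Labellings of gain graphs\<close>

text \<open>The value \<open>None\<close> marks the vertices of the part that is treated as unbalanced. A loop is
  satisfied only there.\<close>

definition satisfies :: "('v \<Rightarrow> 'g::ab_group_add option) \<Rightarrow> 'v set \<Rightarrow> 'g \<Rightarrow> bool" where
  "satisfies \<theta> E g \<longleftrightarrow> (\<forall>u w. E = {u, w} \<longrightarrow>
     \<theta> u = None \<and> \<theta> w = None \<or>
     u \<noteq> w \<and> (\<exists>a b. \<theta> u = Some a \<and> \<theta> w = Some b \<and> a + b = g))"

lemma satisfies_loop: "satisfies \<theta> {u} g \<longleftrightarrow> \<theta> u = None"
  unfolding satisfies_def by auto

lemma satisfies_link:
  assumes "u \<noteq> w"
  shows "satisfies \<theta> {u, w} g \<longleftrightarrow>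
     \<theta> u = None \<and> \<theta> w = None \<or> (\<exists>a b. \<theta> u = Some a \<and> \<theta> w = Some b \<and> a + b = g)"
proof
  assume "satisfies \<theta> {u, w} g"
  then show "\<theta> u = None \<and> \<theta> w = None \<or> (\<exists>a b. \<theta> u = Some a \<and> \<theta> w = Some b \<and> a + b = g)"
    unfolding satisfies_def by blast
next
  assume *: "\<theta> u = None \<and> \<theta> w = None \<or> (\<exists>a b. \<theta> u = Some a \<and> \<theta> w = Some b \<and> a + b = g)"
  then have **: "\<theta> w = None \<and> \<theta> u = None \<or> (\<exists>a b. \<theta> w = Some a \<and> \<theta> u = Some b \<and> a + b = g)"
    by (auto simp: add.commute)
  then show "satisfies \<theta> {u, w} g"
    unfolding satisfies_def
  proof (intro allI impI)
    fix u' w' assume "{u, w} = {u', w'}"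
    then have "u = u' \<and> w = w' \<or> u = w' \<and> w = u'"
      by (simp add: doubleton_eq_iff)
    then show "\<theta> u' = None \<and> \<theta> w' = None \<or>
        u' \<noteq> w' \<and> (\<exists>a b. \<theta> u' = Some a \<and> \<theta> w' = Some b \<and> a + b = g)"
    proof
      assume "u = u' \<and> w = w'"
      then show ?thesis using * assms by simp
    next
      assume "u = w' \<and> w = u'"
      then show ?thesis using ** assms by simp
    qed
  qed
qed

lemma satisfies_None_iff: "satisfies \<theta> {u, w} g \<Longrightarrow> \<theta> u = None \<longleftrightarrow> \<theta> w = None"
  unfolding satisfies_def by (metis option.distinct(1))

lemma satisfies_None: "\<theta> u = None \<Longrightarrow> \<theta> w = None \<Longrightarrow> satisfies \<theta> {u, w} g"
  by (cases "u = w") (auto simp: satisfies_loop satisfies_link)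

lemma satisfies_cong:
  assumes "\<theta> u = \<theta>' u" "\<theta> w = \<theta>' w"
  shows "satisfies \<theta> {u, w} g \<longleftrightarrow> satisfies \<theta>' {u, w} g"
  using assms by (cases "u = w") (auto simp: satisfies_loop satisfies_link)

definition glue :: "'v set \<Rightarrow> ('v \<Rightarrow> 'g option) \<Rightarrow> ('v \<Rightarrow> 'g option) \<Rightarrow> 'v \<Rightarrow> 'g option" where
  "glue K \<theta> \<theta>' = (\<lambda>u. if u \<in> K then \<theta> u else \<theta>' u)"

lemma glue_in [simp]: "u \<in> K \<Longrightarrow> glue K \<theta> \<theta>' u = \<theta> u"
  and glue_out [simp]: "u \<notin> K \<Longrightarrow> glue K \<theta> \<theta>' u = \<theta>' u"
  unfolding glue_def by auto

definition shift :: "'g::ab_group_add \<Rightarrow> ('v \<Rightarrow> 'g option) \<Rightarrow> 'v \<Rightarrow> 'g option" where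
  "shift c \<theta> = map_option ((+) c) \<circ> \<theta>"

lemma shift_eq_None [simp]: "shift c \<theta> u = None \<longleftrightarrow> \<theta> u = None"
  and shift_Some: "\<theta> u = Some a \<Longrightarrow> shift c \<theta> u = Some (c + a)"
  unfolding shift_def by auto

text \<open>Exponent two makes the condition on an edge symmetric in its ends. The type of
  \<open>ends\<close> allows any set; an edge that does not have one or two ends is satisfied
  vacuously.\<close>

locale gain_graph =
  fixes ends :: "'e \<Rightarrow> 'v set" and gain :: "'e \<Rightarrow> 'g::ab_group_add"
  assumes char2: "(a::'g) + a = 0"
begin

lemma add_self_left: "(a::'g) + (a + b) = b"
  by (metis add.assoc add_0 char2)

lemma add_eq_iff: "(a::'g) + b = c \<longleftrightarrow> b = a + c"
  using add_self_left by metis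

lemma add_eq_0: "(a::'g) + b = 0 \<longleftrightarrow> a = b"
  using add_eq_iff[of a b 0] by auto

lemma satisfies_shift: "satisfies (shift c \<theta>) {u, w} (g::'g) \<longleftrightarrow> satisfies \<theta> {u, w} g"
proof (cases "u = w")
  case False
  have "c + a + (c + b) = a + b" for a b :: 'g
    by (metis add.assoc add.commute add_self_left)
  then show ?thesis
    using False by (fastforce simp: satisfies_link shift_def)
qed (simp add: satisfies_loop)

abbreviation sat :: "('v \<Rightarrow> 'g option) \<Rightarrow> 'e \<Rightarrow> bool" where
  "sat \<theta> x \<equiv> satisfies \<theta> (ends x) (gain x)"

definition models :: "('v \<Rightarrow> 'g option) \<Rightarrow> 'e set \<Rightarrow> bool" where
  "models \<theta> A \<longleftrightarrow> (\<forall>x\<in>A. sat \<theta> x)"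

lemma models_subset: "models \<theta> A \<Longrightarrow> B \<subseteq> A \<Longrightarrow> models \<theta> B"
  and models_insert [simp]: "models \<theta> (insert x A) \<longleftrightarrow> sat \<theta> x \<and> models \<theta> A"
  unfolding models_def by auto

definition span :: "'e set \<Rightarrow> 'e set" where
  "span A = {x. \<forall>\<theta>. models \<theta> A \<longrightarrow> sat \<theta> x}"

definition reach :: "'e set \<Rightarrow> 'v \<Rightarrow> 'v \<Rightarrow> bool" where
  "reach A = (\<lambda>u w. \<exists>x\<in>A. ends x = {u, w})\<^sup>*\<^sup>*"

text \<open>These are the unions of components of \<open>A\<close>, as vertex sets; a labelling can
  be changed on such a set without regard to the rest.\<close>

definition closed :: "'e set \<Rightarrow> 'v set \<Rightarrow> bool" where
  "closed A K \<longleftrightarrow> (\<forall>x\<in>A. \<forall>u w. ends x = {u, w} \<longrightarrow> (u \<in> K \<longleftrightarrow> w \<in> K))"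

lemma reach_refl [simp]: "reach A u u"
  and reach_trans: "reach A u w \<Longrightarrow> reach A w z \<Longrightarrow> reach A u z"
  and reach_edge: "x \<in> A \<Longrightarrow> ends x = {u, w} \<Longrightarrow> reach A u w"
  unfolding reach_def by auto

lemma reach_step: "reach A u w \<Longrightarrow> x \<in> A \<Longrightarrow> ends x = {w, z} \<Longrightarrow> reach A u z"
  using reach_trans reach_edge by blast

lemma reach_induct [consumes 1, case_names refl step]:
  assumes "reach A u w" "P u"
    and "\<And>w z x. reach A u w \<Longrightarrow> P w \<Longrightarrow> x \<in> A \<Longrightarrow> ends x = {w, z} \<Longrightarrow> P z"
  shows "P w"
  using assms(1) unfolding reach_def
  by (induction rule: rtranclp_induct) (use assms(2,3) in \<open>auto simp: reach_def\<close>)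

lemma reach_sym: "reach A u w \<Longrightarrow> reach A w u"
proof (induction rule: reach_induct)
  case (step w z x)
  then show ?case
    using reach_edge[of x A z w] reach_trans by (metis insert_commute)
qed simp

lemma reach_mono: "reach A u w \<Longrightarrow> A \<subseteq> B \<Longrightarrow> reach B u w"
  by (induction rule: reach_induct) (auto intro: reach_step)

lemma closed_reach: "closed A K \<Longrightarrow> reach A u w \<Longrightarrow> u \<in> K \<Longrightarrow> w \<in> K"
  by (rotate_tac 1, induction rule: reach_induct) (auto simp: closed_def)

lemma closed_component: "closed A {w. reach A u w}"
  unfolding closed_def using reach_step by (metis (mono_tags, lifting) insert_commute mem_Collect_eq)

lemma models_glue:
  assumes "models \<theta> A" "models \<theta>' A" "closed A K"
  shows "models (glue K \<theta> \<theta>') A"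
  unfolding models_def
proof
  fix x assume x: "x \<in> A"
  show "sat (glue K \<theta> \<theta>') x"
  proof (cases "\<exists>u w. ends x = {u, w}")
    case True
    then obtain u w where e: "ends x = {u, w}" by blast
    then have "u \<in> K \<longleftrightarrow> w \<in> K"
      using assms(3) x unfolding closed_def by blast
    moreover have "sat \<theta> x" "sat \<theta>' x"
      using assms x unfolding models_def by auto
    ultimately show ?thesis
      unfolding e using satisfies_cong[of "glue K \<theta> \<theta>'" u \<theta> w]
        satisfies_cong[of "glue K \<theta> \<theta>'" u \<theta>' w] by (cases "u \<in> K") auto
  qed (auto simp: satisfies_def)
qed

lemma models_shift: "models \<theta> A \<Longrightarrow> models (shift c \<theta>) A"
  unfolding models_def
proof
  fix x assume "\<forall>x\<in>A. sat \<theta> x" "x \<in> A"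
  then show "sat (shift c \<theta>) x"
    by (cases "\<exists>u w. ends x = {u, w}") (auto simp: satisfies_shift, auto simp: satisfies_def)
qed

lemma models_None: "models (\<lambda>_. None) A"
  unfolding models_def satisfies_def by simp

lemma alive_reach:
  assumes "reach A u w" "models \<theta> A"
  shows "\<theta> u = None \<longleftrightarrow> \<theta> w = None"
  using assms(1)
proof (induction rule: reach_induct)
  case (step w z x)
  then show ?case
    using assms(2) satisfies_None_iff unfolding models_def by metis
qed simp

text \<open>Crossing an edge adds its gain to both labels, so the gain cancels in their sum, which
  in exponent two is also their difference.\<close>

lemma difference_reach:
  assumes "reach A u w" "models \<theta> A" "models \<theta>' A" "\<theta> u = Some a" "\<theta>' u = Some a'"
  shows "\<exists>b b'. \<theta> w = Some b \<and> \<theta>' w = Some b' \<and> b + b' = a + a'"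
  using assms(1)
proof (induction rule: reach_induct)
  case refl
  then show ?case using assms(4,5) by simp
next
  case (step w z x)
  then obtain b b' where b: "\<theta> w = Some b" "\<theta>' w = Some b'" "b + b' = a + a'" by blast
  have "satisfies \<theta> {w, z} (gain x)" "satisfies \<theta>' {w, z} (gain x)"
    using step assms unfolding models_def by metis+
  moreover from this have "w \<noteq> z"
    using b by (auto simp: satisfies_loop)
  ultimately obtain c c' where c: "\<theta> z = Some c" "\<theta>' z = Some c'" "b + c = gain x" "b' + c' = gain x"
    using b by (auto simp: satisfies_link)
  then have "c = b + gain x" "c' = b' + gain x"
    using add_eq_iff by auto
  then have "c + c' = b + b' + (gain x + gain x)"
    by (simp add: add.commute add.left_commute)
  then show ?case
    using b c char2 by auto
qed

text \<open>For two labellings that satisfy \<open>A\<close>, on a component of \<open>A\<close> either one of them vanishes or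
  they differ by a constant. So they can be recombined after a shift on one component.\<close>

lemma constraint_exchange:
  assumes dep: "\<And>\<theta>. models \<theta> (insert y A) \<Longrightarrow> satisfies \<theta> {s, t} g"
    and \<theta>0: "models \<theta>0 A" "\<not> satisfies \<theta>0 {s, t} g"
    and \<theta>: "models \<theta> A" "satisfies \<theta> {s, t} g"
  shows "sat \<theta> y"
proof -
  \<comment> \<open>Here \<open>s\<close> is alive in \<open>\<theta>0\<close>. If it is dead, the
    violated constraint has \<open>t\<close> alive, and the two ends trade places at the end of the
    proof.\<close>
  have main: "sat \<theta> y" if dep: "\<And>\<theta>. models \<theta> (insert y A) \<Longrightarrow> satisfies \<theta> {s, t} g"
    and n0: "\<not> satisfies \<theta>0 {s, t} g" and st: "satisfies \<theta> {s, t} g"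
    and s: "\<theta>0 s = Some a0" for s t a0
  proof (rule ccontr)
    assume ny: "\<not> sat \<theta> y"
    then obtain u0 w0 where y0: "ends y = {u0, w0}"
      unfolding satisfies_def by blast
    define K where "K = {w. reach A s w}"
    have clK: "closed A K"
      unfolding K_def by (rule closed_component)
    have sK: "s \<in> K"
      unfolding K_def by simp
    have alive0: "\<exists>a. \<theta>0 v = Some a" if "v \<in> K" for v
      using alive_reach[of A s v \<theta>0] that s \<theta>0(1) unfolding K_def by auto
    \<comment> \<open>Killing \<open>\<theta>0\<close> off the component of \<open>s\<close> keeps
      the violation, so \<open>\<theta>1\<close> must fail at \<open>y\<close>. Two dead ends would
      satisfy \<open>y\<close>, hence \<open>y\<close> has an end in \<open>K\<close>.\<close>
    define \<theta>1 where "\<theta>1 = glue K \<theta>0 (\<lambda>_. None)"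
    have m1: "models \<theta>1 A"
      unfolding \<theta>1_def using models_glue \<theta>0(1) models_None clK by blast
    have "\<not> satisfies \<theta>1 {s, t} g"
    proof (cases "t \<in> K")
      case True
      then show ?thesis
        using n0 satisfies_cong[of \<theta>1 s \<theta>0 t] sK unfolding \<theta>1_def by simp
    next
      case False
      then show ?thesis
        using satisfies_None_iff[of \<theta>1 s t g] sK s unfolding \<theta>1_def by auto
    qed
    then have "\<not> sat \<theta>1 y"
      using dep m1 by auto
    then have "u0 \<in> K \<or> w0 \<in> K"
      using satisfies_None[of \<theta>1 u0 w0 "gain y"] unfolding y0 \<theta>1_def glue_def by metis
    then obtain u w where y: "ends y = {u, w}" and uK: "u \<in> K"
      using y0 insert_commute by metis
    obtain a where a: "\<theta>0 u = Some a"
      using alive0 uK by blast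
    show False
    proof (cases "\<theta> s")
      case None
      have deadK: "\<theta> v = None" if "v \<in> K" for v
        using alive_reach[of A s v \<theta>] None that \<theta>(1) unfolding K_def by simp
      have w: "\<theta> w \<noteq> None"
        using ny deadK[OF uK] satisfies_None unfolding y by metis
      then have wK: "w \<notin> K"
        using deadK by metis
      obtain b where b: "\<theta> w = Some b"
        using w by auto
      \<comment> \<open>\<open>\<theta>\<close> is dead on \<open>K\<close>, so
        \<open>\<theta>0\<close> is grafted there, shifted by the constant that makes
        \<open>y\<close> satisfied.\<close>
      define c where "c = a + b + gain y"
      define \<theta>2 where "\<theta>2 = glue K (shift c \<theta>0) \<theta>"
      have m2: "models \<theta>2 A"
        unfolding \<theta>2_def using models_glue models_shift \<theta>0 \<theta> clK by blast
      have "c + a + b = gain y"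
        unfolding c_def by (metis add.assoc add.commute add_self_left)
      moreover have "u \<noteq> w"
        using uK wK by blast
      ultimately have "sat \<theta>2 y"
        unfolding y using uK wK shift_Some[of \<theta>0 u a c] a b
        by (auto simp: satisfies_link \<theta>2_def)
      then have "satisfies \<theta>2 {s, t} g"
        using dep m2 by simp
      moreover have "\<not> satisfies \<theta>2 {s, t} g"
      proof (cases "t \<in> K")
        case True
        then show ?thesis
          using n0 satisfies_cong[of \<theta>2 s "shift c \<theta>0" t] sK satisfies_shift[of c \<theta>0 s t g]
          unfolding \<theta>2_def by simp
      next
        case False
        then show ?thesis
          using satisfies_None_iff[of \<theta>2 s t g] satisfies_None_iff[OF st] sK s None
          unfolding \<theta>2_def by auto
      qed
      ultimately show False by blast
    next
      case (Some a1)
      \<comment> \<open>On \<open>K\<close> the two live labellings differ by a constant, so they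
        would agree about the constraint between \<open>s\<close> and \<open>t\<close>.\<close>
      have tK: "t \<notin> K"
      proof
        assume tK: "t \<in> K"
        then obtain b b' where b: "\<theta> t = Some b" "\<theta>0 t = Some b'" "b + b' = a1 + a0"
          using difference_reach[of A s t \<theta> \<theta>0 a1 a0] Some s \<theta> \<theta>0 unfolding K_def by blast
        have ne: "s \<noteq> t"
          using st Some by (auto simp: satisfies_loop)
        then have "a1 + b = g"
          using st Some b by (auto simp: satisfies_link)
        moreover have "a0 + b' = a1 + b"
          using b(3) by (metis add.commute add.assoc add_self_left)
        ultimately have "satisfies \<theta>0 {s, t} g"
          using ne b s by (auto simp: satisfies_link)
        then show False using n0 by blast
      qed
      obtain b1 where b1: "\<theta> t = Some b1"
        using satisfies_None_iff[OF st] Some by auto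
      have ne: "s \<noteq> t"
        using sK tK by blast
      then have ab1: "a1 + b1 = g"
        using st Some b1 by (auto simp: satisfies_link)
      obtain a2 where a2: "\<theta> u = Some a2"
        using alive_reach[of A s u \<theta>] Some uK \<theta>(1) unfolding K_def by auto
      show False
      proof (cases "w \<in> K \<or> \<theta> w = None")
        case True
        define \<theta>2 where "\<theta>2 = glue K (\<lambda>_. None) \<theta>"
        have "models \<theta>2 A"
          unfolding \<theta>2_def using models_glue \<theta> models_None clK by blast
        moreover have "sat \<theta>2 y"
          unfolding y \<theta>2_def using True uK by (intro satisfies_None) (auto simp: glue_def)
        ultimately have "satisfies \<theta>2 {s, t} g"
          using dep by simp
        then show False
          using satisfies_None_iff[of \<theta>2 s t g] sK tK b1 unfolding \<theta>2_def by simp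
      next
        case False
        then obtain b where b: "\<theta> w = Some b" and wK: "w \<notin> K" by auto
        \<comment> \<open>The shift on \<open>K\<close> that repairs \<open>y\<close> moves the
          label of \<open>s\<close> but not that of \<open>t\<close>. The constraint then forces it
          to be zero, so \<open>y\<close> was satisfied already.\<close>
        define c where "c = a2 + b + gain y"
        define \<theta>2 where "\<theta>2 = glue K (shift c \<theta>) \<theta>"
        have m2: "models \<theta>2 A"
          unfolding \<theta>2_def using models_glue models_shift \<theta> clK by blast
        have "c + a2 + b = gain y"
          unfolding c_def by (metis add.assoc add.commute add_self_left)
        moreover have "u \<noteq> w"
          using uK wK by blast
        ultimately have "sat \<theta>2 y"
          unfolding y using uK wK shift_Some[of \<theta> u a2 c] a2 b
          by (auto simp: satisfies_link \<theta>2_def)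
        then have "satisfies \<theta>2 {s, t} g"
          using dep m2 by simp
        then have "c + a1 + b1 = g"
          using ne sK tK shift_Some[of \<theta> s a1 c] Some b1 by (auto simp: satisfies_link \<theta>2_def)
        then have "c = 0"
          using ab1 by (metis add.assoc add_right_cancel add_0)
        then have "a2 + b = gain y"
          unfolding c_def using add_eq_0 by simp
        moreover have "u \<noteq> w"
          using uK wK by blast
        ultimately show False
          using ny a2 b satisfies_link[of u w \<theta> "gain y"] unfolding y by simp
      qed
    qed
  qed
  show ?thesis
  proof (cases "\<theta>0 s")
    case None
    then obtain b where b: "\<theta>0 t = Some b"
      using \<theta>0(2) satisfies_None[of \<theta>0 s t g] by auto
    have "{s, t} = {t, s}" by blast
    then show ?thesis
      using main[of t s b] dep \<theta>0(2) \<theta>(2) b by simp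
  next
    case (Some a)
    then show ?thesis
      using main[of s t a] dep \<theta>0(2) \<theta>(2) by blast
  qed
qed

sublocale closure_matroid span
proof
  show "A \<subseteq> span A" for A
    unfolding span_def models_def by blast
  show "span A \<subseteq> span B" if "A \<subseteq> span B" for A B
    using that unfolding span_def models_def by blast
  show "y \<in> span (insert x A)" if x: "x \<in> span (insert y A)" "x \<notin> span A" for x y A
  proof -
    obtain \<theta>0 where \<theta>0: "models \<theta>0 A" "\<not> sat \<theta>0 x"
      using x(2) unfolding span_def by blast
    then obtain s t where st: "ends x = {s, t}"
      unfolding satisfies_def by blast
    show ?thesis
      unfolding span_def
    proof (intro CollectI allI impI)
      fix \<theta> assume "models \<theta> (insert x A)"
      then show "sat \<theta> y"
        using constraint_exchange[of y A s t "gain x" \<theta>0 \<theta>] \<theta>0 x(1) st unfolding span_def by simp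
    qed
  qed
qed

lemma constraint_span_Diff:
  assumes A: "indep A" and fin: "finite Z" "Z \<subseteq> A"
    and Z: "\<And>z \<theta>. z \<in> Z \<Longrightarrow> models \<theta> (A - {z}) \<Longrightarrow> satisfies \<theta> {s, t} g"
    and c: "\<And>\<theta>. models \<theta> A \<Longrightarrow> satisfies \<theta> {s, t} g"
    and \<theta>: "models \<theta> (A - Z)"
  shows "satisfies \<theta> {s, t} g"
  using fin Z \<theta>
proof (induction Z arbitrary: \<theta> rule: finite_induct)
  case empty
  then show ?case using c by simp
next
  case (insert z Z)
  have IH: "satisfies \<theta> {s, t} g" if "models \<theta> (A - Z)" for \<theta>
    using insert.IH[of \<theta>] insert.prems that by auto
  define C where "C = A - insert z Z"
  have z: "insert z C = A - Z"
    using insert.hyps insert.prems unfolding C_def by auto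
  show ?case
  proof (rule ccontr)
    assume n: "\<not> satisfies \<theta> {s, t} g"
    \<comment> \<open>The exchange property makes \<open>z\<close> a consequence of \<open>C\<close>
      and the constraint, and both of these follow from \<open>A - {z}\<close>.\<close>
    have "z \<in> span (A - {z})"
      unfolding span_def
    proof (intro CollectI allI impI)
      fix \<theta>' assume m: "models \<theta>' (A - {z})"
      then have "satisfies \<theta>' {s, t} g"
        using insert.prems by blast
      moreover have "models \<theta>' C"
        using m by (rule models_subset) (auto simp: C_def)
      ultimately show "sat \<theta>' z"
        using constraint_exchange[of z C s t g \<theta> \<theta>'] IH n insert.prems unfolding z
        by (simp add: C_def)
    qed
    then show False
      using A insert.prems unfolding indep_def by blast
  qed
qed

text \<open>The components of \<open>A\<close> that are not dead in \<open>\<theta>\<close> are trees.\<close>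

lemma separating_edge:
  assumes A: "indep A" "finite A" and \<theta>: "models \<theta> A" "\<theta> u = Some a"
    and uw: "reach A u w" "\<not> reach B u w" "B \<subseteq> A"
  shows "\<exists>z\<in>A - B. \<not> reach (A - {z}) u w"
proof (rule ccontr)
  assume "\<not> ?thesis"
  then have r: "reach (A - {z}) u w" if "z \<in> A - B" for z
    using that by blast
  obtain b where b: "\<theta> w = Some b"
    using difference_reach[OF uw(1) \<theta>(1) \<theta>(1) \<theta>(2) \<theta>(2)] by blast
  have ne: "u \<noteq> w"
    using uw(2) by auto
  \<comment> \<open>Connection becomes a constraint: a labelling of a subset that still connects
    \<open>u\<close> with \<open>w\<close> relates their labels as \<open>\<theta>\<close> does,
    with gain \<open>a + b\<close>.\<close>
  have c: "satisfies \<theta>' {u, w} (a + b)"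
    if C: "C \<subseteq> A" "reach C u w" "models \<theta>' C" for C \<theta>'
  proof (cases "\<theta>' u")
    case None
    then show ?thesis
      using alive_reach[OF C(2,3)] satisfies_None by metis
  next
    case (Some a')
    then obtain b1 b' where "\<theta> w = Some b1" "\<theta>' w = Some b'" "b1 + b' = a + a'"
      using difference_reach[OF C(2) models_subset[OF \<theta>(1) C(1)] C(3) \<theta>(2)] by blast
    moreover from this have "a' + b' = a + b"
      using b by (metis add.commute add.assoc add_self_left option.inject)
    ultimately show ?thesis
      using ne Some by (auto simp: satisfies_link)
  qed
  \<comment> \<open>This labelling of \<open>B\<close> is alive at \<open>u\<close> and dead at
    \<open>w\<close>, against the constraint that survives when all of \<open>A - B\<close> is
    dropped.\<close>
  define \<theta>1 where "\<theta>1 = glue {v. reach B u v} \<theta> (\<lambda>_. None)"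
  have "A - (A - B) = B"
    using uw(3) by blast
  moreover have "models \<theta>1 B"
    unfolding \<theta>1_def using models_glue closed_component models_None models_subset[OF \<theta>(1) uw(3)]
    by blast
  ultimately have "satisfies \<theta>1 {u, w} (a + b)"
    using constraint_span_Diff[OF A(1), of "A - B" u w "a + b" \<theta>1] A(2)
      c[OF Diff_subset r] c[OF order_refl uw(1)] by simp
  then show False
    using satisfies_None_iff[of \<theta>1 u w "a + b"] uw(2) \<theta>(2) unfolding \<theta>1_def by auto
qed

lemma reach_insert_cases:
  assumes "reach (insert x A) u w" "ends x = {s, t}"
  shows "reach A u w \<or> reach A u s \<and> reach A t w \<or> reach A u t \<and> reach A s w"
  using assms(1)
proof (induction rule: reach_induct)
  case (step w z y)
  show ?case
  proof (cases "y = x")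
    case True
    then have "w = s \<and> z = t \<or> w = t \<and> z = s"
      using step assms(2) by (auto simp: doubleton_eq_iff)
    then show ?thesis
      using step.IH reach_trans reach_sym reach_refl by metis
  next
    case False
    then have "y \<in> A" using step by blast
    then show ?thesis
      using step.IH step.hyps(3) reach_step step(4) by metis
  qed
qed simp

end

section \<open>The frame matroid of a gain graph\<close>

text \<open>Loops are unbalanced whatever their gain, in agreement with \<open>satisfies\<close>,
  where a loop is satisfied only at a dead vertex.\<close>

locale biased_gain_graph = gain_graph "ends G" \<gamma>
  for G :: "('v, 'e) mgraph" and \<gamma> :: "'e \<Rightarrow> 'g::ab_group_add" +
  fixes \<C> :: "'e set set"
  assumes graph: "graph G"
    and balanced_iff: "cycle G X \<Longrightarrow> X \<in> \<C> \<longleftrightarrow> (\<forall>x\<in>X. \<not> loop G x) \<and> sum \<gamma> X = 0"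
begin

lemma finite_edges: "finite (edges G)"
  using graph unfolding graph_def by blast

lemma edge_ends:
  assumes "x \<in> edges G"
  obtains u w where "ends G x = {u, w}"
proof -
  have "card (ends G x) = 1 \<or> card (ends G x) = 2"
    using assms graph unfolding graph_def by blast
  then show ?thesis
    using that by (metis card_1_singletonE card_2_iff insert_absorb2)
qed

lemma loop_iff: "loop G x \<longleftrightarrow> (\<exists>u. ends G x = {u})"
  unfolding loop_def by (simp add: card_1_singleton_iff)

lemma reach_ends:
  assumes "x \<in> A" "A \<subseteq> edges G" "u \<in> ends G x" "w \<in> ends G x"
  shows "reach A u w"
proof -
  obtain a b where ab: "ends G x = {a, b}"
    using edge_ends assms by blast
  then have "reach A a b" "reach A b a"
    using reach_edge[of x A a b] reach_sym assms(1) by auto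
  then show ?thesis
    using assms(3,4) ab by auto
qed

text \<open>Components are defined through edges that share ends, labellings live on vertices; this
  translates between the two.\<close>

lemma connected_iff_reach:
  assumes A: "A \<subseteq> edges G" and xy: "x \<in> A" "y \<in> A" "u \<in> ends G x" "w \<in> ends G y"
  shows "(x, y) \<in> (adjacent_in G A)\<^sup>+ \<longleftrightarrow> reach A u w"
proof
  assume "(x, y) \<in> (adjacent_in G A)\<^sup>+"
  then have "\<forall>w\<in>ends G y. reach A u w"
  proof (induction rule: trancl_induct)
    case (base y)
    then obtain z where "z \<in> ends G x" "z \<in> ends G y" "y \<in> A"
      unfolding adjacent_in_def by blast
    then show ?case
      using reach_ends A xy reach_trans by metis
  next
    case (step y y')
    then obtain z where "z \<in> ends G y" "z \<in> ends G y'" "y' \<in> A"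
      unfolding adjacent_in_def by blast
    then show ?case
      using reach_ends A step.IH reach_trans by metis
  qed
  then show "reach A u w" using xy by blast
next
  have adj: "(y, y') \<in> adjacent_in G A" if "y \<in> A" "y' \<in> A" "z \<in> ends G y" "z \<in> ends G y'" for y y' z
    using that unfolding adjacent_in_def by blast
  assume "reach A u w"
  then have "\<forall>y\<in>A. w \<in> ends G y \<longrightarrow> (x, y) \<in> (adjacent_in G A)\<^sup>+"
  proof (induction rule: reach_induct)
    case refl
    then show ?case using adj xy by blast
  next
    case (step w z e)
    then have "(x, e) \<in> (adjacent_in G A)\<^sup>+" by simp
    then show ?case
      using adj[OF \<open>e \<in> A\<close>, of _ z] \<open>ends G e = {w, z}\<close> by (auto intro: trancl_into_trancl)
  qed
  then show "(x, y) \<in> (adjacent_in G A)\<^sup>+" using xy by blast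
qed

lemma equiv_connected:
  assumes "A \<subseteq> edges G"
  shows "equiv A ((adjacent_in G A)\<^sup>+)"
proof (rule equivI)
  show "(adjacent_in G A)\<^sup>+ \<subseteq> A \<times> A"
    by (rule trancl_subset_Sigma) (auto simp: adjacent_in_def)
  show "refl_on A ((adjacent_in G A)\<^sup>+)"
  proof (rule refl_onI)
    fix x assume x: "x \<in> A"
    then obtain u w where "ends G x = {u, w}"
      using edge_ends assms by blast
    then show "(x, x) \<in> (adjacent_in G A)\<^sup>+"
      using x unfolding adjacent_in_def by auto
  qed
  show "sym ((adjacent_in G A)\<^sup>+)"
    by (rule sym_trancl) (auto simp: sym_def adjacent_in_def)
qed simp

lemma component_reach:
  assumes "A \<subseteq> edges G" "K \<in> components_in G A" "x \<in> K" "y \<in> K" "u \<in> ends G x" "w \<in> ends G y"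
  shows "reach A u w"
proof -
  note eq = equiv_connected[OF assms(1)]
  have "K \<subseteq> A"
    using assms(2) eq in_quotient_imp_subset unfolding components_in_def by metis
  moreover have "(x, y) \<in> (adjacent_in G A)\<^sup>+"
    using quotient_eq_iff[OF eq _ _ assms(3,4)] assms(2) unfolding components_in_def by blast
  ultimately show ?thesis
    using connected_iff_reach assms by blast
qed

lemma component_subset: "A \<subseteq> edges G \<Longrightarrow> K \<in> components_in G A \<Longrightarrow> K \<subseteq> A"
  using equiv_connected in_quotient_imp_subset unfolding components_in_def by metis

lemma components_connected:
  assumes X: "X \<subseteq> edges G" "x \<in> X" "u \<in> ends G x"
    and r: "\<And>y w. y \<in> X \<Longrightarrow> w \<in> ends G y \<Longrightarrow> reach X u w"
  shows "components_in G X = {X}"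
proof -
  let ?r = "(adjacent_in G X)\<^sup>+"
  have xy: "(x, y) \<in> ?r" if y: "y \<in> X" for y
  proof -
    obtain a b where "ends G y = {a, b}"
      using edge_ends[of y] y X(1) by blast
    then show ?thesis
      using connected_iff_reach[OF X(1,2) y X(3), of a] r[OF y, of a] by simp
  qed
  have eq: "equiv X ?r"
    using equiv_connected X(1) by blast
  have "X // ?r = (\<lambda>y. ?r `` {y}) ` X"
    unfolding quotient_def by blast
  moreover have "?r `` {y} = X" if "y \<in> X" for y
  proof
    show "?r `` {y} \<subseteq> X"
      using eq equiv_type by blast
    show "X \<subseteq> ?r `` {y}"
    proof
      fix z assume "z \<in> X"
      then have "(x, y) \<in> ?r" "(x, z) \<in> ?r"
        using xy that by auto
      then show "z \<in> ?r `` {y}"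
        using eq unfolding equiv_def by (auto dest: symD transD)
    qed
  qed
  ultimately have "X // ?r = (\<lambda>y. X) ` X"
    by simp
  then show ?thesis
    using X(2) unfolding components_in_def by auto
qed

lemma cycle_reach:
  assumes "cycle G X" "x \<in> X" "y \<in> X" "u \<in> ends G x" "w \<in> ends G y"
  shows "reach X u w"
  using assms component_reach[of X X x y u w] unfolding cycle_def by blast

lemma cycle_nonempty:
  assumes "cycle G X"
  shows "X \<noteq> {}"
proof
  assume "X = {}"
  then show False
    using assms unfolding cycle_def components_in_def by simp
qed

lemma cycle_subset_edges: "cycle G X \<Longrightarrow> X \<subseteq> edges G"
  unfolding cycle_def by blast

lemma cycle_finite: "cycle G X \<Longrightarrow> finite X"
  using cycle_subset_edges finite_edges finite_subset by blast

lemma cycle_edge_ends: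
  assumes "cycle G X" "x \<in> X"
  obtains u w where "ends G x = {u, w}"
  using assms cycle_subset_edges edge_ends by blast

text \<open>The loop alone uses up degree two at its vertex, so no other edge of the connected set
  can be attached there.\<close>

lemma cycle_loop:
  assumes X: "cycle G X" "x \<in> X" and u: "ends G x = {u}"
  shows "X = {x}"
proof -
  have "degree_in G X u = 2"
    using X u unfolding cycle_def vertices_of_def by blast
  moreover have "card {y \<in> X. ends G y = {u}} > 0"
    using X u cycle_finite[OF X(1)] by (auto simp: card_gt_0_iff)
  moreover have "card {y \<in> X. u \<in> ends G y} > 0"
    using X u cycle_finite[OF X(1)] by (auto simp: card_gt_0_iff)
  ultimately have "card {y \<in> X. u \<in> ends G y} = 1"
    unfolding degree_in_def by linarith
  then obtain x' where x': "{y \<in> X. u \<in> ends G y} = {x'}"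
    by (auto simp: card_1_singleton_iff)
  moreover have "x \<in> {y \<in> X. u \<in> ends G y}"
    using X(2) u by simp
  ultimately have only: "{y \<in> X. u \<in> ends G y} = {x}"
    by simp
  have cl: "closed X {u}"
    unfolding closed_def
  proof (intro ballI allI impI)
    fix y a b assume y: "y \<in> X" "ends G y = {a, b}"
    show "a \<in> {u} \<longleftrightarrow> b \<in> {u}"
    proof (cases "u \<in> {a, b}")
      case True
      then have "y = x" using only y by blast
      then show ?thesis using u y(2) by (auto simp: doubleton_eq_iff)
    qed auto
  qed
  have "y = x" if y: "y \<in> X" for y
  proof -
    obtain a b where ab: "ends G y = {a, b}"
      using cycle_edge_ends[OF X(1) y] by blast
    then have "reach X u a"
      using cycle_reach[OF X y, of u a] u by simp
    then have "a = u"
      using closed_reach[OF cl] by blast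
    then show ?thesis
      using only y ab by blast
  qed
  then show ?thesis using X(2) by blast
qed

text \<open>Double counting: every vertex lies on two edges, so its value is added twice. The group
  is left free because the lemma is applied to labels and also to the \<open>bit\<close>-valued
  indicator of a component.\<close>

lemma cycle_vertex_sum:
  fixes f :: "'v \<Rightarrow> 'h::ab_group_add"
  assumes X: "cycle G X" "\<forall>x\<in>X. \<not> loop G x" and char2: "\<And>a::'h. a + a = 0"
  shows "(\<Sum>x\<in>X. \<Sum>v\<in>ends G x. f v) = 0"
proof -
  have fin: "finite X" "finite (vertices_of G X)"
  proof -
    show f: "finite X"
      using X(1) by (rule cycle_finite)
    have "finite (ends G x)" if x: "x \<in> X" for x
    proof -
      obtain u w where "ends G x = {u, w}"
        using cycle_edge_ends[OF X(1) x] by blast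
      then show ?thesis by simp
    qed
    then show "finite (vertices_of G X)"
      using f unfolding vertices_of_def by blast
  qed
  have "(\<Sum>x\<in>X. \<Sum>v\<in>ends G x. f v) = (\<Sum>x\<in>X. \<Sum>v | v \<in> vertices_of G X \<and> v \<in> ends G x. f v)"
    by (intro sum.cong refl arg_cong2[where f = sum]) (auto simp: vertices_of_def)
  also have "\<dots> = (\<Sum>v\<in>vertices_of G X. \<Sum>x | x \<in> X \<and> v \<in> ends G x. f v)"
    by (rule sum.swap_restrict[OF fin])
  also have "\<dots> = 0"
  proof (rule sum.neutral, rule ballI)
    fix v assume v: "v \<in> vertices_of G X"
    have "{x \<in> X. ends G x = {v}} = {}"
      using X(2) loop_iff by blast
    moreover have "degree_in G X v = 2"
      using X(1) v unfolding cycle_def by blast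
    ultimately have "card {x \<in> X. v \<in> ends G x} = 2"
      unfolding degree_in_def by (simp only: card.empty add_0_right)
    then obtain a b where "a \<noteq> b" "{x \<in> X. v \<in> ends G x} = {a, b}"
      by (auto simp: card_2_iff)
    then show "(\<Sum>x | x \<in> X \<and> v \<in> ends G x. f v) = 0"
      using char2 by simp
  qed
  finally show ?thesis .
qed

lemma cycle_no_loop:
  assumes "cycle G X" "x \<in> X" "ends G x = {u, w}" "u \<noteq> w"
  shows "\<forall>y\<in>X. \<not> loop G y"
proof
  fix y assume y: "y \<in> X"
  show "\<not> loop G y"
  proof
    assume "loop G y"
    then obtain v where "ends G y = {v}" using loop_iff by blast
    then show False
      using cycle_loop[OF assms(1) y] assms by auto
  qed
qed

text \<open>If \<open>u\<close> and \<open>w\<close> were in different components of \<open>X - {x}\<close>, the degrees in one of them would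
  have an odd sum.\<close>

lemma cycle_Diff_reach:
  assumes X: "cycle G X" "x \<in> X" and uw: "ends G x = {u, w}"
  shows "reach (X - {x}) u w"
proof (cases "u = w")
  case False
  have nl: "\<forall>y\<in>X. \<not> loop G y"
    using cycle_no_loop X uw False by blast
  define f :: "'v \<Rightarrow> bit" where "f v = (if reach (X - {x}) u v then 1 else 0)" for v
  have "(\<Sum>v\<in>ends G y. f v) = 0" if y: "y \<in> X - {x}" for y
  proof -
    obtain a b where ab: "ends G y = {a, b}"
      using cycle_edge_ends[OF X(1), of y] y by blast
    have "a \<noteq> b"
      using nl ab y loop_iff by auto
    moreover have "f a = f b"
      unfolding f_def using reach_step[of "X - {x}" u a y b] reach_step[of "X - {x}" u b y a] y ab
      by (auto simp: insert_commute)
    ultimately show ?thesis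
      by (simp add: ab)
  qed
  moreover have "(\<Sum>y\<in>X. \<Sum>v\<in>ends G y. f v) = 0"
    using cycle_vertex_sum[OF X(1) nl, of f] by simp
  ultimately have "(\<Sum>v\<in>ends G x. f v) = 0"
    using X(2) cycle_finite[OF X(1)] by (simp add: sum.remove[of X x])
  then have "f u + f w = 0"
    using uw False by simp
  then have "f w = 1"
    unfolding f_def by (auto split: if_splits)
  then show ?thesis
    unfolding f_def by (auto split: if_splits)
qed simp

text \<open>The labels of the ends, summed over all edges of the cycle, give zero. The edges other
  than \<open>x\<close> contribute their gains, which leaves
  \<open>\<gamma> x + sum \<gamma> X\<close> for the ends of \<open>x\<close>.\<close>

lemma cycle_satisfied:
  assumes X: "cycle G X" "\<forall>y\<in>X. \<not> loop G y" "x \<in> X" and uw: "ends G x = {u, w}"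
    and \<theta>: "models \<theta> (X - {x})"
  shows "\<theta> u = None \<and> \<theta> w = None \<or>
    (\<exists>a b. \<theta> u = Some a \<and> \<theta> w = Some b \<and> a + b = \<gamma> x + sum \<gamma> X)"
proof (cases "\<theta> u")
  case None
  then show ?thesis
    using alive_reach[OF cycle_Diff_reach[OF X(1,3) uw] \<theta>] by simp
next
  case (Some a)
  then have w: "\<theta> w \<noteq> None"
    using alive_reach[OF cycle_Diff_reach[OF X(1,3) uw] \<theta>] by simp
  have ne: "u \<noteq> w"
    using X loop_iff uw by auto
  have alive: "\<theta> v \<noteq> None" if "reach X u v" for v
    using that
  proof (induction rule: reach_induct)
    case (step v z y)
    show ?case
    proof (cases "y = x")
      case True
      then show ?thesis
        using \<open>ends G y = {v, z}\<close> uw Some w by (auto simp: doubleton_eq_iff)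
    next
      case False
      then have "sat \<theta> y"
        using \<theta> \<open>y \<in> X\<close> unfolding models_def by blast
      then show ?thesis
        using step satisfies_None_iff by metis
    qed
  qed (use Some in simp)
  define f where "f v = the (\<theta> v)" for v
  have inner: "(\<Sum>v\<in>ends G y. f v) = \<gamma> y" if y: "y \<in> X - {x}" for y
  proof -
    obtain c d where cd: "ends G y = {c, d}"
      using cycle_edge_ends[OF X(1), of y] y by blast
    have "c \<noteq> d"
      using X(2) cd y loop_iff by auto
    moreover have "\<theta> c \<noteq> None"
      using alive cycle_reach[OF X(1,3), of y u c] y uw cd by simp
    moreover have "sat \<theta> y"
      using \<theta> y unfolding models_def by blast
    ultimately show ?thesis
      unfolding cd by (auto simp: satisfies_link f_def)
  qed
  have "0 = (\<Sum>y\<in>X. \<Sum>v\<in>ends G y. f v)"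
    using cycle_vertex_sum[OF X(1,2), of f] char2 by simp
  also have "\<dots> = (f u + f w) + (\<Sum>y\<in>X - {x}. \<gamma> y)"
    using X(3) cycle_finite[OF X(1)] inner uw ne by (simp add: sum.remove[of X x])
  finally have "f u + f w = (\<Sum>y\<in>X - {x}. \<gamma> y)"
    using add_eq_0 by metis
  also have "\<dots> = \<gamma> x + sum \<gamma> X"
    using X(3) cycle_finite[OF X(1)] add_self_left by (simp add: sum.remove[of X x])
  finally show ?thesis
    using Some w unfolding f_def by auto
qed

text \<open>A balanced cycle forces each of its edges from the others. An unbalanced cycle
  \<open>Y\<close> admits no live label and so kills its component. If a second cycle
  \<open>X\<close> lies there, dropping an edge \<open>x\<close> of it that is not in
  \<open>Y\<close> disconnects nothing, so both ends of \<open>x\<close> stay dead and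
  \<open>x\<close> is spanned by the rest.\<close>

lemma indep_imp_frame_indep:
  assumes A: "A \<subseteq> edges G" "indep A"
  shows "frame_indep G \<C> A"
proof -
  have unbalanced: "X \<notin> \<C>" if X: "cycle G X" "X \<subseteq> A" for X
  proof
    assume "X \<in> \<C>"
    then have b: "\<forall>y\<in>X. \<not> loop G y" "sum \<gamma> X = 0"
      using balanced_iff[OF X(1)] by auto
    obtain x where x: "x \<in> X"
      using cycle_nonempty X by blast
    obtain u w where uw: "ends G x = {u, w}"
      using edge_ends x X A by blast
    have "u \<noteq> w"
      using b(1) x uw loop_iff by auto
    have "sat \<theta> x" if "models \<theta> (A - {x})" for \<theta>
    proof -
      have "models \<theta> (X - {x})"
        using models_subset[OF that, of "X - {x}"] X(2) by blast
      then show ?thesis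
        using cycle_satisfied[OF X(1) b(1) x uw] b(2) \<open>u \<noteq> w\<close> unfolding uw
        by (simp add: satisfies_link)
    qed
    then show False
      using A(2) x X(2) unfolding indep_def span_def by blast
  qed
  have unique: "X \<subseteq> Y"
    if K: "K \<in> components_in G A" and X: "cycle G X" "X \<subseteq> K" and Y: "cycle G Y" "Y \<subseteq> K" for X Y K
  proof
    fix x assume x: "x \<in> X"
    have KA: "K \<subseteq> A"
      using component_subset A(1) K by blast
    obtain u w where uw: "ends G x = {u, w}"
      using edge_ends x X KA A(1) by blast
    show "x \<in> Y"
    proof (rule ccontr)
      assume nY: "x \<notin> Y"
      obtain y where y: "y \<in> Y"
        using cycle_nonempty Y by blast
      obtain c d where cd: "ends G y = {c, d}"
        using edge_ends y Y KA A(1) by blast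
      have "sat \<theta> x" if \<theta>: "models \<theta> (A - {x})" for \<theta>
      proof -
        have mY: "models \<theta> Y"
          using models_subset[OF \<theta>, of Y] Y(2) KA nY by blast
        have dead: "\<theta> c = None"
        proof (cases "\<forall>y\<in>Y. \<not> loop G y")
          case True
          then have "sum \<gamma> Y \<noteq> 0"
            using unbalanced[OF Y(1)] balanced_iff[OF Y(1)] Y(2) KA by blast
          moreover have "c \<noteq> d"
            using True y cd loop_iff by auto
          moreover have "sat \<theta> y"
            using mY y unfolding models_def by blast
          \<comment> \<open>Live labels at the ends of \<open>y\<close> would need two different
            sums, one required by \<open>y\<close> itself and one by the rest of the cycle.\<close>
          moreover have "a + b \<noteq> \<gamma> y \<or> a + b \<noteq> \<gamma> y + sum \<gamma> Y" if "sum \<gamma> Y \<noteq> 0" for a b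
            using that by (metis add_cancel_left_right)
          ultimately show ?thesis
            using cycle_satisfied[OF Y(1) True y cd, of \<theta>] models_subset[OF mY, of "Y - {y}"]
            unfolding cd by (auto simp: satisfies_link)
        next
          case False
          then obtain z v where zv: "z \<in> Y" "ends G z = {v}"
            using loop_iff by blast
          then have "z = y"
            using cycle_loop[OF Y(1) zv] y by blast
          then show ?thesis
            using mY y zv cd unfolding models_def by (auto simp: satisfies_loop)
        qed
        have xA: "reach (A - {x}) u w"
          using reach_mono[OF cycle_Diff_reach[OF X(1) x uw], of "A - {x}"] X(2) KA by blast
        have "reach A u c"
          using component_reach[OF A(1) K, of x y u c] x X(2) y Y(2) uw cd by blast
        then have "reach (A - {x}) u c"
        proof (induction rule: reach_induct)
          case (step p q z)
          show ?case
          proof (cases "z = x")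
            case True
            then show ?thesis
              using step xA uw reach_sym by (auto simp: doubleton_eq_iff)
          next
            case False
            then show ?thesis
              using reach_step step by blast
          qed
        qed simp
        then have "\<theta> u = None"
          using alive_reach[OF _ \<theta>] dead by blast
        moreover from this have "\<theta> w = None"
          using alive_reach[OF xA \<theta>] by blast
        ultimately show ?thesis
          unfolding uw by (rule satisfies_None)
      qed
      then show False
        using A(2) x X(2) KA unfolding indep_def span_def by blast
    qed
  qed
  show ?thesis
    unfolding frame_indep_def
    using A(1) unbalanced unique component_subset by (meson order_trans subset_antisym)
qed

end

section \<open>Paths, walks and potentials, for the converse that frame independence implies
  independence\<close>

context biased_gain_graph
begin

text \<open>The visited vertices are carried along so that each step can be required to reach a
  fresh one.\<close>

inductive simple_path :: "'e set \<Rightarrow> 'v \<Rightarrow> 'v \<Rightarrow> 'e set \<Rightarrow> 'v set \<Rightarrow> bool" for A u where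
  start: "simple_path A u u {} {u}"
| extend: "simple_path A u w P V \<Longrightarrow> x \<in> A \<Longrightarrow> ends G x = {w, z} \<Longrightarrow> z \<notin> V \<Longrightarrow>
    simple_path A u z (insert x P) (insert z V)"

lemma simple_path_subset:
  "simple_path A u w P V \<Longrightarrow>
     P \<subseteq> A \<and> finite P \<and> u \<in> V \<and> w \<in> V \<and> (\<forall>y\<in>P. ends G y \<subseteq> V \<and> \<not> loop G y)"
proof (induction rule: simple_path.induct)
  case (extend w P V x z)
  then have "\<not> loop G x"
    by (auto simp: loop_iff)
  then show ?case
    using extend by auto
qed simp

lemma simple_path_prefix:
  "simple_path A u w P V \<Longrightarrow> z \<in> V \<Longrightarrow> \<exists>P' V'. simple_path A u z P' V'"
  by (induction rule: simple_path.induct) (auto intro: simple_path.intros)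

lemma simple_path_suffix:
  "simple_path A u w P V \<Longrightarrow> z \<in> V \<Longrightarrow> \<exists>P' V'. P' \<subseteq> P \<and> V' \<subseteq> V \<and> simple_path A z w P' V'"
proof (induction rule: simple_path.induct)
  case start
  then show ?case
    by (auto intro: simple_path.start)
next
  case (extend w P V x q)
  show ?case
  proof (cases "z = q")
    case True
    then have "simple_path A z q {} {q}"
      using simple_path.start by simp
    then show ?thesis
      by blast
  next
    case False
    then obtain P' V' where PV: "P' \<subseteq> P" "V' \<subseteq> V" "simple_path A z w P' V'"
      using extend by blast
    then have "simple_path A z q (insert x P') (insert q V')"
      using extend by (intro simple_path.extend) auto
    then show ?thesis
      using PV by (meson insert_mono)
  qed
qed

lemma reach_simple_path:
  "reach A u w \<Longrightarrow> \<exists>P V. simple_path A u w P V"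
proof (induction rule: reach_induct)
  case refl
  then show ?case
    using simple_path.start by blast
next
  case (step w z x)
  then show ?case
    using simple_path_prefix simple_path.extend by metis
qed

lemma simple_path_reach:
  "simple_path A u w P V \<Longrightarrow> v \<in> V \<Longrightarrow> reach P u v"
proof (induction arbitrary: v rule: simple_path.induct)
  case (extend w P V x z)
  have IH: "reach (insert x P) u v" if "v \<in> V" for v
    using extend.IH[OF that] reach_mono by blast
  have "w \<in> V"
    using extend.hyps(1) simple_path_subset by blast
  then have "reach (insert x P) u z"
    using IH reach_step extend.hyps(3) by blast
  then show ?case
    using IH extend.prems by blast
qed simp

text \<open>The indicator terms are what a closing edge has to add at the two ends. They also cover
  the path without edges, where both fall on the same vertex.\<close>

lemma simple_path_degree:
  "simple_path A u w P V \<Longrightarrow> v \<in> V \<Longrightarrow>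
     card {y \<in> P. v \<in> ends G y} + (if v = u then 1 else 0) + (if v = w then 1 else 0) = (2::nat)"
proof (induction arbitrary: v rule: simple_path.induct)
  case (extend w P V x z)
  have P: "finite P" "u \<in> V" "w \<in> V" "\<forall>y\<in>P. ends G y \<subseteq> V"
    using simple_path_subset[OF extend.hyps(1)] by auto
  have x: "x \<notin> P"
    using P(4) extend.hyps(3,4) by blast
  have zw: "z \<noteq> w" "z \<noteq> u"
    using P extend.hyps(4) by auto
  show ?case
  proof (cases "v = z")
    case True
    then have "{y \<in> insert x P. v \<in> ends G y} = {x}"
      using P(4) extend.hyps(3,4) by auto
    then show ?thesis
      using True zw by simp
  next
    case False
    then have v: "v \<in> V"
      using extend.prems by simp
    show ?thesis
    proof (cases "v = w")
      case True
      then have "{y \<in> insert x P. v \<in> ends G y} = insert x {y \<in> P. v \<in> ends G y}"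
        using extend.hyps(3) by auto
      then have "card {y \<in> insert x P. v \<in> ends G y} = Suc (card {y \<in> P. v \<in> ends G y})"
        using x P(1) by simp
      then show ?thesis
        using extend.IH[OF v] True False by simp
    next
      case nw: False
      then have "{y \<in> insert x P. v \<in> ends G y} = {y \<in> P. v \<in> ends G y}"
        using False extend.hyps(3) by auto
      then show ?thesis
        using extend.IH[OF v] nw False by simp
    qed
  qed
qed simp

lemma simple_path_closed: "simple_path A u u P V \<Longrightarrow> P = {} \<and> V = {u}"
  by (erule simple_path.cases) (auto dest: simple_path_subset)

text \<open>The case \<open>u = w\<close> is included: the path is then empty and \<open>x\<close>
  is a loop.\<close>

lemma cycle_insert_path:
  assumes P: "simple_path A u w P V" "A \<subseteq> edges G"
    and x: "x \<in> edges G" "x \<notin> P" "ends G x = {u, w}"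
  shows "cycle G (insert x P)"
proof -
  have PV: "P \<subseteq> A" "finite P" "u \<in> V" "w \<in> V" "\<forall>y\<in>P. ends G y \<subseteq> V \<and> \<not> loop G y"
    using simple_path_subset[OF P(1)] by auto
  have sub: "insert x P \<subseteq> edges G"
    using PV(1) P(2) x(1) by blast
  have inV: "v \<in> V" if "y \<in> insert x P" "v \<in> ends G y" for y v
    using that PV x(3) by auto
  have "reach (insert x P) u v" if "y \<in> insert x P" "v \<in> ends G y" for y v
    using reach_mono[OF simple_path_reach[OF P(1) inV[OF that]]] by blast
  then have "components_in G (insert x P) = {insert x P}"
    using components_connected[OF sub, of x u] x(3) by simp
  moreover have "degree_in G (insert x P) v = 2" if v: "v \<in> vertices_of G (insert x P)" for v
  proof -
    have vV: "v \<in> V"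
      using v inV unfolding vertices_of_def by blast
    have nl: "ends G y \<noteq> {v}" if "y \<in> P" for y
      using PV(5) that loop_iff by blast
    show ?thesis
    proof (cases "u = w")
      case True
      then have "P = {}" "V = {u}"
        using simple_path_closed P(1) by auto
      then show ?thesis
        using vV x(3) True unfolding degree_in_def by (simp cong: conj_cong)
    next
      case False
      have l: "{y \<in> insert x P. ends G y = {v}} = {}"
        using nl x(3) False by auto
      have d: "degree_in G (insert x P) v = card {y \<in> insert x P. v \<in> ends G y}"
        unfolding degree_in_def l by simp
      show ?thesis
      proof (cases "v \<in> {u, w}")
        case True
        then have "{y \<in> insert x P. v \<in> ends G y} = insert x {y \<in> P. v \<in> ends G y}"
          using x(3) by auto
        then have "card {y \<in> insert x P. v \<in> ends G y} = Suc (card {y \<in> P. v \<in> ends G y})"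
          using x(2) PV(2) by simp
        then show ?thesis
          using simple_path_degree[OF P(1) vV] True False unfolding d
          by (auto split: if_splits)
      next
        case nv: False
        then have "{y \<in> insert x P. v \<in> ends G y} = {y \<in> P. v \<in> ends G y}"
          using x(3) by auto
        then show ?thesis
          using simple_path_degree[OF P(1) vV] nv unfolding d
          by (auto split: if_splits)
      qed
    qed
  qed
  ultimately show ?thesis
    using sub unfolding cycle_def by blast
qed

inductive walk :: "'e set \<Rightarrow> 'v \<Rightarrow> 'v \<Rightarrow> 'g \<Rightarrow> bool" for A u where
  walk_refl: "walk A u u 0"
| walk_step: "walk A u w g \<Longrightarrow> x \<in> A \<Longrightarrow> ends G x = {w, z} \<Longrightarrow> walk A u z (g + \<gamma> x)"

lemma walk_reach: "walk A u w g \<Longrightarrow> reach A u w"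
  by (induction rule: walk.induct) (auto intro: reach_step)

lemma reach_walk: "reach A u w \<Longrightarrow> \<exists>g. walk A u w g"
  by (induction rule: reach_induct) (auto intro: walk.intros)

lemma walk_trans: "walk A w z h \<Longrightarrow> walk A u w g \<Longrightarrow> walk A u z (g + h)"
proof (induction rule: walk.induct)
  case (walk_step p h x q)
  then show ?case
    using walk.walk_step[of A u p "g + h" x q] by (simp add: add.assoc)
qed simp

lemma walk_sym: "walk A u w g \<Longrightarrow> walk A w u g"
proof (induction rule: walk.induct)
  case walk_refl
  then show ?case by (rule walk.walk_refl)
next
  case (walk_step w g x z)
  have "walk A z w (0 + \<gamma> x)"
    using walk.walk_step[OF walk.walk_refl walk_step.hyps(2), of z w] walk_step.hyps(3)
    by (simp add: insert_commute)
  then have "walk A z u (0 + \<gamma> x + g)"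
    by (rule walk_trans[OF walk_step.IH])
  then show ?case
    by (simp add: add.commute)
qed

definition cycle_near :: "'e set \<Rightarrow> 'v \<Rightarrow> bool" where
  "cycle_near A u \<longleftrightarrow> (\<exists>Y y v. cycle G Y \<and> Y \<subseteq> A \<and> y \<in> Y \<and> v \<in> ends G y \<and> reach A u v)"

text \<open>A walk that returns to a vertex of its path either closes a cycle, which is excluded, or
  runs back along the last edge of the path, whose gain then cancels.\<close>

lemma walk_path_gain:
  assumes A: "A \<subseteq> edges G" and u: "\<not> cycle_near A u" and w: "walk A u w g"
  shows "\<exists>P V. simple_path A u w P V \<and> sum \<gamma> P = g"
  using w
proof (induction rule: walk.induct)
  case walk_refl
  have "simple_path A u u {} {u} \<and> sum \<gamma> {} = 0"
    using simple_path.start by simp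
  then show ?case
    by blast
next
  case (walk_step w g x z)
  then obtain P V where P: "simple_path A u w P V" "sum \<gamma> P = g" by blast
  have PV: "P \<subseteq> A" "finite P" "w \<in> V" "\<forall>y\<in>P. ends G y \<subseteq> V"
    using simple_path_subset[OF P(1)] by auto
  show ?case
  proof (cases "z \<in> V")
    case False
    then have "x \<notin> P"
      using PV(4) walk_step.hyps(3) by blast
    then show ?thesis
      using simple_path.extend[OF P(1) walk_step.hyps(2,3) False] P(2) PV(2)
      by (auto simp: add.commute)
  next
    case zV: True
    show ?thesis
    proof (cases "x \<in> P")
      case False
      obtain P' V' where P': "P' \<subseteq> P" "simple_path A z w P' V'"
        using simple_path_suffix[OF P(1) zV] by blast
      have "cycle G (insert x P')"
        using cycle_insert_path[OF P'(2) A, of x] A walk_step.hyps(2,3) False P'(1)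
        by (auto simp: insert_commute)
      then have "cycle_near A u"
        using P'(1) PV(1) walk_step.hyps(2,3) walk_reach[OF walk_step.hyps(1)]
        unfolding cycle_near_def by blast
      then show ?thesis using u by blast
    next
      case True
      from P(1) show ?thesis
      proof (cases rule: simple_path.cases)
        case start
        then show ?thesis using True by simp
      next
        case (extend w' P' V' x')
        have P': "finite P'" "\<forall>y\<in>P'. ends G y \<subseteq> V'" "w' \<in> V'"
          using simple_path_subset[OF extend(3)] by auto
        have "x = x'"
          using True P'(2) walk_step.hyps(3) extend(1,6) by blast
        then have "z = w'"
          using walk_step.hyps(3) extend(5,6) P'(3) by (auto simp: doubleton_eq_iff)
        moreover have "x' \<notin> P'"
          using P'(2) extend(5,6) by blast
        then have "g = \<gamma> x + sum \<gamma> P'"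
          using P(2) extend(1) P'(1) \<open>x = x'\<close> by simp
        then have "g + \<gamma> x = sum \<gamma> P'"
          by (metis add.commute add_self_left)
        ultimately show ?thesis
          using extend(3) by metis
      qed
    qed
  qed
qed

text \<open>With no cycle in the component of \<open>u\<close>, a closed walk has the gain of the
  empty path. Hence all walks from \<open>u\<close> to a vertex have the same gain, which serves as
  its label.\<close>

lemma potential_exists:
  assumes A: "A \<subseteq> edges G" and u: "\<not> cycle_near A u"
  obtains \<theta> where "models \<theta> A" "\<theta> u = Some 0"
    "\<And>w. \<theta> w = None \<longleftrightarrow> \<not> reach A u w" "\<And>w g. \<theta> w = Some g \<Longrightarrow> walk A u w g"
proof -
  have unique: "g = h" if "walk A u w g" "walk A u w h" for w g h
  proof -
    have "walk A u u (g + h)"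
      using walk_trans[OF walk_sym[OF that(2)] that(1)] .
    then obtain P V where "simple_path A u u P V" "sum \<gamma> P = g + h"
      using walk_path_gain[OF A u] by blast
    then have "g + h = 0"
      using simple_path_closed by fastforce
    then show ?thesis using add_eq_0 by blast
  qed
  define \<theta> where "\<theta> w = (if reach A u w then Some (THE g. walk A u w g) else None)" for w
  have \<theta>: "\<theta> w = Some g" if "walk A u w g" for w g
  proof -
    have "(THE g. walk A u w g) = g"
      using that unique by (intro the_equality) auto
    then show ?thesis
      using walk_reach[OF that] unfolding \<theta>_def by simp
  qed
  have "models \<theta> A"
    unfolding models_def
  proof
    fix x assume x: "x \<in> A"
    then obtain a b where ab: "ends G x = {a, b}"
      using edge_ends A by blast
    have r: "reach A u a \<longleftrightarrow> reach A u b"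
      using closed_component[of A u] x ab unfolding closed_def by blast
    show "sat \<theta> x"
    proof (cases "reach A u a")
      case False
      then show ?thesis
        using r satisfies_None[of \<theta> a b] unfolding ab \<theta>_def by simp
    next
      case True
      then obtain g where g: "walk A u a g"
        using reach_walk by blast
      have "a \<noteq> b"
      proof
        assume "a = b"
        then have "cycle G {x}"
          using cycle_insert_path[OF simple_path.start A, of x a] x A ab by auto
        then show False
          using u x True ab unfolding cycle_near_def by blast
      qed
      moreover have "\<theta> b = Some (g + \<gamma> x)"
        using \<theta>[OF walk_step[OF g x ab]] .
      moreover have "g + (g + \<gamma> x) = \<gamma> x"
        by (rule add_self_left)
      ultimately show ?thesis
        using \<theta>[OF g] unfolding ab by (simp add: satisfies_link)
    qed
  qed
  moreover have "walk A u w g" if "\<theta> w = Some g" for w g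
    using that \<theta> reach_walk[of A u w] unfolding \<theta>_def by (metis option.distinct(1) option.inject)
  ultimately show ?thesis
    using that[of \<theta>] \<theta>[OF walk_refl] unfolding \<theta>_def by simp
qed

lemma common_component:
  assumes A: "A \<subseteq> edges G" and X: "cycle G X" "X \<subseteq> A" "x \<in> X" "a \<in> ends G x"
    and Y: "cycle G Y" "Y \<subseteq> A" "y \<in> Y" "b \<in> ends G y" and ab: "reach A a b"
  shows "\<exists>K\<in>components_in G A. X \<subseteq> K \<and> Y \<subseteq> K"
proof -
  let ?r = "(adjacent_in G A)\<^sup>+"
  have conn: "Z \<subseteq> ?r `` {x}"
    if Z: "cycle G Z" "Z \<subseteq> A" "z \<in> Z" "c \<in> ends G z" "reach A a c" for Z z c
  proof
    fix z' assume z': "z' \<in> Z"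
    obtain c' d' where c': "ends G z' = {c', d'}"
      using cycle_edge_ends[OF Z(1) z'] by blast
    have "reach A c c'"
      using reach_mono[OF cycle_reach[OF Z(1,3) z' Z(4)] Z(2), of c'] c' by simp
    then have "reach A a c'"
      using reach_trans Z(5) by blast
    then show "z' \<in> ?r `` {x}"
      using connected_iff_reach[OF A, of x z' a c'] X Z(2) z' c' by auto
  qed
  have "?r `` {x} \<in> components_in G A"
    unfolding components_in_def using X(2,3) by (auto intro: quotientI)
  then show ?thesis
    using conn[OF X] conn[OF Y ab] by auto
qed

text \<open>If \<open>x\<close> were spanned, the component of each of its ends in \<open>A\<close>
  would contain a cycle: otherwise the potential from that end satisfies \<open>x\<close> and yields
  a path that \<open>x\<close> closes to a balanced cycle. Then \<open>x\<close> joins two cycles,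
  or it closes a new cycle in a component that has one already.\<close>

lemma frame_indep_not_span:
  assumes f: "frame_indep G \<C> (insert x A)" and x: "x \<notin> A"
  shows "x \<notin> span A"
proof
  assume xs: "x \<in> span A"
  have E: "insert x A \<subseteq> edges G"
    using f unfolding frame_indep_def by blast
  have A: "A \<subseteq> edges G"
    using E by blast
  obtain u w where uw: "ends G x = {u, w}"
    using edge_ends E by blast
  have no_two: "X = Y"
    if "cycle G X" "X \<subseteq> insert x A" "p \<in> X" "a \<in> ends G p"
      "cycle G Y" "Y \<subseteq> insert x A" "q \<in> Y" "b \<in> ends G q" "reach (insert x A) a b" for X Y p q a b
    using common_component[OF E that] that(1,5) f unfolding frame_indep_def by blast
  have unbalanced: "X \<notin> \<C>" if X: "cycle G X" "X \<subseteq> insert x A" for X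
  proof -
    obtain p where p: "p \<in> X"
      using cycle_nonempty X by blast
    obtain a b where "ends G p = {a, b}"
      using cycle_edge_ends[OF X(1) p] by blast
    then have "\<exists>K\<in>components_in G (insert x A). X \<subseteq> K \<and> X \<subseteq> K"
      using common_component[OF E X p _ X p, of a a] by simp
    then show ?thesis
      using f X(1) unfolding frame_indep_def by blast
  qed
  have near: "cycle_near A s" if st: "ends G x = {s, t}" for s t
  proof (rule ccontr)
    assume "\<not> cycle_near A s"
    then obtain \<theta> where \<theta>: "models \<theta> A" "\<theta> s = Some 0"
        "\<And>w g. \<theta> w = Some g \<Longrightarrow> walk A s w g"
      using potential_exists[OF A] by metis
    have "sat \<theta> x"
      using xs \<theta>(1) unfolding span_def by blast
    then have "s \<noteq> t" "\<theta> t = Some (\<gamma> x)"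
      using \<theta>(2) unfolding st by (cases "s = t"; simp add: satisfies_loop satisfies_link)+
    then obtain P V where P: "simple_path A s t P V" "sum \<gamma> P = \<gamma> x"
      using walk_path_gain[OF A \<open>\<not> cycle_near A s\<close>] \<theta>(3) by blast
    have PV: "P \<subseteq> A" "finite P" "\<forall>y\<in>P. \<not> loop G y"
      using simple_path_subset[OF P(1)] by auto
    have cyc: "cycle G (insert x P)"
      using cycle_insert_path[OF P(1) A] E x PV(1) st by blast
    moreover have "sum \<gamma> (insert x P) = 0"
      using P(2) PV x char2 by (metis sum.insert subsetD)
    moreover have "\<not> loop G x"
      using st \<open>s \<noteq> t\<close> by (auto simp: loop_iff)
    ultimately have "insert x P \<in> \<C>"
      using balanced_iff[OF cyc] PV(3) by simp
    then show False
      using unbalanced[OF cyc] PV(1) by blast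
  qed
  obtain Y y v where Y: "cycle G Y" "Y \<subseteq> A" "y \<in> Y" "v \<in> ends G y" "reach A u v"
    using near[OF uw] unfolding cycle_near_def by blast
  obtain Z z v' where Z: "cycle G Z" "Z \<subseteq> A" "z \<in> Z" "v' \<in> ends G z" "reach A w v'"
    using near[of w u] uw unfolding cycle_near_def by (auto simp: insert_commute)
  have r: "reach (insert x A) u v" "reach (insert x A) w v'"
    using reach_mono Y(5) Z(5) by blast+
  show False
  proof (cases "reach A u w")
    case True
    then obtain P V where P: "simple_path A u w P V"
      using reach_simple_path by blast
    have PA: "P \<subseteq> A"
      using simple_path_subset[OF P] by blast
    have cyc: "cycle G (insert x P)"
      using cycle_insert_path[OF P A] E x PA uw by blast
    have "insert x P = Y"
    proof (rule no_two[OF cyc _ _ _ Y(1) _ Y(3,4)])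
      show "insert x P \<subseteq> insert x A" "Y \<subseteq> insert x A" "x \<in> insert x P"
        using PA Y(2) by auto
      show "u \<in> ends G x" "reach (insert x A) u v"
        using uw r by auto
    qed
    then show False
      using x Y(2) by blast
  next
    case False
    have "reach (insert x A) u w"
      using reach_edge uw by blast
    then have vv': "reach (insert x A) v v'"
      using r reach_sym reach_trans by metis
    have "Y = Z"
      using no_two[OF Y(1) _ Y(3,4) Z(1) _ Z(3,4) vv'] Y(2) Z(2) by blast
    then have "reach Y v v'"
      using cycle_reach[OF Y(1,3), of z v v'] Y(4) Z(3,4) by blast
    then have "reach A v v'"
      using reach_mono Y(2) by blast
    then have "reach A u w"
      using Y(5) Z(5) reach_sym reach_trans by metis
    then show False
      using False by blast
  qed
qed

lemma frame_indep_subset: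
  assumes f: "frame_indep G \<C> A" and B: "B \<subseteq> A"
  shows "frame_indep G \<C> B"
proof -
  have "\<exists>K\<in>components_in G A. L \<subseteq> K" if L: "L \<in> components_in G B" for L
  proof -
    obtain x where x: "x \<in> B" "L = (adjacent_in G B)\<^sup>+ `` {x}"
      using L unfolding components_in_def by (auto elim: quotientE)
    have "adjacent_in G B \<subseteq> adjacent_in G A"
      using B unfolding adjacent_in_def by blast
    then have "L \<subseteq> (adjacent_in G A)\<^sup>+ `` {x}"
      unfolding x(2) using trancl_mono by blast
    moreover have "(adjacent_in G A)\<^sup>+ `` {x} \<in> components_in G A"
      unfolding components_in_def using x(1) B by (auto intro: quotientI)
    ultimately show ?thesis by blast
  qed
  then show ?thesis
    using f B unfolding frame_indep_def by (meson order_trans)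
qed

lemma frame_indep_iff: "frame_indep G \<C> A \<longleftrightarrow> A \<subseteq> edges G \<and> indep A"
proof
  assume f: "frame_indep G \<C> A"
  then have A: "A \<subseteq> edges G"
    unfolding frame_indep_def by blast
  then have "finite A"
    using finite_edges finite_subset by blast
  then have "indep A"
    using f
  proof (induction A rule: finite_induct)
    case empty
    then show ?case
      unfolding indep_def by simp
  next
    case (insert x A)
    then show ?case
      using indep_insert frame_indep_not_span frame_indep_subset[OF insert.prems, of A] by blast
  qed
  then show "A \<subseteq> edges G \<and> indep A"
    using A by blast
qed (use indep_imp_frame_indep in blast)

lemma frame_bases_eq: "frame_bases G \<C> = bases (edges G)"
  unfolding frame_bases_def bases_def frame_indep_iff by auto

end

section \<open>Exchanges between two opposed hyperplanes\<close>

context gain_graph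
begin

text \<open>On the live part the matroid is graphic. If \<open>B\<close> does not connect the ends
  of \<open>x\<close>, keeping \<open>\<theta>\<close> on the component of \<open>a\<close> only
  violates \<open>x\<close>; if it does, every labelling of \<open>B\<close> alive there differs
  from \<open>\<theta>\<close> by a constant.\<close>

lemma span_iff_reach:
  assumes \<theta>: "models \<theta> A" "\<theta> a \<noteq> None" and x: "ends x = {a, b}" "sat \<theta> x" and B: "B \<subseteq> A"
  shows "x \<in> span B \<longleftrightarrow> reach B a b"
proof
  assume xB: "x \<in> span B"
  define K where "K = {w. reach B a w}"
  have "models (glue K \<theta> (\<lambda>_. None)) B"
    using models_glue models_None models_subset[OF \<theta>(1) B] closed_component unfolding K_def by blast
  then have "satisfies (glue K \<theta> (\<lambda>_. None)) {a, b} (gain x)"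
    using xB x(1) unfolding span_def by auto
  then have "glue K \<theta> (\<lambda>_. None) b \<noteq> None"
    using satisfies_None_iff[of "glue K \<theta> (\<lambda>_. None)" a b "gain x"] \<theta>(2) unfolding K_def by simp
  then show "reach B a b"
    unfolding K_def glue_def by (auto split: if_splits)
next
  assume ab: "reach B a b"
  have ne: "a \<noteq> b"
    using x \<theta>(2) by (auto simp: satisfies_loop)
  obtain c d where cd: "\<theta> a = Some c" "\<theta> b = Some d" "c + d = gain x"
    using x \<theta>(2) ne by (auto simp: satisfies_link)
  show "x \<in> span B"
    unfolding span_def
  proof (intro CollectI allI impI)
    fix \<theta>' assume \<theta>': "models \<theta>' B"
    show "sat \<theta>' x"
    proof (cases "\<theta>' a")
      case None
      then show ?thesis
        using alive_reach[OF ab \<theta>'] satisfies_None x(1) by metis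
    next
      case (Some c')
      then obtain d' where "\<theta>' b = Some d'" "d + d' = c + c'"
        using difference_reach[OF ab models_subset[OF \<theta>(1) B] \<theta>' cd(1)] cd(2) by auto
      moreover from this have "c' + d' = c + d"
        by (metis add.commute add.assoc add_self_left)
      ultimately show ?thesis
        using Some ne cd(3) unfolding x(1) by (simp add: satisfies_link)
    qed
  qed
qed

text \<open>The fundamental circuit of \<open>x\<close> avoids every element of
  \<open>A - B\<close>, so the part of \<open>A\<close> inside \<open>B\<close> still spans
  \<open>x\<close>.\<close>

lemma span_Diff:
  assumes "indep A" "finite A" "x \<in> span A" "ends x = {s, t}"
    and "\<And>z. z \<in> A - B \<Longrightarrow> x \<in> span (A - {z})"
  shows "x \<in> span (A \<inter> B)"
proof -
  have A: "A - (A - B) = A \<inter> B"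
    by blast
  show ?thesis
    unfolding span_def
  proof (intro CollectI allI impI)
    fix \<theta> assume "models \<theta> (A \<inter> B)"
    then show "sat \<theta> x"
      using constraint_span_Diff[of A "A - B" s t "gain x" \<theta>] assms A unfolding span_def by simp
  qed
qed

lemma reach_common: "reach A u z \<Longrightarrow> reach A w z \<Longrightarrow> reach A u w"
  and reach_common': "reach A z u \<Longrightarrow> reach A z w \<Longrightarrow> reach A u w"
  using reach_sym reach_trans by blast+

lemma reach_Diff_cases:
  assumes "reach A u w" "x \<in> A" "ends x = {s, t}" "\<not> reach (A - {x}) u w"
  shows "reach (A - {x}) u s \<and> reach (A - {x}) t w \<or> reach (A - {x}) u t \<and> reach (A - {x}) s w"
  using reach_insert_cases[of x "A - {x}" u w s t] assms by (simp add: insert_absorb)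

end

text \<open>An index stands for an edge at the deleted vertex, \<open>att i\<close> for its other
  end, empty for a loop, and \<open>h i j\<close> for the edge made of two of them. In
  \<open>triangle\<close> an edge missing from \<open>E\<close> counts as satisfied: in the intended
  instance it is a removed balanced loop or would be made of two loops.\<close>

locale stub_frame = gain_graph ends gain
  for ends :: "'e \<Rightarrow> 'v set" and gain :: "'e \<Rightarrow> 'g::ab_group_add" +
  fixes E :: "'e set" and I :: "nat set" and att :: "nat \<Rightarrow> 'v set" and h :: "nat \<Rightarrow> nat \<Rightarrow> 'e"
  assumes finite_E: "finite E"
    and edge_E: "x \<in> E \<Longrightarrow> \<exists>u w. ends x = {u, w}"
    and h_commute: "h i j = h j i"
    and ends_h: "ends (h i j) = att i \<union> att j"
    and att: "i \<in> I \<Longrightarrow> att i = {} \<or> (\<exists>u. att i = {u})"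
    and triangle: "distinct [i, j, k] \<Longrightarrow> {i, j, k} \<subseteq> I \<Longrightarrow> h i j \<in> E \<Longrightarrow>
      (h i k \<in> E \<Longrightarrow> sat \<theta> (h i k)) \<Longrightarrow> (h k j \<in> E \<Longrightarrow> sat \<theta> (h k j)) \<Longrightarrow> sat \<theta> (h i j)"
begin

text \<open>A missing edge counts as joining its indices, in accordance with
  \<open>triangle\<close>, so that not being separated behaves like an equivalence of
  indices.\<close>

definition separates :: "'e set \<Rightarrow> nat \<Rightarrow> nat \<Rightarrow> bool" where
  "separates A i j \<longleftrightarrow> h i j \<in> E \<and> h i j \<notin> span A"

lemma separates_commute: "separates A i j \<longleftrightarrow> separates A j i"
  unfolding separates_def h_commute[of i j] ..

lemma separates_split:
  assumes "distinct [i, j, k]" "{i, j, k} \<subseteq> I" "separates A i j"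
  shows "separates A i k \<or> separates A k j"
  using assms triangle[of i j k] unfolding separates_def span_def by blast

text \<open>These are the ways to complete \<open>A\<close> and \<open>D\<close> by non-incident
  edges other than \<open>h p q\<close> and \<open>h r s\<close>.\<close>

definition crossing :: "'e set \<Rightarrow> 'e set \<Rightarrow> nat \<Rightarrow> nat \<Rightarrow> nat \<Rightarrow> nat \<Rightarrow> bool" where
  "crossing A D p q r s \<longleftrightarrow>
     separates A p r \<and> separates D q s \<or> separates A q s \<and> separates D p r \<or>
     separates A p s \<and> separates D q r \<or> separates A q r \<and> separates D p s"

definition opposed :: "'e set \<Rightarrow> 'e set \<Rightarrow> nat \<Rightarrow> nat \<Rightarrow> nat \<Rightarrow> nat \<Rightarrow> bool" where
  "opposed A D p q r s \<longleftrightarrow>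
     separates A p q \<and> separates A p r \<and> separates A q s \<and> separates A r s \<and>
     \<not> separates A p s \<and> \<not> separates A q r \<and>
     separates D p q \<and> separates D p s \<and> separates D q r \<and> separates D r s \<and>
     \<not> separates D p r \<and> \<not> separates D q s"

text \<open>Suppose \<open>A\<close> separates \<open>p\<close> from \<open>r\<close>. Then
  \<open>D\<close> joins \<open>q\<close> to \<open>s\<close> and so separates \<open>q\<close> from
  \<open>r\<close>; hence \<open>A\<close> joins \<open>p\<close> to \<open>s\<close> and separates
  \<open>q\<close> from \<open>s\<close>; hence \<open>D\<close> joins \<open>p\<close> to
  \<open>r\<close> and separates \<open>p\<close> from \<open>s\<close>; hence \<open>A\<close>
  joins \<open>q\<close> to \<open>r\<close>. Otherwise \<open>A\<close> separates \<open>q\<close>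
  from \<open>r\<close>, and the same chain leads to the second form.\<close>

lemma not_crossing_opposed:
  assumes d: "distinct [p, q, r, s]" "{p, q, r, s} \<subseteq> I"
    and s: "separates A p q" "separates D r s" and n: "\<not> crossing A D p q r s"
  shows "opposed A D p q r s \<or> opposed A D p q s r"
proof -
  have split: "separates B i j \<Longrightarrow> separates B i k \<or> separates B j k"
    if "distinct [i, j, k]" "{i, j, k} \<subseteq> {p, q, r, s}" for B i j k
    using separates_split[OF that(1) subset_trans[OF that(2) d(2)], of B] separates_commute[of B k j]
    by simp
  have c: "separates B q p = separates B p q" "separates B r p = separates B p r"
    "separates B s p = separates B p s" "separates B r q = separates B q r"
    "separates B s q = separates B q s" "separates B s r = separates B r s" for B
    using separates_commute by blast+
  have t: "separates B p q \<Longrightarrow> separates B p r \<or> separates B q r"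
    "separates B p r \<Longrightarrow> separates B p q \<or> separates B q r"
    "separates B q r \<Longrightarrow> separates B p q \<or> separates B p r"
    "separates B p q \<Longrightarrow> separates B p s \<or> separates B q s"
    "separates B p s \<Longrightarrow> separates B p q \<or> separates B q s"
    "separates B q s \<Longrightarrow> separates B p q \<or> separates B p s"
    "separates B p r \<Longrightarrow> separates B p s \<or> separates B r s"
    "separates B p s \<Longrightarrow> separates B p r \<or> separates B r s"
    "separates B r s \<Longrightarrow> separates B p r \<or> separates B p s"
    "separates B q r \<Longrightarrow> separates B q s \<or> separates B r s"
    "separates B q s \<Longrightarrow> separates B q r \<or> separates B r s"
    "separates B r s \<Longrightarrow> separates B q r \<or> separates B q s" for B
    using split[of p q r B] split[of p r q B] split[of q r p B] split[of p q s B] split[of p s q B]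
      split[of q s p B] split[of p r s B] split[of p s r B] split[of r s p B] split[of q r s B]
      split[of q s r B] split[of r s q B] d(1) c by auto
  show ?thesis
    unfolding opposed_def c using n[unfolded crossing_def] s t[of A] t[of D] by satx
qed

text \<open>Two symmetries cut down the later cases: interchanging \<open>p, q\<close> with
  \<open>r, s\<close>, and interchanging the hyperplanes together with \<open>r\<close> and
  \<open>s\<close>.\<close>

lemma crossing_relabel: "crossing A D r s p q \<longleftrightarrow> crossing A D p q r s"
  and crossing_swap: "crossing D A p q s r \<longleftrightarrow> crossing A D p q r s"
  unfolding crossing_def separates_def h_commute[of r p] h_commute[of s q] h_commute[of r q]
    h_commute[of s p] by blast+

lemma opposed_relabel: "opposed A D p q r s \<Longrightarrow> opposed A D r s p q"
  and opposed_swap: "opposed A D p q r s \<Longrightarrow> opposed D A p q s r"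
  unfolding opposed_def separates_def h_commute[of r p] h_commute[of s q] h_commute[of r q]
    h_commute[of s p] h_commute[of s r] by blast+

text \<open>An index without attachment is dead: a stem loop made with it is satisfied only where
  the other index is dead too.\<close>

definition dead :: "('v \<Rightarrow> 'g option) \<Rightarrow> nat \<Rightarrow> bool" where
  "dead \<theta> i \<longleftrightarrow> (\<forall>v\<in>att i. \<theta> v = None)"

lemma sat_if_dead:
  assumes "h i j \<in> E" "dead \<theta> i" "dead \<theta> j"
  shows "sat \<theta> (h i j)"
proof -
  obtain u w where uw: "ends (h i j) = {u, w}"
    using edge_E assms(1) by blast
  then have "{u, w} = att i \<union> att j"
    using ends_h by simp
  then have "\<theta> u = None" "\<theta> w = None"
    using assms unfolding dead_def by blast+
  then show ?thesis
    unfolding uw by (rule satisfies_None)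
qed

lemma sat_dead:
  assumes "i \<in> I" "j \<in> I" "sat \<theta> (h i j)" "dead \<theta> i"
  shows "dead \<theta> j"
  using att[OF assms(1)]
proof
  assume i: "att i = {}"
  then show ?thesis
    using att[OF assms(2)] assms(3) ends_h[of i j] unfolding dead_def by (auto simp: satisfies_loop)
next
  assume "\<exists>u. att i = {u}"
  then obtain u where u: "att i = {u}" by blast
  show ?thesis
    using att[OF assms(2)]
  proof
    assume "\<exists>w. att j = {w}"
    then obtain w where w: "att j = {w}" by blast
    then have "ends (h i j) = {u, w}"
      using ends_h u by auto
    then show ?thesis
      using satisfies_None_iff[of \<theta> u w] assms(3,4) u w unfolding dead_def by auto
  qed (simp add: dead_def)
qed

text \<open>Any labelling of \<open>A\<close> that violates \<open>b\<close> will do: an edge that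
  it satisfies outside \<open>span A\<close> would complete \<open>A\<close> to a basis and thereby
  force \<open>b\<close>.\<close>

lemma hyperplane_labelling:
  assumes "insert b A \<in> bases E" "b \<notin> A"
  obtains \<theta> where "models \<theta> A" "\<And>y. y \<in> E \<Longrightarrow> sat \<theta> y \<longleftrightarrow> y \<in> span A"
proof -
  have b: "b \<in> E" "b \<notin> span A"
    using assms indep_insert_notin unfolding bases_def by auto
  then obtain \<theta> where \<theta>: "models \<theta> A" "\<not> sat \<theta> b"
    unfolding span_def by blast
  have "y \<in> span A" if y: "y \<in> E" "sat \<theta> y" for y
  proof (rule ccontr)
    assume "y \<notin> span A"
    then have "insert y A \<in> bases E"
      using insert_in_bases_iff[OF finite_E assms y(1)] by blast
    then have "b \<in> span (insert y A)"
      using bases_spanning b(1) by blast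
    then show False
      using \<theta> y(2) unfolding span_def by simp
  qed
  then show ?thesis
    using that[OF \<theta>(1)] \<theta>(1) unfolding span_def by blast
qed

end

text \<open>Here \<open>A\<close> and \<open>D\<close> stand for the two bases without their elements in the subgraph, and
  \<open>p, q, r, s\<close> for the four indices. The assumptions \<open>lopsided_left\<close>, \<open>lopsided_right\<close> and
  \<open>exchanged\<close> are what non-switchability says about pairs that are one exchange away.\<close>

locale exchange_config = stub_frame +
  fixes A D :: "'a set" and p q r s :: nat
  assumes indices: "distinct [p, q, r, s]" "{p, q, r, s} \<subseteq> I"
    and avoid: "i \<in> {p, q, r, s} \<Longrightarrow> j \<in> {p, q, r, s} \<Longrightarrow> h i j \<notin> A"
      "i \<in> {p, q, r, s} \<Longrightarrow> j \<in> {p, q, r, s} \<Longrightarrow> h i j \<notin> D"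
    and bases: "insert (h p q) A \<in> bases E" "insert (h r s) D \<in> bases E"
    and opposed: "opposed A D p q r s"
    and lopsided_left: "z \<in> A \<Longrightarrow> insert (h p q) (insert (h r s) (A - {z})) \<in> bases E \<Longrightarrow>
      insert z D \<in> bases E \<Longrightarrow>
      insert (h p r) (insert (h q s) (A - {z})) \<notin> bases E \<and>
      insert (h p s) (insert (h q r) (A - {z})) \<notin> bases E"
    and lopsided_right: "z \<in> D \<Longrightarrow> insert (h p q) (insert (h r s) (D - {z})) \<in> bases E \<Longrightarrow>
      insert z A \<in> bases E \<Longrightarrow>
      insert (h p r) (insert (h q s) (D - {z})) \<notin> bases E \<and>
      insert (h p s) (insert (h q r) (D - {z})) \<notin> bases E"
    and exchanged: "x \<in> A \<Longrightarrow> y \<in> D \<Longrightarrow>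
      insert (h p q) (insert y (A - {x})) \<in> bases E \<and> insert (h r s) (insert x (D - {y})) \<in> bases E \<or>
      insert (h r s) (insert y (A - {x})) \<in> bases E \<and> insert (h p q) (insert x (D - {y})) \<in> bases E \<Longrightarrow>
      \<not> crossing (insert y (A - {x})) (insert x (D - {y})) p q r s"
begin

text \<open>Meaningful only for singletons; \<open>alive\<close> shows that the four attachments are
  of this kind.\<close>

abbreviation u :: "nat \<Rightarrow> 'b" where
  "u i \<equiv> the_elem (att i)"

lemma pq_notin_A: "h p q \<notin> A" and rs_notin_D: "h r s \<notin> D"
  using avoid by auto

lemma relabelled: "exchange_config ends gain E I att h A D r s p q"
proof unfold_locales
  show "distinct [r, s, p, q]" "{r, s, p, q} \<subseteq> I"
    using indices by auto
  \<comment> \<open>Opposition separates both pairs in both hyperplanes, so the two completing edges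
    may trade places.\<close>
  show "insert (h r s) A \<in> bases E" "insert (h p q) D \<in> bases E"
    using insert_in_bases_iff[OF finite_E bases(1) pq_notin_A] insert_in_bases_iff[OF finite_E bases(2) rs_notin_D]
      opposed unfolding opposed_def separates_def by auto
  show "opposed A D r s p q"
    using opposed by (rule opposed_relabel)
  show "insert (h r p) (insert (h s q) (A - {z})) \<notin> bases E \<and>
      insert (h r q) (insert (h s p) (A - {z})) \<notin> bases E"
    if "z \<in> A" "insert (h r s) (insert (h p q) (A - {z})) \<in> bases E" "insert z D \<in> bases E" for z
    using lopsided_left[OF that(1) _ that(3)] that(2)
    unfolding h_commute[of r p] h_commute[of s q] h_commute[of r q] h_commute[of s p]
    by (simp add: insert_commute)
  show "insert (h r p) (insert (h s q) (D - {z})) \<notin> bases E \<and>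
      insert (h r q) (insert (h s p) (D - {z})) \<notin> bases E"
    if "z \<in> D" "insert (h r s) (insert (h p q) (D - {z})) \<in> bases E" "insert z A \<in> bases E" for z
    using lopsided_right[OF that(1) _ that(3)] that(2)
    unfolding h_commute[of r p] h_commute[of s q] h_commute[of r q] h_commute[of s p]
    by (simp add: insert_commute)
  show "\<not> crossing (insert y (A - {x})) (insert x (D - {y})) r s p q"
    if "x \<in> A" "y \<in> D"
      "insert (h r s) (insert y (A - {x})) \<in> bases E \<and> insert (h p q) (insert x (D - {y})) \<in> bases E \<or>
       insert (h p q) (insert y (A - {x})) \<in> bases E \<and> insert (h r s) (insert x (D - {y})) \<in> bases E" for x y
    using exchanged[OF that(1,2)] that(3)
      crossing_relabel[of "insert y (A - {x})" "insert x (D - {y})" r s p q] by blast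
qed (use avoid in auto)

lemma swapped: "exchange_config ends gain E I att h D A p q s r"
proof unfold_locales
  show "distinct [p, q, s, r]" "{p, q, s, r} \<subseteq> I"
    using indices by auto
  show "insert (h p q) D \<in> bases E" "insert (h s r) A \<in> bases E"
    using insert_in_bases_iff[OF finite_E bases(1) pq_notin_A] insert_in_bases_iff[OF finite_E bases(2) rs_notin_D]
      opposed h_commute[of s r] unfolding opposed_def separates_def by auto
  show "opposed D A p q s r"
    using opposed by (rule opposed_swap)
  show "insert (h p s) (insert (h q r) (D - {z})) \<notin> bases E \<and>
      insert (h p r) (insert (h q s) (D - {z})) \<notin> bases E"
    if "z \<in> D" "insert (h p q) (insert (h s r) (D - {z})) \<in> bases E" "insert z A \<in> bases E" for z
    using lopsided_right[OF that(1) _ that(3)] that(2) unfolding h_commute[of s r] by blast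
  show "insert (h p s) (insert (h q r) (A - {z})) \<notin> bases E \<and>
      insert (h p r) (insert (h q s) (A - {z})) \<notin> bases E"
    if "z \<in> A" "insert (h p q) (insert (h s r) (A - {z})) \<in> bases E" "insert z D \<in> bases E" for z
    using lopsided_left[OF that(1) _ that(3)] that(2) unfolding h_commute[of s r] by blast
  show "\<not> crossing (insert y (D - {x})) (insert x (A - {y})) p q s r"
    if "x \<in> D" "y \<in> A"
      "insert (h p q) (insert y (D - {x})) \<in> bases E \<and> insert (h s r) (insert x (A - {y})) \<in> bases E \<or>
       insert (h s r) (insert y (D - {x})) \<in> bases E \<and> insert (h p q) (insert x (A - {y})) \<in> bases E" for x y
    using exchanged[OF that(2,1)] that(3) h_commute[of s r]
      crossing_swap[of "insert y (D - {x})" "insert x (A - {y})" p q s r] by auto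
qed (use avoid in auto)

lemma subset_E: "A \<subseteq> E" "D \<subseteq> E"
  and finite_A: "finite A" and finite_D: "finite D"
  and indep_A: "indep A" and indep_D: "indep D"
  using bases indep_subset[OF _ subset_insertI] finite_E unfolding bases_def
  by (auto intro: finite_subset)

lemma in_E: "h p q \<in> E" "h p r \<in> E" "h p s \<in> E" "h q r \<in> E" "h q s \<in> E" "h r s \<in> E"
  and notin_A: "h p q \<notin> span A" "h p r \<notin> span A" "h q s \<notin> span A" "h r s \<notin> span A"
  and in_A: "h p s \<in> span A" "h q r \<in> span A"
  and notin_D: "h p q \<notin> span D" "h p s \<notin> span D" "h q r \<notin> span D" "h r s \<notin> span D"
  and in_D: "h p r \<in> span D" "h q s \<in> span D"
  using opposed unfolding opposed_def separates_def by auto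

lemma insert_A_bases: "y \<in> E \<Longrightarrow> insert y A \<in> bases E \<longleftrightarrow> y \<notin> span A"
  using insert_in_bases_iff[OF finite_E bases(1) pq_notin_A] .

lemma insert_D_bases: "y \<in> E \<Longrightarrow> insert y D \<in> bases E \<longleftrightarrow> y \<notin> span D"
  using insert_in_bases_iff[OF finite_E bases(2) rs_notin_D] .

lemma all_in_E: "i \<in> {p, q, r, s} \<Longrightarrow> j \<in> {p, q, r, s} \<Longrightarrow> i \<noteq> j \<Longrightarrow> h i j \<in> E"
  using in_E h_commute by auto

lemma triangle_span:
  assumes "{i, j, k} \<subseteq> {p, q, r, s}" "distinct [i, j, k]" "h i k \<in> span X" "h k j \<in> span X"
  shows "h i j \<in> span X"
  using triangle[of i j k] assms indices(2) all_in_E[of i j] unfolding span_def by auto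

lemma span_exchange_subset:
  assumes "x \<in> span (insert y X)" "x \<notin> span X" "insert x X \<subseteq> span B"
  shows "y \<in> span B"
  using exchange[OF assms(1,2)] closure_least[OF assms(3)] by blast

text \<open>If \<open>p\<close> and \<open>s\<close> stay joined without \<open>z\<close> but
  \<open>q\<close> and \<open>r\<close> do not, three classes remain, \<open>ps\<close>,
  \<open>q\<close> and \<open>r\<close>. Then \<open>h p q\<close> with \<open>h r s\<close> and
  also \<open>h p r\<close> with \<open>h q s\<close> complete \<open>A - {z}\<close>, while
  \<open>insert z D\<close> is a basis; \<open>lopsided_left\<close> forbids this.\<close>

lemma lopsided_exchange:
  assumes z: "z \<in> A" "z \<notin> span D" and ps: "h p s \<in> span (A - {z})"
  shows "h q r \<in> span (A - {z})"
proof (rule ccontr)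
  define X where "X = A - {z}"
  assume "h q r \<notin> span (A - {z})"
  then have qr: "h q r \<notin> span X" and ps: "h p s \<in> span X"
    using ps unfolding X_def by auto
  have sub: "insert (h q r) X \<subseteq> span A"
    using in_A(2) extensive[of A] unfolding X_def by blast
  have ps': "h p s \<in> span (insert y X)" "h s p \<in> span (insert y X)" for y
    using ps closure_mono[of X "insert y X"] h_commute[of s p] by auto
  have own: "y \<in> span (insert y X)" for y
    using extensive by blast
  have pq_qr: "h q r \<notin> span (insert (h p q) X)"
    using span_exchange_subset[OF _ qr sub] notin_A(1) by blast
  have qs_qr: "h q r \<notin> span (insert (h q s) X)"
    using span_exchange_subset[OF _ qr sub] notin_A(3) by blast
  have "h q s \<in> span (insert (h p q) X)"
    using triangle_span[of q s p] own[of "h p q"] ps' indices(1) h_commute[of q p] by auto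
  then have rs: "h r s \<notin> span (insert (h p q) X)"
    using triangle_span[of q r s "insert (h p q) X"] pq_qr indices(1) h_commute[of s r] by auto
  have "h p q \<in> span (insert (h q s) X)"
    using triangle_span[of p q s] own[of "h q s"] ps' indices(1) h_commute[of s q] by auto
  then have pr: "h p r \<notin> span (insert (h q s) X)"
    using triangle_span[of q r p "insert (h q s) X"] qs_qr indices(1) h_commute[of q p] by auto
  have zX: "insert z (insert y X) = insert y A" "z \<notin> X" for y
    using z(1) unfolding X_def by auto
  have ne: "z \<noteq> h i j" if "i \<in> {p, q, r, s}" "j \<in> {p, q, r, s}" for i j
    using z(1) avoid(1)[OF that] by blast
  have "insert (h p q) (insert (h r s) X) \<in> bases E"
    using insert_in_bases_iff[OF finite_E, of z "insert (h p q) X" "h r s"] zX ne rs in_E(1,6)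
      insert_A_bases notin_A(1) by (simp add: insert_commute)
  moreover have "insert (h p r) (insert (h q s) X) \<in> bases E"
    using insert_in_bases_iff[OF finite_E, of z "insert (h q s) X" "h p r"] zX ne pr in_E(2,5)
      insert_A_bases notin_A(3) by simp
  moreover have "insert z D \<in> bases E"
    using insert_D_bases z subset_E by blast
  ultimately show False
    using lopsided_left[OF z(1)] unfolding X_def by blast
qed

lemma lopsided_iff:
  assumes "z \<in> A" "z \<notin> span D"
  shows "h p s \<in> span (A - {z}) \<longleftrightarrow> h q r \<in> span (A - {z})"
  using lopsided_exchange[OF assms] exchange_config.lopsided_exchange[OF relabelled assms]
    h_commute[of r q] h_commute[of s p] by auto

text \<open>If \<open>p\<close> is dead then so is \<open>s\<close>, while \<open>q\<close> and
  \<open>r\<close> are alive. Some \<open>z\<close> outside \<open>span D\<close> is needed to span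
  \<open>h q r\<close>, since \<open>span D\<close> does not contain that edge. By
  \<open>lopsided_iff\<close> it is needed for \<open>h p s\<close> as well. But \<open>z\<close>
  lies in the live or in the dead part of \<open>A\<close>, so it can affect only one of the two
  edges.\<close>

lemma not_dead:
  assumes \<theta>: "models \<theta> A" "\<And>y. y \<in> E \<Longrightarrow> sat \<theta> y \<longleftrightarrow> y \<in> span A"
  shows "\<not> dead \<theta> p"
proof
  assume p: "dead \<theta> p"
  have I: "p \<in> I" "q \<in> I" "r \<in> I" "s \<in> I"
    using indices by auto
  have s: "dead \<theta> s"
    using sat_dead[OF I(1,4) _ p] \<theta>(2) in_E in_A by blast
  have q: "\<not> dead \<theta> q"
    using sat_if_dead[OF in_E(1) p] \<theta>(2) in_E notin_A by blast
  have r: "\<not> dead \<theta> r"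
    using sat_if_dead[OF in_E(2) p] \<theta>(2) in_E notin_A by blast
  define K where "K = {v. \<theta> v \<noteq> None}"
  have clK: "closed A K"
    unfolding closed_def K_def
    using \<theta>(1) satisfies_None_iff unfolding models_def by (metis mem_Collect_eq)
  obtain c d where cd: "ends (h q r) = {c, d}"
    using edge_E in_E by blast
  have "h q r \<notin> span (A \<inter> span D)"
    using notin_D(3) closure_least[of "A \<inter> span D" D] by blast
  then obtain z where z: "z \<in> A" "z \<notin> span D" "h q r \<notin> span (A - {z})"
    using span_Diff[OF indep_A finite_A in_A(2) cd] by blast
  then have "h p s \<notin> span (A - {z})"
    using lopsided_iff by blast
  then obtain \<theta>1 where \<theta>1: "models \<theta>1 (A - {z})" "\<not> sat \<theta>1 (h p s)"
    unfolding span_def by blast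
  obtain \<theta>2 where \<theta>2: "models \<theta>2 (A - {z})" "\<not> sat \<theta>2 (h q r)"
    using z(3) unfolding span_def by blast
  have clKz: "closed (A - {z}) K"
    using clK unfolding closed_def by blast
  obtain a b where ab: "ends z = {a, b}"
    using edge_E z(1) subset_E by blast
  have zK: "a \<in> K \<longleftrightarrow> b \<in> K"
    using clK ab z(1) unfolding closed_def by blast
  have A: "A = insert z (A - {z})"
    using z(1) by blast
  show False
  proof (cases "a \<in> K")
    case True
    define \<theta>' where "\<theta>' = glue K (\<lambda>_. None) \<theta>1"
    have "models \<theta>' (A - {z})"
      unfolding \<theta>'_def using models_glue models_None \<theta>1(1) clKz by blast
    moreover have "sat \<theta>' z"
      unfolding ab \<theta>'_def using True zK by (intro satisfies_None) auto
    ultimately have "models \<theta>' A"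
      using A models_insert by metis
    then have sat: "sat \<theta>' (h p s)"
      using in_A(1) unfolding span_def by blast
    obtain a' b' where ab': "ends (h p s) = {a', b'}"
      using edge_E in_E by blast
    have "att p \<union> att s \<subseteq> - K"
      using p s unfolding dead_def K_def by auto
    then have "a' \<notin> K" "b' \<notin> K"
      using ab' ends_h[of p s] by auto
    then show False
      using sat \<theta>1(2) satisfies_cong[of \<theta>' a' \<theta>1 b'] unfolding ab' \<theta>'_def by simp
  next
    case False
    define \<theta>' where "\<theta>' = glue K \<theta>2 (\<lambda>_. None)"
    have "models \<theta>' (A - {z})"
      unfolding \<theta>'_def using models_glue models_None \<theta>2(1) clKz by blast
    moreover have "sat \<theta>' z"
      unfolding ab \<theta>'_def using False zK by (intro satisfies_None) auto
    ultimately have "models \<theta>' A"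
      using A models_insert by metis
    then have sat: "sat \<theta>' (h q r)"
      using in_A(2) unfolding span_def by blast
    have qr: "q \<in> I" "r \<in> I" "\<not> dead \<theta> q" "\<not> dead \<theta> r"
      using q r I by blast+
    have "att i \<subseteq> K" if "\<not> dead \<theta> i" "i \<in> I" for i
      using that(1) att[OF that(2)] unfolding dead_def K_def by auto
    then have K: "att q \<union> att r \<subseteq> K"
      using qr by simp
    have "{c, d} = att q \<union> att r"
      using cd ends_h[of q r] by simp
    then have "{c, d} \<subseteq> K"
      using K by (rule ssubst)
    then have "c \<in> K" "d \<in> K"
      by simp_all
    then show False
      using sat \<theta>2(2) satisfies_cong[of \<theta>' c \<theta>2 d] unfolding cd \<theta>'_def by simp
  qed
qed

lemma alive:
  assumes \<theta>: "models \<theta> A" "\<And>y. y \<in> E \<Longrightarrow> sat \<theta> y \<longleftrightarrow> y \<in> span A"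
    and i: "i \<in> {p, q, r, s}"
  shows "att i = {u i} \<and> \<theta> (u i) \<noteq> None"
proof -
  have I: "p \<in> I" "q \<in> I" "r \<in> I" "s \<in> I"
    using indices by auto
  have p: "\<not> dead \<theta> p" and r: "\<not> dead \<theta> r"
    using not_dead[OF \<theta>] exchange_config.not_dead[OF relabelled \<theta>] by blast+
  have "\<not> dead \<theta> s"
    using sat_dead[OF I(4,1), of \<theta>] \<theta>(2)[OF in_E(3)] in_A(1) p h_commute[of s p] by auto
  moreover have "\<not> dead \<theta> q"
    using sat_dead[OF I(2,3), of \<theta>] \<theta>(2)[OF in_E(4)] in_A(2) r by auto
  ultimately have nd: "\<not> dead \<theta> i" and iI: "i \<in> I"
    using p r i I by blast+
  then obtain v where "att i = {v}"
    using att[OF iI] unfolding dead_def by blast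
  then show ?thesis
    using nd unfolding dead_def by simp
qed

text \<open>Its failure is what remains known when some edge between the four indices completes
  \<open>X\<close>.\<close>

definition spans_all :: "'a set \<Rightarrow> bool" where
  "spans_all X \<longleftrightarrow> (\<forall>i\<in>{p, q, r, s}. \<forall>j\<in>{p, q, r, s}. i \<noteq> j \<longrightarrow> h i j \<in> span X)"

lemma spans_allI:
  assumes "h p q \<in> span X" "h p r \<in> span X" "h p s \<in> span X" "h q r \<in> span X" "h q s \<in> span X"
    "h r s \<in> span X"
  shows "spans_all X"
  using assms h_commute unfolding spans_all_def by auto

end

section \<open>The position of the four indices in the trees of the two hyperplanes\<close>

locale labelled_config = exchange_config +
  fixes \<theta> \<theta>' :: "'b \<Rightarrow> 'c option"
  assumes \<theta>: "models \<theta> A" "\<And>y. y \<in> E \<Longrightarrow> sat \<theta> y \<longleftrightarrow> y \<in> span A"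
    and \<theta>': "models \<theta>' D" "\<And>y. y \<in> E \<Longrightarrow> sat \<theta>' y \<longleftrightarrow> y \<in> span D"
begin

lemma relabelled': "labelled_config ends gain E I att h A D r s p q \<theta> \<theta>'"
  by (intro labelled_config.intro labelled_config_axioms.intro relabelled \<theta> \<theta>')

lemma swapped': "labelled_config ends gain E I att h D A p q s r \<theta>' \<theta>"
  by (intro labelled_config.intro labelled_config_axioms.intro swapped \<theta> \<theta>')

lemma att_eq: "i \<in> {p, q, r, s} \<Longrightarrow> att i = {u i}"
  and alive_left: "i \<in> {p, q, r, s} \<Longrightarrow> \<theta> (u i) \<noteq> None"
  using alive[OF \<theta>] by blast+

lemma alive_right: "i \<in> {p, q, r, s} \<Longrightarrow> \<theta>' (u i) \<noteq> None"
  using exchange_config.alive[OF swapped \<theta>', of i] by blast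

lemma ends_h_eq: "i \<in> {p, q, r, s} \<Longrightarrow> j \<in> {p, q, r, s} \<Longrightarrow> ends (h i j) = {u i, u j}"
  using ends_h[of i j] att_eq[of i] att_eq[of j] by auto

lemma span_iff_reach_ps: "B \<subseteq> A \<Longrightarrow> h p s \<in> span B \<longleftrightarrow> reach B (u p) (u s)"
  using span_iff_reach[OF \<theta>(1) alive_left[of p] ends_h_eq[of p s]] \<theta>(2)[OF in_E(3)] in_A by simp

lemma span_iff_reach_qr: "B \<subseteq> A \<Longrightarrow> h q r \<in> span B \<longleftrightarrow> reach B (u q) (u r)"
  using span_iff_reach[OF \<theta>(1) alive_left[of q] ends_h_eq[of q r]] \<theta>(2)[OF in_E(4)] in_A by simp

text \<open>Along edges that both labellings satisfy they differ by a constant, so they would agree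
  about \<open>h p r\<close>. But \<open>span D\<close> contains this edge and \<open>span A\<close>
  does not.\<close>

lemma not_reach_inter: "\<not> reach (A \<inter> span D) (u p) (u r)"
proof
  assume pr: "reach (A \<inter> span D) (u p) (u r)"
  have m: "models \<theta> (A \<inter> span D)" "models \<theta>' (A \<inter> span D)"
    using models_subset[OF \<theta>(1)] \<theta>'(1) unfolding models_def span_def by blast+
  obtain a a' where a: "\<theta> (u p) = Some a" "\<theta>' (u p) = Some a'"
    using alive_left[of p] alive_right[of p] by auto
  then obtain b b' where b: "\<theta> (u r) = Some b" "\<theta>' (u r) = Some b'" "b + b' = a + a'"
    using difference_reach[OF pr m] by blast
  have sat': "satisfies \<theta>' {u p, u r} (gain (h p r))"
    using \<theta>'(2)[OF in_E(2)] in_D(1) ends_h_eq[of p r] by simp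
  then have ne: "u p \<noteq> u r"
    using a by (auto simp: satisfies_loop)
  then have "a' + b' = gain (h p r)"
    using sat' a b by (auto simp: satisfies_link)
  moreover have "a + b = a' + b'"
    using b(3) by (metis add.commute add.assoc add_self_left)
  ultimately have "sat \<theta> (h p r)"
    using ends_h_eq[of p r] ne a b by (simp add: satisfies_link)
  then show False
    using \<theta>(2)[OF in_E(2)] notin_A by blast
qed

text \<open>Some \<open>z\<close> outside \<open>span D\<close> separates \<open>p\<close> from
  \<open>r\<close> in the tree of \<open>A\<close>. It leaves \<open>q\<close> connected to
  \<open>s\<close>, since otherwise it would lie in two different components of \<open>X\<close>. By
  \<open>lopsided_iff\<close> it cuts both or neither of \<open>ps\<close> and \<open>qr\<close>.
  Cutting neither would connect \<open>p\<close> to \<open>r\<close>; cutting both would put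
  \<open>r\<close> and \<open>s\<close>, and with them \<open>q\<close>, on one side.\<close>

lemma no_parallel_split:
  assumes x: "x \<in> A" and X: "X = A - {x}"
    and r: "reach X (u p) (u r)" "reach X (u q) (u s)"
    and n: "\<not> reach X (u p) (u s)" "\<not> reach X (u q) (u r)"
  shows False
proof -
  obtain c where c: "\<theta> (u p) = Some c"
    using alive_left[of p] by auto
  have "reach A (u p) (u r)"
    using reach_mono[OF r(1)] X by blast
  then obtain z where z: "z \<in> A" "z \<notin> span D" and npr: "\<not> reach (A - {z}) (u p) (u r)"
    using separating_edge[OF indep_A finite_A \<theta>(1) c _ not_reach_inter] by blast
  have zX: "z \<in> X"
    using z(1) npr r(1) X by blast
  obtain a b where ab: "ends z = {a, b}"
    using edge_E z(1) subset_E by blast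
  have sub: "X - {z} \<subseteq> A - {z}" "X - {z} \<subseteq> X"
    using X by auto
  have qs: "reach (A - {z}) (u q) (u s)"
  proof (rule ccontr)
    assume "\<not> reach (A - {z}) (u q) (u s)"
    then have n': "\<not> reach (X - {z}) (u q) (u s)" "\<not> reach (X - {z}) (u p) (u r)"
      using reach_mono sub(1) npr by blast+
    have "reach X (u p) a \<or> reach X (u p) b" "reach X (u q) a \<or> reach X (u q) b"
      using reach_Diff_cases[OF r(1) zX ab n'(2)] reach_Diff_cases[OF r(2) zX ab n'(1)]
        reach_mono sub(2) by blast+
    then have "reach X (u p) (u q)"
      using reach_edge[OF zX ab] reach_sym reach_trans by metis
    then show False
      using n(1) r(2) reach_trans by blast
  qed
  have "reach (A - {z}) (u p) (u s) \<longleftrightarrow> reach (A - {z}) (u q) (u r)"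
    using lopsided_iff[OF z] span_iff_reach_ps[of "A - {z}"] span_iff_reach_qr[of "A - {z}"] by blast
  then have nps: "\<not> reach (A - {z}) (u p) (u s)" "\<not> reach (A - {z}) (u q) (u r)"
    using npr qs reach_sym reach_trans by metis+
  have "reach A (u p) (u s)"
    using span_iff_reach_ps in_A by blast
  then show False
    using reach_Diff_cases[OF _ z(1) ab nps(1)] reach_Diff_cases[OF \<open>reach A (u p) (u r)\<close> z(1) ab npr]
      npr nps(2) qs reach_sym reach_trans by metis
qed

text \<open>Dropping \<open>x\<close> leaves two sides, with \<open>p\<close> opposite to
  \<open>s\<close> and \<open>q\<close> opposite to \<open>r\<close>. Of the two possible
  arrangements \<open>no_parallel_split\<close> excludes the one that puts \<open>p\<close> with
  \<open>r\<close>.\<close>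

lemma quartet:
  assumes x: "x \<in> A" and X: "X = A - {x}" and n: "h p s \<notin> span X" "h q r \<notin> span X"
  shows "reach X (u p) (u q)" "reach X (u r) (u s)" "\<not> reach X (u p) (u r)"
proof -
  obtain a b where ab: "ends x = {a, b}"
    using edge_E x subset_E by blast
  have n': "\<not> reach X (u p) (u s)" "\<not> reach X (u q) (u r)"
    using n span_iff_reach_ps[of X] span_iff_reach_qr[of X] X by auto
  have A: "reach A (u p) (u s)" "reach A (u q) (u r)"
    using in_A span_iff_reach_ps[of A] span_iff_reach_qr[of A] by auto
  have c: "reach X (u p) a \<and> reach X b (u s) \<or> reach X (u p) b \<and> reach X a (u s)"
    "reach X (u q) a \<and> reach X b (u r) \<or> reach X (u q) b \<and> reach X a (u r)"
    using reach_Diff_cases[OF A(1) x ab] reach_Diff_cases[OF A(2) x ab] n' X by auto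
  have "reach X (u p) (u q) \<and> reach X (u r) (u s) \<or> reach X (u p) (u r) \<and> reach X (u q) (u s)"
    using c reach_common[of X "u p" _ "u q"] reach_common'[of X _ "u r" "u s"]
      reach_trans[of X "u p" _ "u r"] reach_trans[of X "u q" _ "u s"] by blast
  then show pq: "reach X (u p) (u q)" and rs: "reach X (u r) (u s)"
    using no_parallel_split[OF x X _ _ n'] by blast+
  show "\<not> reach X (u p) (u r)"
    using rs n'(1) reach_trans by blast
qed

text \<open>A labelling of \<open>X\<close> that agrees with \<open>\<theta>\<close> on the
  component of \<open>u p\<close> violates \<open>h p q\<close>, hence also \<open>y\<close>.
  Killing everything else shows that \<open>y\<close> meets this component; shifting the component
  of \<open>u r\<close> shows that \<open>y\<close> does not lead there. As \<open>a\<close> and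
  \<open>b\<close> may be swapped, the second conclusion excludes both ends.\<close>

lemma exchange_edge_ends:
  assumes X: "X \<subseteq> A" "reach X (u p) (u q)" "\<not> reach X (u p) (u r)"
    and y: "h p q \<in> span (insert y X)" "ends y = {a, b}"
  shows "reach X (u p) a \<or> reach X (u p) b" "\<not> reach X (u r) b"
proof -
  define S T where "S = {v. reach X (u p) v}" and "T = {v. reach X (u r) v}"
  have closed: "closed X S" "closed X T"
    unfolding S_def T_def by (rule closed_component)+
  have disjoint: "v \<notin> T" if "v \<in> S" for v
    using that X(3) reach_sym reach_trans unfolding S_def T_def by blast
  have m: "models \<theta> X"
    using models_subset \<theta>(1) X(1) by blast
  have not_y: "\<not> sat \<theta>1 y" if "models \<theta>1 X" "\<And>v. v \<in> S \<Longrightarrow> \<theta>1 v = \<theta> v" for \<theta>1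
  proof
    assume "sat \<theta>1 y"
    then have "sat \<theta>1 (h p q)"
      using y(1) that(1) unfolding span_def by simp
    then have "satisfies \<theta> {u p, u q} (gain (h p q))"
      using that(2)[of "u p"] that(2)[of "u q"] X(2) satisfies_cong[of \<theta>1 "u p" \<theta> "u q"]
        ends_h_eq[of p q] unfolding S_def by simp
    then show False
      using \<theta>(2)[OF in_E(1)] notin_A(1) ends_h_eq[of p q] by simp
  qed
  have "models (glue S \<theta> (\<lambda>_. None)) X"
    using models_glue m models_None closed by blast
  then have "\<not> sat (glue S \<theta> (\<lambda>_. None)) y"
    using not_y by simp
  then have S: "a \<in> S \<or> b \<in> S"
    unfolding y(2) using satisfies_None[of "glue S \<theta> (\<lambda>_. None)" a b] glue_out by metis
  then show "reach X (u p) a \<or> reach X (u p) b"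
    unfolding S_def by simp
  show "\<not> reach X (u r) b"
  proof
    assume "reach X (u r) b"
    then have b: "b \<in> T" "a \<in> S" "a \<notin> T" "b \<notin> S"
      using S disjoint unfolding T_def by auto
    obtain c d where cd: "\<theta> a = Some c" "\<theta> b = Some d"
      using alive_reach[OF _ m, of "u p" a] alive_reach[OF _ m, of "u r" b] b(1,2)
        alive_left[of p] alive_left[of r] unfolding S_def T_def by auto
    define e where "e = c + d + gain y"
    define \<theta>2 where "\<theta>2 = glue T (shift e \<theta>) \<theta>"
    have "models \<theta>2 X"
      unfolding \<theta>2_def using models_glue models_shift m closed by blast
    moreover have "\<theta>2 v = \<theta> v" if "v \<in> S" for v
      unfolding \<theta>2_def using disjoint[OF that] by simp
    moreover have "c + (e + d) = gain y"
      unfolding e_def by (metis add.assoc add.commute add_self_left)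
    moreover have "\<theta>2 a = Some c" "\<theta>2 b = Some (e + d)"
      unfolding \<theta>2_def using b cd shift_Some[of \<theta> b d e] by simp_all
    moreover have "a \<noteq> b"
      using b by blast
    ultimately have "models \<theta>2 X" "\<And>v. v \<in> S \<Longrightarrow> \<theta>2 v = \<theta> v" "sat \<theta>2 y"
      unfolding y(2) using satisfies_link[of a b \<theta>2 "gain y"] by simp_all
    then show False
      using not_y by blast
  qed
qed

text \<open>If \<open>h p s\<close> or \<open>h q r\<close> survived without \<open>x\<close>, all
  four indices would be joined. So \<open>x\<close> cuts as in \<open>quartet\<close>, and
  \<open>y\<close> would have to meet the component of \<open>u p\<close> because of
  \<open>h p q\<close> and to avoid it because of \<open>h r s\<close>.\<close>

lemma not_both_spanned_left:
  assumes x: "x \<in> A" and y: "y \<in> E" and n: "\<not> spans_all (insert y (A - {x}))"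
    and s: "h p q \<in> span (insert y (A - {x}))" "h r s \<in> span (insert y (A - {x}))"
  shows False
proof -
  define X where "X = A - {x}"
  let ?A = "insert y X"
  have mono: "span X \<subseteq> span ?A"
    using closure_mono by blast
  have s: "h p q \<in> span ?A" "h q p \<in> span ?A" "h r s \<in> span ?A" "h s r \<in> span ?A"
    and n: "\<not> spans_all ?A"
    using s n h_commute unfolding X_def by auto
  have ps: "h p s \<notin> span X"
  proof
    assume "h p s \<in> span X"
    then have ps: "h p s \<in> span ?A" "h s p \<in> span ?A"
      using mono h_commute by auto
    then have "h p r \<in> span ?A" "h q s \<in> span ?A"
      using triangle_span[of p r s ?A] triangle_span[of q s p ?A] s indices(1) by auto
    moreover from this have "h q r \<in> span ?A"
      using triangle_span[of q r p ?A] s indices(1) by auto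
    ultimately show False
      using spans_allI s ps n by blast
  qed
  have qr: "h q r \<notin> span X"
  proof
    assume "h q r \<in> span X"
    then have qr: "h q r \<in> span ?A" "h r q \<in> span ?A"
      using mono h_commute by auto
    then have "h p r \<in> span ?A" "h q s \<in> span ?A"
      using triangle_span[of p r q ?A] triangle_span[of q s r ?A] s indices(1) by auto
    moreover from this have "h p s \<in> span ?A"
      using triangle_span[of p s q ?A] s indices(1) by auto
    ultimately show False
      using spans_allI s qr n by blast
  qed
  note q = quartet[OF x X_def ps qr]
  obtain a b where ab: "ends y = {a, b}"
    using edge_E y by blast
  interpret re: labelled_config ends gain E I att h A D r s p q \<theta> \<theta>'
    by (rule relabelled')
  have XA: "X \<subseteq> A"
    unfolding X_def by blast
  have "\<not> reach X (u r) (u p)"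
    using q(3) reach_sym by blast
  note re = re.exchange_edge_ends(2)[OF XA q(2) this s(3)]
  have "\<not> reach X (u p) b" "\<not> reach X (u p) a"
    using re[OF ab] re[of b a] ab by (auto simp: insert_commute)
  then show False
    using exchange_edge_ends(1)[OF XA q(1,3) s(1) ab] by blast
qed

lemma not_both_spanned_right:
  assumes "y \<in> D" "x \<in> E" "\<not> spans_all (insert x (D - {y}))"
    "h p q \<in> span (insert x (D - {y}))" "h r s \<in> span (insert x (D - {y}))"
  shows False
proof -
  interpret sw: labelled_config ends gain E I att h D A p q s r \<theta>' \<theta>
    by (rule swapped')
  have "\<not> sw.spans_all (insert x (D - {y}))"
    using assms(3) unfolding sw.spans_all_def spans_all_def by (simp add: insert_commute)
  then show False
    using sw.not_both_spanned_left assms h_commute[of s r] by auto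
qed

text \<open>In this case an edge of \<open>D - {y}\<close> on the way from \<open>u r\<close> to \<open>y\<close> leaves the component of
  \<open>u r\<close> in \<open>A - {x}\<close>. Exchanging it instead of \<open>y\<close> with \<open>x\<close> gives a crossing pair.\<close>

lemma pq_not_spanned_twice:
  assumes x: "x \<in> A" and y: "y \<in> D"
    and nA: "\<not> spans_all (insert y (A - {x}))" and nD: "\<not> spans_all (insert x (D - {y}))"
    and pqA: "h p q \<in> span (insert y (A - {x}))" and pqD: "h p q \<in> span (insert x (D - {y}))"
  shows False
proof -
  interpret sw: labelled_config ends gain E I att h D A p q s r \<theta>' \<theta>
    by (rule swapped')
  define X Y where "X = A - {x}" and "Y = D - {y}"
  have XA: "X \<subseteq> A" and YD: "Y \<subseteq> D"
    unfolding X_def Y_def by blast+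
  have E: "x \<in> E" "y \<in> E"
    using x y subset_E by blast+
  have rsA: "h r s \<notin> span (insert y X)"
    using not_both_spanned_left[OF x E(2) nA pqA] unfolding X_def by blast
  have rsD: "h r s \<notin> span (insert x Y)"
    using not_both_spanned_right[OF y E(1) nD pqD] unfolding Y_def by blast
  have pqA: "h p q \<in> span (insert y X)" "h q p \<in> span (insert y X)"
    and pqD: "h p q \<in> span (insert x Y)" "h q p \<in> span (insert x Y)"
    using pqA pqD h_commute[of q p] unfolding X_def Y_def by auto
  have xD: "x \<notin> span D"
  proof
    assume "x \<in> span D"
    then have "insert x Y \<subseteq> span D"
      using extensive[of D] YD by blast
    then show False
      using closure_least pqD(1) notin_D(1) by blast
  qed
  have yA: "y \<notin> span A"
  proof
    assume "y \<in> span A"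
    then have "insert y X \<subseteq> span A"
      using extensive[of A] XA by blast
    then show False
      using closure_least pqA(1) notin_A(1) by blast
  qed
  \<comment> \<open>By \<open>lopsided_iff\<close> the two edges are kept or lost together, and if
    kept they would join \<open>r\<close> to \<open>s\<close> through \<open>q\<close> and
    \<open>p\<close>.\<close>
  have psqr: "h p s \<notin> span X \<and> h q r \<notin> span X"
  proof (rule ccontr)
    assume "\<not> ?thesis"
    then have "h p s \<in> span (insert y X)" "h q r \<in> span (insert y X)"
      using lopsided_iff[OF x xD] closure_mono[of X "insert y X"] unfolding X_def by blast+
    then have "h r s \<in> span (insert y X)"
      using triangle_span[of q s p "insert y X"] triangle_span[of r s q "insert y X"] pqA
        h_commute[of r q] indices(1) by auto
    then show False using rsA by blast
  qed
  have prqs: "h p r \<notin> span Y \<and> h q s \<notin> span Y"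
  proof (rule ccontr)
    assume "\<not> ?thesis"
    then have "h p r \<in> span (insert x Y)" "h q s \<in> span (insert x Y)"
      using sw.lopsided_iff[OF y yA] closure_mono[of Y "insert x Y"] unfolding Y_def by blast+
    then have "h r s \<in> span (insert x Y)"
      using triangle_span[of q r p "insert x Y"] triangle_span[of r s q "insert x Y"] pqD
        h_commute[of r q] indices(1) by auto
    then show False using rsD by blast
  qed
  note qX = quartet[OF x X_def psqr[THEN conjunct1] psqr[THEN conjunct2]]
  note qY = sw.quartet[OF y Y_def prqs[THEN conjunct1] prqs[THEN conjunct2]]
  have nprY: "\<not> reach Y (u p) (u r)"
    using qY(2,3) reach_sym reach_trans by metis
  have yT: "\<not> reach X (u r) b" if "ends y = {a, b}" for a b
    using exchange_edge_ends(2)[OF XA qX(1,3) pqA(1) that] .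
  have xT: "\<not> reach Y (u r) b" if "ends x = {a, b}" for a b
    using sw.exchange_edge_ends(2)[OF YD qY(1,3) pqD(1) that] qY(2) reach_trans by blast
  have "reach D (u p) (u r)"
    using sw.span_iff_reach_ps[of D] in_D(1) by blast
  moreover obtain a b where "ends y = {a, b}"
    using edge_E[OF E(2)] by blast
  moreover from this have "ends y = {b, a}"
    by (simp add: insert_commute)
  \<comment> \<open>\<open>D\<close> connects \<open>p\<close> with \<open>r\<close> and
    \<open>Y\<close> does not, so the connection uses \<open>y\<close>; \<open>t'\<close> is the end
    of \<open>y\<close> on the side of \<open>r\<close>.\<close>
  ultimately obtain s' t' where st: "ends y = {s', t'}" "reach Y (u p) s'" "reach Y t' (u r)"
    using reach_Diff_cases[of D "u p" "u r" y a b] y nprY unfolding Y_def by blast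
  have t'r: "reach Y (u r) t'"
    using st(3) reach_sym by blast
  \<comment> \<open>In \<open>Y\<close> the vertex \<open>t'\<close> is reached from
    \<open>u r\<close>, but it lies outside \<open>T\<close>. So the edges of \<open>Y\<close> that
    respect \<open>T\<close> do not suffice, and by \<open>separating_edge\<close> some edge
    \<open>z\<close> across the boundary of \<open>T\<close> is a bridge between \<open>u r\<close>
    and \<open>t'\<close>.\<close>
  define T where "T = {v. reach X (u r) v}"
  define B where "B = {e \<in> Y. \<forall>a b. ends e = {a, b} \<longrightarrow> (a \<in> T \<longleftrightarrow> b \<in> T)}"
  have "closed B T"
    unfolding closed_def B_def by blast
  moreover have "u r \<in> T" "t' \<notin> T"
    using yT[OF st(1)] unfolding T_def by auto
  ultimately have "\<not> reach B (u r) t'"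
    using closed_reach by blast
  moreover obtain c where "\<theta>' (u r) = Some c"
    using alive_right[of r] by auto
  moreover have "indep Y" "finite Y" "models \<theta>' Y" "B \<subseteq> Y"
    using indep_subset[OF indep_D YD] finite_subset[OF YD finite_D] models_subset[OF \<theta>'(1) YD]
    unfolding B_def by auto
  ultimately obtain z where z: "z \<in> Y - B" "\<not> reach (Y - {z}) (u r) t'"
    using separating_edge[of Y \<theta>' "u r" c t' B] t'r by blast
  then have zD: "z \<in> D" "z \<noteq> y"
    unfolding Y_def by auto
  obtain a b where ab: "ends z = {a, b}" "a \<in> T" "b \<notin> T"
    using z(1) unfolding B_def by (auto simp: insert_commute)
  \<comment> \<open>Keeping \<open>\<theta>\<close> on \<open>T\<close> only makes both ends of
    \<open>h p q\<close> dead but leaves exactly one end of \<open>z\<close> alive.\<close>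
  have zX: "z \<notin> span (insert (h p q) X)"
  proof
    define \<theta>1 where "\<theta>1 = glue T \<theta> (\<lambda>_. None)"
    assume zs: "z \<in> span (insert (h p q) X)"
    have "u p \<notin> T" "u q \<notin> T"
      using qX(1,3) reach_sym reach_trans unfolding T_def by blast+
    then have "sat \<theta>1 (h p q)"
      using ends_h_eq[of p q] satisfies_None[of \<theta>1 "u p" "u q"] unfolding \<theta>1_def by simp
    moreover have "models \<theta>1 X"
      unfolding \<theta>1_def T_def using models_glue models_subset[OF \<theta>(1) XA] models_None closed_component
      by blast
    ultimately have "sat \<theta>1 z"
      using zs unfolding span_def by simp
    then have "\<theta> a = None"
      using satisfies_None_iff[of \<theta>1 a b] ab unfolding \<theta>1_def by auto
    then show False
      using alive_reach[OF _ models_subset[OF \<theta>(1) XA], of "u r" a] ab(2) alive_left[of r]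
      unfolding T_def by auto
  qed
  \<comment> \<open>This is the part that \<open>z\<close> cuts off. Neither \<open>y\<close> nor
    \<open>x\<close> has an end in it, so labels on it can be changed without affecting
    them.\<close>
  define T2 where "T2 = {v. reach (Y - {z}) (u r) v}"
  have T2Y: "reach Y (u r) v" if "v \<in> T2" for v
    using that reach_mono[of "Y - {z}" "u r" v Y] unfolding T2_def by blast
  have pT2: "v \<notin> T2" if "reach Y (u p) v" for v
    using that T2Y nprY reach_sym reach_trans by blast
  have closed: "closed (D - {z}) T2"
  proof -
    have "closed (Y - {z}) T2"
      unfolding T2_def by (rule closed_component)
    moreover have "s' \<notin> T2" "t' \<notin> T2"
      using pT2 st(2) z(2) unfolding T2_def by auto
    moreover have "e \<in> Y - {z}" if "e \<in> D - {z}" "e \<noteq> y" for e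
      using that unfolding Y_def by blast
    ultimately show ?thesis
      using st(1) unfolding closed_def by (metis doubleton_eq_iff)
  qed
  have m: "models \<theta>' (D - {z})"
    using models_subset[OF \<theta>'(1)] by blast
  obtain v w where vw: "ends x = {v, w}"
    using edge_E E(1) by blast
  have vwT2: "v \<notin> T2" "w \<notin> T2"
    using xT[OF vw] xT[of w v] vw T2Y by (auto simp: insert_commute)
  have rT2: "u r \<in> T2"
    unfolding T2_def by simp
  have xrs: "x \<notin> span (insert (h r s) (D - {z}))"
  proof
    assume xs: "x \<in> span (insert (h r s) (D - {z}))"
    obtain c d where cd: "\<theta>' (u r) = Some c" "\<theta>' (u s) = Some d"
      using alive_right[of r] alive_right[of s] by auto
    \<comment> \<open>\<open>h r s\<close> is repaired by changing \<open>T2\<close> only: killing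
      it if it contains \<open>u s\<close>, shifting it otherwise. The violated edge
      \<open>x\<close> does not notice.\<close>
    define e where "e = c + d + gain (h r s)"
    define \<theta>2 where "\<theta>2 = glue T2 (if u s \<in> T2 then \<lambda>_. None else shift e \<theta>') \<theta>'"
    have "models \<theta>2 (D - {z})"
      unfolding \<theta>2_def using models_glue[OF _ m closed] models_shift[OF m] models_None by simp
    moreover have "sat \<theta>2 (h r s)"
    proof (cases "u s \<in> T2")
      case True
      then show ?thesis
        using ends_h_eq[of r s] satisfies_None[of \<theta>2 "u r" "u s"] rT2 unfolding \<theta>2_def by simp
    next
      case False
      then have "u r \<noteq> u s"
        using rT2 by metis
      moreover have "e + c + d = gain (h r s)"
        unfolding e_def by (metis add.assoc add.commute add_self_left)
      moreover have "\<theta>2 (u r) = Some (e + c)" "\<theta>2 (u s) = Some d"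
        unfolding \<theta>2_def using False rT2 cd shift_Some[of \<theta>' "u r" c e] by simp_all
      ultimately show ?thesis
        using ends_h_eq[of r s] satisfies_link[of "u r" "u s" \<theta>2 "gain (h r s)"] by simp
    qed
    ultimately have "sat \<theta>2 x"
      using xs unfolding span_def by simp
    then have "sat \<theta>' x"
      using satisfies_cong[of \<theta>2 v \<theta>' w] vwT2 unfolding vw \<theta>2_def by simp
    then show False
      using \<theta>'(2)[OF E(1)] xD by blast
  qed
  define A' D' where "A' = insert z X" and "D' = insert x (D - {z})"
  have ne: "h i j \<notin> {x, z}" if "i \<in> {p, q, r, s}" "j \<in> {p, q, r, s}" for i j
    using x zD(1) avoid[OF that] by auto
  have A': "insert (h p q) A' \<in> bases E"
  proof -
    have "insert x (insert (h p q) X) = insert (h p q) A"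
      using x unfolding X_def by auto
    then show ?thesis
      using insert_in_bases_iff[OF finite_E, of x "insert (h p q) X" z] bases(1) ne[of p q] zX zD(1)
        subset_E unfolding A'_def X_def by (auto simp: insert_commute)
  qed
  have D': "insert (h r s) D' \<in> bases E"
  proof -
    have "insert z (insert (h r s) (D - {z})) = insert (h r s) D"
      using zD by auto
    then show ?thesis
      using insert_in_bases_iff[OF finite_E, of z "insert (h r s) (D - {z})" x] bases(2) ne[of r s] xrs
        E(1) unfolding D'_def by (auto simp: insert_commute)
  qed
  have "\<not> crossing A' D' p q r s"
    using exchanged[OF x zD(1)] A' D' unfolding A'_def D'_def X_def by blast
  \<comment> \<open>\<open>D'\<close> cuts \<open>r\<close> off from both \<open>p\<close> and
    \<open>q\<close>. To avoid a crossing, \<open>A'\<close> must then join \<open>s\<close> to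
    \<open>q\<close> and to \<open>p\<close>, although \<open>h p q\<close> completes
    \<open>A'\<close>.\<close>
  moreover have "separates D' i r" if i: "i \<in> {p, q}" for i
  proof -
    define \<theta>3 where "\<theta>3 = glue T2 \<theta>' (\<lambda>_. None)"
    have "models \<theta>3 (D - {z})"
      unfolding \<theta>3_def using models_glue[OF m _ closed] models_None by blast
    moreover have "sat \<theta>3 x"
      unfolding vw \<theta>3_def using vwT2 by (intro satisfies_None) auto
    moreover have "u i \<notin> T2"
      using i pT2 qY(1) by auto
    then have "\<not> sat \<theta>3 (h i r)"
      using satisfies_None_iff[of \<theta>3 "u i" "u r"] ends_h_eq[of i r] i rT2 alive_right[of r]
      unfolding \<theta>3_def by auto
    ultimately have "h i r \<notin> span D'"
      unfolding span_def D'_def using models_insert by blast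
    then show ?thesis
      unfolding separates_def using i in_E by auto
  qed
  ultimately have "\<not> separates A' q s" "\<not> separates A' p s"
    unfolding crossing_def by blast+
  then have "h q s \<in> span A'" "h p s \<in> span A'"
    unfolding separates_def using in_E by blast+
  then have "h p q \<in> span A'"
    using triangle_span[of p q s A'] indices(1) h_commute[of s q] by auto
  moreover have "h p q \<notin> A'"
    unfolding A'_def X_def using pq_notin_A ne[of p q] by auto
  ultimately show False
    using A' indep_insert_notin unfolding bases_def by blast
qed

end

context exchange_config
begin

text \<open>If both placements fail, each contains a spanned edge. This gives four cases: both edges
  are spanned on one side, or one of them on both sides. The edges \<open>h i j\<close> and
  \<open>h k l\<close> witness that neither new set joins all four indices.\<close>

lemma exchange_keeps_bases:
  assumes x: "x \<in> A" and y: "y \<in> D"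
    and ij: "i \<in> {p, q, r, s}" "j \<in> {p, q, r, s}" "i \<noteq> j" "insert (h i j) (insert y (A - {x})) \<in> bases E"
    and kl: "k \<in> {p, q, r, s}" "l \<in> {p, q, r, s}" "k \<noteq> l" "insert (h k l) (insert x (D - {y})) \<in> bases E"
  shows "insert (h p q) (insert y (A - {x})) \<in> bases E \<and> insert (h r s) (insert x (D - {y})) \<in> bases E \<or>
     insert (h r s) (insert y (A - {x})) \<in> bases E \<and> insert (h p q) (insert x (D - {y})) \<in> bases E"
proof (rule ccontr)
  define A' D' where "A' = insert y (A - {x})" and "D' = insert x (D - {y})"
  assume "\<not> ?thesis"
  then have n: "\<not> (insert (h p q) A' \<in> bases E \<and> insert (h r s) D' \<in> bases E \<or>
      insert (h r s) A' \<in> bases E \<and> insert (h p q) D' \<in> bases E)"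
    unfolding A'_def D'_def .
  have b: "insert (h i j) A' \<in> bases E" "insert (h k l) D' \<in> bases E"
    using ij(4) kl(4) unfolding A'_def D'_def .
  have E: "x \<in> E" "y \<in> E"
    using x y subset_E by blast+
  have avoid': "h i j \<notin> A'" "h i j \<notin> D'" if "i \<in> {p, q, r, s}" "j \<in> {p, q, r, s}" for i j
    using x y avoid[OF that] unfolding A'_def D'_def by blast+
  note iff =
    insert_in_bases_iff[OF finite_E b(1) avoid'(1)[OF ij(1,2)] in_E(1)] insert_in_bases_iff[OF finite_E b(1) avoid'(1)[OF ij(1,2)] in_E(6)]
    insert_in_bases_iff[OF finite_E b(2) avoid'(2)[OF kl(1,2)] in_E(1)] insert_in_bases_iff[OF finite_E b(2) avoid'(2)[OF kl(1,2)] in_E(6)]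
  have "h i j \<notin> span A'" "h k l \<notin> span D'"
    using indep_insert_notin[OF _ avoid'(1)[OF ij(1,2)]] indep_insert_notin[OF _ avoid'(2)[OF kl(1,2)]] b
    unfolding bases_def by simp_all
  then have all: "\<not> spans_all A'" "\<not> spans_all D'"
    using ij kl unfolding spans_all_def by blast+
  obtain \<theta> where \<theta>: "models \<theta> A" "\<And>y. y \<in> E \<Longrightarrow> sat \<theta> y \<longleftrightarrow> y \<in> span A"
    using hyperplane_labelling[OF bases(1) pq_notin_A] by blast
  obtain \<theta>' where \<theta>': "models \<theta>' D" "\<And>y. y \<in> E \<Longrightarrow> sat \<theta>' y \<longleftrightarrow> y \<in> span D"
    using hyperplane_labelling[OF bases(2) rs_notin_D] by blast
  interpret lab: labelled_config ends gain E I att h A D p q r s \<theta> \<theta>'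
    by unfold_locales (use \<theta> \<theta>' in auto)
  interpret re: labelled_config ends gain E I att h A D r s p q \<theta> \<theta>'
    by (rule lab.relabelled')
  have all': "\<not> re.spans_all A'" "\<not> re.spans_all D'"
    using all unfolding re.spans_all_def spans_all_def by (simp_all add: insert_commute)
  have "h p q \<in> span A' \<and> h r s \<in> span A' \<or> h p q \<in> span D' \<and> h r s \<in> span D' \<or>
      h p q \<in> span A' \<and> h p q \<in> span D' \<or> h r s \<in> span A' \<and> h r s \<in> span D'"
    using n unfolding iff by satx
  then show False
    using lab.not_both_spanned_left[OF x E(2)] lab.not_both_spanned_right[OF y E(1)]
      lab.pq_not_spanned_twice[OF x y] re.pq_not_spanned_twice[OF x y] all all'
    unfolding A'_def D'_def by blast
qed

end

section \<open>Gains for the v-deleted biased graph\<close>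

lemma odd_card_sym_diff:
  assumes "finite P" "finite Q"
  shows "odd (card (sym_diff P Q)) \<longleftrightarrow> odd (card P) \<noteq> odd (card Q)"
proof -
  have "card (sym_diff P Q) = card (P - Q) + card (Q - P)"
    using assms by (intro card_Un_disjoint) auto
  moreover have "card P = card (P - Q) + card (P \<inter> Q)" "card Q = card (Q - P) + card (P \<inter> Q)"
    using assms card_Diff_subset_Int[of P Q] card_Diff_subset_Int[of Q P]
      card_mono[of P "P \<inter> Q"] card_mono[of Q "P \<inter> Q"] by (auto simp: Int_commute)
  ultimately show ?thesis by auto
qed

lemma symm_diff_of_sym_diff:
  assumes "finite S" "finite T"
  shows "symm_diff_of (sym_diff S T) = sym_diff (symm_diff_of S) (symm_diff_of T)"
proof -
  have "odd (card {X \<in> sym_diff S T. x \<in> X}) \<longleftrightarrow>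
      odd (card {X \<in> S. x \<in> X}) \<noteq> odd (card {X \<in> T. x \<in> X})" for x
  proof -
    have "{X \<in> sym_diff S T. x \<in> X} = sym_diff {X \<in> S. x \<in> X} {X \<in> T. x \<in> X}"
      by blast
    then show ?thesis
      using odd_card_sym_diff[of "{X \<in> S. x \<in> X}" "{X \<in> T. x \<in> X}"] assms by simp
  qed
  then show ?thesis
    unfolding symm_diff_of_def by blast
qed

lemma symm_diff_of_empty [simp]: "symm_diff_of {} = {}"
  unfolding symm_diff_of_def by simp

lemma symm_diff_of_disjoint:
  assumes "\<And>X Y. X \<in> P \<Longrightarrow> Y \<in> P \<Longrightarrow> X \<noteq> Y \<Longrightarrow> X \<inter> Y = {}"
  shows "symm_diff_of P = \<Union>P"
proof -
  have "odd (card {X \<in> P. x \<in> X}) \<longleftrightarrow> x \<in> \<Union>P" for x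
  proof (cases "x \<in> \<Union>P")
    case True
    then obtain X where X: "X \<in> P" "x \<in> X" by blast
    then have "{X \<in> P. x \<in> X} = {X}"
      using assms by blast
    then show ?thesis using True by simp
  next
    case False
    then have "{X \<in> P. x \<in> X} = {}" by blast
    then show ?thesis
      using False by (simp only: card.empty) simp
  qed
  then show ?thesis
    unfolding symm_diff_of_def by blast
qed

text \<open>The linear span over the field with two elements, with symmetric difference as
  addition.\<close>

definition symm_span :: "'a set set \<Rightarrow> 'a set set" where
  "symm_span \<A> = {symm_diff_of S | S. finite S \<and> S \<subseteq> \<A>}"

lemma symm_span_empty: "{} \<in> symm_span \<A>"
  unfolding symm_span_def by (intro CollectI exI[of _ "{}"]) simp

lemma symm_span_superset: "X \<in> \<A> \<Longrightarrow> X \<in> symm_span \<A>"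
proof -
  assume "X \<in> \<A>"
  moreover have "X = symm_diff_of {X}"
    using symm_diff_of_disjoint[of "{X}"] by simp
  ultimately show ?thesis
    unfolding symm_span_def by (intro CollectI exI[of _ "{X}"]) simp
qed

lemma symm_span_sym_diff:
  assumes "X \<in> symm_span \<A>" "Y \<in> symm_span \<A>"
  shows "sym_diff X Y \<in> symm_span \<A>"
proof -
  obtain S T where S: "finite S" "S \<subseteq> \<A>" "X = symm_diff_of S" and T: "finite T" "T \<subseteq> \<A>" "Y = symm_diff_of T"
    using assms unfolding symm_span_def by blast
  have "sym_diff X Y = symm_diff_of (sym_diff S T)"
    using symm_diff_of_sym_diff[OF S(1) T(1)] S(3) T(3) by simp
  moreover have "finite (sym_diff S T)" "sym_diff S T \<subseteq> \<A>"
    using S T by auto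
  ultimately show ?thesis
    unfolding symm_span_def by blast
qed

lemma symm_span_induct [consumes 1, case_names empty sym_diff]:
  assumes "X \<in> symm_span \<A>" "P {}"
    and "\<And>X Y. X \<in> \<A> \<Longrightarrow> Y \<in> symm_span \<A> \<Longrightarrow> P Y \<Longrightarrow> P (sym_diff X Y)"
  shows "P X"
proof -
  obtain S where S: "finite S" "S \<subseteq> \<A>" "X = symm_diff_of S"
    using assms(1) unfolding symm_span_def by blast
  have "P (symm_diff_of S)"
    using S(1,2)
  proof (induction S rule: finite_induct)
    case (insert Y S)
    have "symm_diff_of (insert Y S) = sym_diff (symm_diff_of {Y}) (symm_diff_of S)"
    proof -
      have "insert Y S = sym_diff {Y} S"
        using insert.hyps by auto
      then show ?thesis
        using symm_diff_of_sym_diff[of "{Y}" S] insert.hyps(1) by simp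
    qed
    moreover have "symm_diff_of {Y} = Y"
      using symm_diff_of_disjoint[of "{Y}"] by simp
    moreover have "symm_diff_of S \<in> symm_span \<A>"
      using insert unfolding symm_span_def by blast
    ultimately show ?case
      using insert assms(3) by simp
  qed (use assms(2) in simp)
  then show ?thesis using S(3) by simp
qed

lemma symm_span_Union: "X \<in> symm_span \<A> \<Longrightarrow> X \<subseteq> \<Union>\<A>"
  by (induction rule: symm_span_induct) auto

text \<open>The orthogonal complement for the pairing that sends two sets to the parity of their
  intersection.\<close>

definition annihilator :: "'a set set \<Rightarrow> 'a set set" where
  "annihilator N = {F. \<forall>S\<in>N. even (card (S \<inter> F))}"

text \<open>A subspace that is maximal among those containing \<open>N\<close> and avoiding
  \<open>X\<close> is the kernel of a linear functional. The functional is the parity on the set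
  \<open>F\<close> of those elements whose singletons lie outside the subspace.\<close>

lemma annihilator_separates:
  assumes fin: "finite E" and N: "N \<subseteq> Pow E" "{} \<in> N" "\<And>S T. S \<in> N \<Longrightarrow> T \<in> N \<Longrightarrow> sym_diff S T \<in> N"
    and X: "X \<subseteq> E" "X \<notin> N"
  shows "\<exists>F\<in>annihilator N. odd (card (X \<inter> F))"
proof -
  define \<M> where "\<M> = {M. N \<subseteq> M \<and> M \<subseteq> Pow E \<and> X \<notin> M \<and> (\<forall>S\<in>M. \<forall>T\<in>M. sym_diff S T \<in> M)}"
  have "\<M> \<subseteq> Pow (Pow E)"
    unfolding \<M>_def by blast
  then have "finite \<M>"
    using fin by (simp add: finite_subset)
  moreover have "N \<in> \<M>"
    using N X unfolding \<M>_def by blast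
  ultimately have "\<exists>M\<in>\<M>. N \<subseteq> M \<and> (\<forall>M'\<in>\<M>. M \<subseteq> M' \<longrightarrow> M = M')"
    using finite_has_maximal2[of \<M> N] by simp
  then obtain M where M: "M \<in> \<M>" and max: "\<And>M'. M' \<in> \<M> \<Longrightarrow> M \<subseteq> M' \<Longrightarrow> M = M'"
    by metis
  have M': "N \<subseteq> M" "M \<subseteq> Pow E" "X \<notin> M" and add: "\<And>S T. S \<in> M \<Longrightarrow> T \<in> M \<Longrightarrow> sym_diff S T \<in> M"
    using M unfolding \<M>_def by auto
  have e: "{} \<in> M"
    using subsetD[OF M'(1) N(2)] .
  \<comment> \<open>If both \<open>S\<close> and its sum with \<open>X\<close> stayed outside,
    adjoining \<open>S\<close> to \<open>M\<close> would give a larger subspace that still avoids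
    \<open>X\<close>.\<close>
  have index2: "sym_diff S X \<in> M" if S: "S \<subseteq> E" "S \<notin> M" for S
  proof (rule ccontr)
    assume n: "sym_diff S X \<notin> M"
    define M2 where "M2 = M \<union> (\<lambda>T. sym_diff S T) ` M"
    have "sym_diff T T' \<in> M2" if T: "T \<in> M2" "T' \<in> M2" for T T'
    proof -
      have *: "sym_diff (sym_diff S U) (sym_diff S U') = sym_diff U U'"
        "sym_diff (sym_diff S U) U' = sym_diff S (sym_diff U U')"
        "sym_diff U (sym_diff S U') = sym_diff S (sym_diff U U')" for U U'
        by blast+
      obtain U U' where U: "U \<in> M" "T = U \<or> T = sym_diff S U" "U' \<in> M" "T' = U' \<or> T' = sym_diff S U'"
        using T unfolding M2_def by blast
      have "sym_diff T T' = sym_diff U U' \<or> sym_diff T T' = sym_diff S (sym_diff U U')"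
        using U(2,4) *[of U U'] by (elim disjE) simp_all
      then show ?thesis
        using add[OF U(1,3)] unfolding M2_def by (elim disjE) simp_all
    qed
    moreover have "X \<notin> M2"
    proof
      assume "X \<in> M2"
      then obtain T where "T \<in> M" "X = sym_diff S T"
        using M'(3) unfolding M2_def by blast
      moreover have "sym_diff S (sym_diff S T) = T"
        by blast
      ultimately show False
        using n by simp
    qed
    moreover have "N \<subseteq> M2" "M2 \<subseteq> Pow E" "M \<subseteq> M2"
      using M' S(1) unfolding M2_def by auto
    ultimately have "M = M2"
      using max unfolding \<M>_def by blast
    moreover have "sym_diff S {} \<in> M2"
      using e unfolding M2_def by blast
    ultimately show False
      using S(2) by simp
  qed
  define F where "F = {x \<in> E. {x} \<notin> M}"
  have parity: "S \<in> M \<longleftrightarrow> even (card (S \<inter> F))" if "S \<subseteq> E" for S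
    using finite_subset[OF that fin] that
  proof (induction S rule: finite_induct)
    case empty
    then show ?case using e by simp
  next
    case (insert x S)
    have i: "insert x S = sym_diff {x} S" "S = sym_diff {x} (insert x S)" "{x} = sym_diff (insert x S) S"
      using insert.hyps(2) by auto
    show ?case
    proof (cases "x \<in> F")
      case False
      then have "{x} \<in> M"
        using insert.prems unfolding F_def by simp
      then have "insert x S \<in> M \<longleftrightarrow> S \<in> M"
        using add i(1,2) by metis
      then show ?thesis
        using False insert by simp
    next
      case True
      then have x: "{x} \<notin> M" "x \<in> E"
        unfolding F_def by auto
      have "insert x S \<in> M \<longleftrightarrow> S \<notin> M"
      proof
        assume "insert x S \<in> M"
        then show "S \<notin> M"
          using add i(3) x(1) by metis
      next
        assume "S \<notin> M"
        then have "sym_diff {x} X \<in> M" "sym_diff S X \<in> M"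
          using index2 x insert.prems by auto
        moreover have "sym_diff (sym_diff {x} X) (sym_diff S X) = insert x S"
          using insert.hyps(2) by blast
        ultimately show "insert x S \<in> M"
          using add by metis
      qed
      then show ?thesis
        using True insert by simp
    qed
  qed
  have "F \<in> annihilator N"
    unfolding annihilator_def using parity M' by blast
  moreover have "odd (card (X \<inter> F))"
    using parity X(1) M'(3) by blast
  ultimately show ?thesis by blast
qed

text \<open>The gains are the classes of the edges modulo the span \<open>N\<close> of the balanced cycles. A class is
  represented by its pairing with the annihilator of \<open>N\<close>, so that gains form a group type.\<close>

definition quotient_gain :: "'a set set \<Rightarrow> 'a \<Rightarrow> 'a set \<Rightarrow> bit" where
  "quotient_gain N x = (\<lambda>F. if F \<in> annihilator N \<and> x \<in> F then 1 else 0)"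

lemma sum_quotient_gain:
  assumes "finite X"
  shows "(\<Sum>x\<in>X. quotient_gain N x) F = (if F \<in> annihilator N \<and> odd (card (X \<inter> F)) then 1 else 0)"
  using assms
proof (induction X rule: finite_induct)
  case (insert x X)
  then show ?case
    by (auto simp: quotient_gain_def)
qed simp

lemma quotient_gain_kernel:
  assumes "finite E" "N \<subseteq> Pow E" "{} \<in> N" "\<And>S T. S \<in> N \<Longrightarrow> T \<in> N \<Longrightarrow> sym_diff S T \<in> N" "X \<subseteq> E"
  shows "(\<Sum>x\<in>X. quotient_gain N x) = 0 \<longleftrightarrow> X \<in> N"
proof -
  have "finite X"
    using finite_subset[OF assms(5,1)] .
  then have s: "(\<Sum>x\<in>X. quotient_gain N x) F = 0 \<longleftrightarrow> \<not> (F \<in> annihilator N \<and> odd (card (X \<inter> F)))" for F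
    using sum_quotient_gain[of X N F] by simp
  show ?thesis
  proof
    assume 0: "(\<Sum>x\<in>X. quotient_gain N x) = 0"
    show "X \<in> N"
    proof (rule ccontr)
      assume "X \<notin> N"
      then obtain F where "F \<in> annihilator N" "odd (card (X \<inter> F))"
        using annihilator_separates assms by metis
      then show False
        using s[of F] 0 by simp
    qed
  next
    assume "X \<in> N"
    then have "(\<Sum>x\<in>X. quotient_gain N x) F = 0" for F
      using s[of F] unfolding annihilator_def by blast
    then show "(\<Sum>x\<in>X. quotient_gain N x) = 0"
      by (simp add: fun_eq_iff)
  qed
qed

section \<open>Pull-backs as a linear map\<close>

lemma pull_back_single: "pull_back e {a} = pull_back_edge e a"
proof -
  have "{a' \<in> {a}. x \<in> pull_back_edge e a'} = (if x \<in> pull_back_edge e a then {a} else {})" for x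
    by auto
  then show ?thesis
    unfolding pull_back_def by simp
qed

lemma pull_back_sym_diff:
  assumes "finite X" "finite Y"
  shows "pull_back e (sym_diff X Y) = sym_diff (pull_back e X) (pull_back e Y)"
proof -
  have "odd (card {a \<in> sym_diff X Y. x \<in> pull_back_edge e a}) \<longleftrightarrow>
      odd (card {a \<in> X. x \<in> pull_back_edge e a}) \<noteq> odd (card {a \<in> Y. x \<in> pull_back_edge e a})" for x
  proof -
    have "{a \<in> sym_diff X Y. x \<in> pull_back_edge e a} =
        sym_diff {a \<in> X. x \<in> pull_back_edge e a} {a \<in> Y. x \<in> pull_back_edge e a}"
      by blast
    then show ?thesis
      using odd_card_sym_diff[of "{a \<in> X. x \<in> pull_back_edge e a}" "{a \<in> Y. x \<in> pull_back_edge e a}"] assms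
      by simp
  qed
  then show ?thesis
    unfolding pull_back_def by blast
qed

lemma pull_back_empty: "pull_back e {} = {}"
  unfolding pull_back_def by simp

lemma pull_back_insert:
  assumes "finite X" "a \<notin> X"
  shows "pull_back e (insert a X) = sym_diff (pull_back_edge e a) (pull_back e X)"
proof -
  have "insert a X = sym_diff {a} X"
    using assms(2) by blast
  then show ?thesis
    using pull_back_sym_diff[of "{a}" X e] assms(1) pull_back_single[of e a] by simp
qed

lemma pull_back_Old: "pull_back e (Old ` Y) = Y"
proof -
  have "{a \<in> Old ` Y. x \<in> pull_back_edge e a} = (if x \<in> Y then {Old x} else {})" for x
    by auto
  then show ?thesis
    unfolding pull_back_def by simp
qed

text \<open>Makes the lemmas on cycles and paths available for graphs before their actual gains are
  known; with zero gains exactly the cycles without loops are balanced.\<close>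

lemma graph_biased_gain_graph:
  "graph G \<Longrightarrow> biased_gain_graph G (\<lambda>_. 0 :: bit) {X. cycle G X \<and> (\<forall>x\<in>X. \<not> loop G x)}"
  by unfold_locales auto

section \<open>The v-deleted biased graph as a gain graph\<close>

locale vertex_deletion =
  fixes G :: "('v, 'e) mgraph" and \<C> :: "'e set set" and v :: 'v and m :: nat and e :: "nat \<Rightarrow> 'e"
  assumes linear: "linear_biased_graph G \<C>"
    and v: "v \<in> verts G"
    and e: "bij_betw e {1..m} (edges_at G v)"
begin

abbreviation hat where "hat \<equiv> hat_graph G v m e"
abbreviation del where "del \<equiv> deleted_graph G \<C> v m e"
abbreviation gens where "gens \<equiv> hat_generators G \<C> v m e"
abbreviation bal where "bal \<equiv> symm_span {X \<in> gens. \<not> (\<exists>a. X = {a})}"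

definition att :: "nat \<Rightarrow> 'v set" where
  "att i = ends G (e i) - {v}"

lemma graph_G: "graph G"
  and cycles_C: "X \<in> \<C> \<Longrightarrow> cycle G X"
  and linear_C: "cycle G X \<Longrightarrow> X \<in> symm_span \<C> \<Longrightarrow> X \<in> \<C>"
  using linear unfolding linear_biased_graph_def biased_graph_def spanned_cycles_def symm_span_def
  by blast+

lemma hat_simps [simp]:
  "ends hat = hat_ends G v e" "ends del = hat_ends G v e"
  "edges hat = Old ` (edges G - edges_at G v) \<union> new_edges G m e"
  "verts hat = verts G - {v}" "verts del = verts G - {v}"
  unfolding hat_graph_def deleted_graph_def by simp_all

lemma edges_del: "edges del = edges hat - {a. {a} \<in> gens}"
  unfolding deleted_graph_def by simp

lemma hat_ends_Hat: "hat_ends G v e (Hat {i, j}) = att i \<union> att j"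
  unfolding att_def by auto

lemma e_edge: "i \<in> {1..m} \<Longrightarrow> e i \<in> edges G \<and> v \<in> ends G (e i)"
  using e unfolding bij_betw_def edges_at_def by blast

lemma e_inj: "i \<in> {1..m} \<Longrightarrow> j \<in> {1..m} \<Longrightarrow> e i = e j \<Longrightarrow> i = j"
  using e unfolding bij_betw_def inj_on_def by blast

lemma att_cases:
  assumes i: "i \<in> {1..m}"
  obtains (loop) "att i = {}" "ends G (e i) = {v}" "loop G (e i)"
    | (link) a where "att i = {a}" "ends G (e i) = {v, a}" "a \<noteq> v" "a \<in> verts G" "\<not> loop G (e i)"
proof -
  have c: "card (ends G (e i)) = 1 \<or> card (ends G (e i)) = 2" "ends G (e i) \<subseteq> verts G"
    using graph_G e_edge[OF i] unfolding graph_def by auto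
  show ?thesis
  proof (cases "card (ends G (e i)) = 1")
    case True
    then have "ends G (e i) = {v}"
      using e_edge[OF i] by (auto simp: card_1_singleton_iff)
    then show ?thesis
      using loop unfolding att_def loop_def by simp
  next
    case False
    then obtain x y where "ends G (e i) = {x, y}" "x \<noteq> y"
      using c by (auto simp: card_2_iff)
    then obtain a where "ends G (e i) = {v, a}" "a \<noteq> v"
      using e_edge[OF i] by auto
    then show ?thesis
      using link[of a] c(2) unfolding att_def loop_def by auto
  qed
qed

lemma att_small: "i \<in> {1..m} \<Longrightarrow> att i = {} \<or> (\<exists>a\<in>verts G - {v}. att i = {a})"
  by (erule att_cases) auto

lemma att_empty_iff: "i \<in> {1..m} \<Longrightarrow> att i = {} \<longleftrightarrow> loop G (e i)"
  by (erule att_cases) auto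

lemma Hat_new_iff:
  assumes "i \<in> {1..m}" "j \<in> {1..m}" "i \<noteq> j"
  shows "Hat {i, j} \<in> new_edges G m e \<longleftrightarrow> \<not> (att i = {} \<and> att j = {})"
proof
  assume "Hat {i, j} \<in> new_edges G m e"
  then obtain k l where "{i, j} = {k, l}" "k \<in> {1..m}" "l \<in> {1..m}" "\<not> (loop G (e k) \<and> loop G (e l))"
    unfolding new_edges_def by auto
  then show "\<not> (att i = {} \<and> att j = {})"
    using att_empty_iff by (auto simp: doubleton_eq_iff)
next
  assume "\<not> (att i = {} \<and> att j = {})"
  then show "Hat {i, j} \<in> new_edges G m e"
    using assms att_empty_iff unfolding new_edges_def by blast
qed

lemma finite_hat: "finite (edges hat)"
proof -
  have "new_edges G m e \<subseteq> (\<lambda>(i, j). Hat {i, j}) ` ({1..m} \<times> {1..m})"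
    unfolding new_edges_def by auto
  then have "finite (new_edges G m e)"
    by (rule finite_subset) simp
  then show ?thesis
    using graph_G unfolding graph_def by simp
qed

lemma graph_hat: "graph hat"
  unfolding graph_def
proof (intro conjI ballI)
  show "finite (verts hat)" "finite (edges hat)"
    using graph_G finite_hat unfolding graph_def by auto
  fix x assume x: "x \<in> edges hat"
  have "ends hat x \<subseteq> verts hat \<and> (card (ends hat x) = 1 \<or> card (ends hat x) = 2)"
  proof (cases x)
    case (Old y)
    have "Old y \<notin> new_edges G m e"
      unfolding new_edges_def by auto
    then have "y \<in> edges G" "v \<notin> ends G y"
      using x Old by (auto simp: edges_at_def)
    then show ?thesis
      using graph_G Old unfolding graph_def by auto
  next
    case (Hat P)
    then have new: "x \<in> new_edges G m e"
      using x by auto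
    then obtain i j where ij: "x = Hat {i, j}" "i \<in> {1..m}" "j \<in> {1..m}" "i \<noteq> j"
      unfolding new_edges_def by auto
    then have "Hat {i, j} \<in> new_edges G m e"
      using new by simp
    with ij have ne: "\<not> (att i = {} \<and> att j = {})"
      using Hat_new_iff by blast
    have "ends hat x = att i \<union> att j"
      unfolding ij(1) using hat_ends_Hat by simp
    then show ?thesis
      using ne att_small[OF ij(2)] att_small[OF ij(3)] by (auto simp: card_insert_if split: if_splits)
  qed
  then show "ends hat x \<subseteq> verts hat" "card (ends hat x) = 1 \<or> card (ends hat x) = 2"
    by auto
qed

lemma graph_del: "graph del"
  using graph_hat unfolding graph_def edges_del by simp

lemma cycle_del: "cycle del X \<Longrightarrow> cycle hat X"
  unfolding cycle_def components_in_def adjacent_in_def vertices_of_def degree_in_def edges_del by auto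

interpretation G: biased_gain_graph G "\<lambda>_. 0 :: bit" "{X. cycle G X \<and> (\<forall>x\<in>X. \<not> loop G x)}"
  using graph_biased_gain_graph graph_G .

interpretation hat: biased_gain_graph hat "\<lambda>_. 0 :: bit" "{X. cycle hat X \<and> (\<forall>x\<in>X. \<not> loop hat x)}"
  using graph_biased_gain_graph graph_hat .

lemma gens_cycle: "X \<in> gens \<Longrightarrow> cycle hat X"
  unfolding hat_generators_def by blast

lemma bal_subset: "bal \<subseteq> Pow (edges hat)"
proof
  fix X assume "X \<in> bal"
  then have "X \<subseteq> \<Union>gens"
    using symm_span_Union by blast
  then show "X \<in> Pow (edges hat)"
    using gens_cycle hat.cycle_subset_edges by blast
qed

abbreviation \<gamma> where "\<gamma> \<equiv> quotient_gain bal"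

lemma gain_kernel: "X \<subseteq> edges hat \<Longrightarrow> sum \<gamma> X = 0 \<longleftrightarrow> X \<in> bal"
  using quotient_gain_kernel[OF finite_hat bal_subset symm_span_empty symm_span_sym_diff] .

text \<open>A cycle through a loop consists of that loop alone, and one-element generators are left
  out of \<open>bal\<close>.\<close>

lemma bal_no_loop:
  assumes "X \<in> bal" "x \<in> X"
  shows "\<not> loop hat x"
proof
  assume "loop hat x"
  then obtain u where u: "ends hat x = {u}"
    using hat.loop_iff by blast
  obtain Y where Y: "Y \<in> gens" "\<nexists>a. Y = {a}" "x \<in> Y"
    using symm_span_Union assms by blast
  then have "Y = {x}"
    using hat.cycle_loop[OF gens_cycle Y(3) u] by blast
  then show False
    using Y(2) by blast
qed

lemma hat_cycles_iff: "X \<in> hat_cycles G \<C> v m e \<longleftrightarrow> cycle hat X \<and> X \<in> bal"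
  unfolding hat_cycles_def spanned_cycles_def symm_span_def by blast

text \<open>The gains vanish exactly on \<open>bal\<close>, and a cycle belongs to
  \<open>hat_cycles\<close> by lying in \<open>bal\<close>; the condition on loops comes from
  \<open>bal_no_loop\<close>.\<close>

sublocale frame: biased_gain_graph del \<gamma> "hat_cycles G \<C> v m e"
proof
  show "a + a = 0" for a :: "'e hat_edge set \<Rightarrow> bit"
    by (simp add: fun_eq_iff)
  show "graph del"
    by (rule graph_del)
  fix X assume X: "cycle del X"
  then have "X \<subseteq> edges hat"
    using cycle_del hat.cycle_subset_edges by blast
  then show "X \<in> hat_cycles G \<C> v m e \<longleftrightarrow> (\<forall>x\<in>X. \<not> loop del x) \<and> sum \<gamma> X = 0"
    using X cycle_del gain_kernel hat_cycles_iff bal_no_loop unfolding loop_def by auto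
qed

lemma gain_eq_iff:
  "(a :: 'e hat_edge set \<Rightarrow> bit) + b = 0 \<longleftrightarrow> a = b"
  by (rule frame.add_eq_0)

lemma hat_bases_eq: "hat_bases G \<C> v m e = frame.bases (edges del)"
  unfolding hat_bases_def by (rule frame.frame_bases_eq)

lemma two_cycle_G:
  assumes i: "i \<in> {1..m}" "j \<in> {1..m}" "i \<noteq> j" and a: "att i = {a}" "att j = {a}"
  shows "cycle G {e i, e j}"
proof -
  have ends: "ends G (e i) = {v, a}" "ends G (e j) = {v, a}" "v \<noteq> a"
    using att_cases[OF i(1)] att_cases[OF i(2)] a by (metis insert_not_empty singleton_inject)+
  have "G.simple_path {e i} v a {e i} {a, v}"
    using G.simple_path.extend[OF G.simple_path.start, of "e i" "{e i}" v a] ends by simp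
  moreover have "e j \<noteq> e i"
    using e_inj[OF i(1,2)] i(3) by auto
  ultimately show ?thesis
    using G.cycle_insert_path[of "{e i}" v a "{e i}" "{a, v}" "e j"] e_edge[OF i(1)] e_edge[OF i(2)] ends
    by (simp add: insert_commute)
qed

text \<open>A loop that is not a stem loop comes from two links to the same vertex. One link alone
  is no cycle, so the petal through \<open>e i\<close> is the whole pair. Conversely a balanced pair
  is its own petal.\<close>

lemma single_generator_iff:
  assumes i: "i \<in> {1..m}" "j \<in> {1..m}" "i \<noteq> j"
  shows "{Hat {i, j}} \<in> gens \<longleftrightarrow> (\<exists>a. att i = {a} \<and> att j = {a}) \<and> {e i, e j} \<in> \<C>"
proof
  assume gen: "{Hat {i, j}} \<in> gens"
  then have cyc: "cycle hat {Hat {i, j}}"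
    by (rule gens_cycle)
  obtain u w where uw: "ends hat (Hat {i, j}) = {u, w}"
    using hat.cycle_edge_ends[OF cyc] by blast
  have "hat.reach {} u w"
    using hat.cycle_Diff_reach[OF cyc _ uw] by simp
  then have "u = w"
    using hat.closed_reach[of "{}" "{u}" u w] unfolding hat.closed_def by simp
  then have att_Un: "att i \<union> att j = {u}"
    using uw hat_ends_Hat by simp
  have "Hat {i, j} \<notin> stem_loops G m e"
    using gen unfolding hat_generators_def by blast
  then have "att i = {} \<longleftrightarrow> att j = {}"
    using i att_empty_iff unfolding stem_loops_def by (auto simp: insert_commute)
  then have a: "att i = {u}" "att j = {u}"
    using att_Un by auto
  have "{Hat {i, j}} \<noteq> Old ` Y" for Y
    by auto
  moreover have pb: "pull_back e {Hat {i, j}} = {e i, e j}"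
    using pull_back_single[of e "Hat {i, j}"] by simp
  ultimately obtain \<P> where P: "petals G v {e i, e j} \<P>" "\<P> \<subseteq> \<C>"
    using gen unfolding hat_generators_def by auto
  then have U: "\<Union>\<P> = {e i, e j}" and cycles: "\<forall>X\<in>\<P>. cycle G X"
    unfolding petals_def by simp_all
  have "e i \<in> \<Union>\<P>"
    unfolding U by simp
  then obtain X where X: "X \<in> \<P>" "e i \<in> X"
    by blast
  then have cX: "cycle G X" and X_sub: "X \<subseteq> {e i, e j}"
    using cycles U by auto
  have ends: "ends G (e i) = {v, u}" "v \<noteq> u"
    using att_cases[OF i(1)] a by (metis insert_not_empty singleton_inject)+
  have "X \<noteq> {e i}"
  proof
    assume "X = {e i}"
    then have "G.reach {} v u"
      using G.cycle_Diff_reach[OF cX X(2) ends(1)] by simp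
    then show False
      using G.closed_reach[of "{}" "{v}" v u] ends(2) unfolding G.closed_def by simp
  qed
  then have "X = {e i, e j}"
    using X(2) X_sub by blast
  then show "(\<exists>a. att i = {a} \<and> att j = {a}) \<and> {e i, e j} \<in> \<C>"
    using a X(1) P(2) by blast
next
  assume "(\<exists>a. att i = {a} \<and> att j = {a}) \<and> {e i, e j} \<in> \<C>"
  then obtain a where a: "att i = {a}" "att j = {a}" and C: "{e i, e j} \<in> \<C>" by blast
  have new: "Hat {i, j} \<in> new_edges G m e"
    using Hat_new_iff[OF i] a by simp
  have "cycle hat {Hat {i, j}}"
    using hat.cycle_insert_path[OF hat.simple_path.start, of "{}" "Hat {i, j}" a] new a hat_ends_Hat[of i j]
    by simp
  moreover have "Hat {i, j} \<notin> stem_loops G m e"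
    using a i att_empty_iff unfolding stem_loops_def by (auto simp: doubleton_eq_iff)
  moreover have "pull_back e {Hat {i, j}} = {e i, e j}"
    using pull_back_single[of e "Hat {i, j}"] by simp
  moreover have "petals G v {e i, e j} {{e i, e j}}"
    unfolding petals_def using cycles_C C by simp
  ultimately show "{Hat {i, j}} \<in> gens"
    unfolding hat_generators_def using new C by fastforce
qed

lemma edges_del_iff:
  assumes "i \<in> {1..m}" "j \<in> {1..m}" "i \<noteq> j"
  shows "Hat {i, j} \<in> edges del \<longleftrightarrow> \<not> (att i = {} \<and> att j = {}) \<and>
    \<not> ((\<exists>a. att i = {a} \<and> att j = {a}) \<and> {e i, e j} \<in> \<C>)"
  using Hat_new_iff[OF assms] single_generator_iff[OF assms] unfolding edges_del by auto

lemma petals_symm_span: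
  assumes "petals G v X \<P>" "\<P> \<subseteq> \<C>"
  shows "X \<in> symm_span \<C>"
proof -
  have "\<P> \<subseteq> Pow (edges G)"
    using assms(2) cycles_C G.cycle_subset_edges by blast
  then have "finite \<P>"
    using G.finite_edges by (simp add: finite_subset)
  moreover have "symm_diff_of \<P> = X"
    using symm_diff_of_disjoint[of \<P>] assms(1) unfolding petals_def by metis
  ultimately show ?thesis
    unfolding symm_span_def using assms(2) by blast
qed

text \<open>Pulling back is linear, and the pull-back of a generator is a balanced cycle, empty, or
  a disjoint union of balanced petals.\<close>

lemma pull_back_bal:
  assumes "X \<in> bal"
  shows "pull_back e X \<in> symm_span \<C>"
  using assms
proof (induction rule: symm_span_induct)
  case empty
  then show ?case
    using pull_back_empty symm_span_empty by metis
next
  case (sym_diff X Y)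
  then have X: "X \<in> gens" and Y: "Y \<subseteq> edges hat"
    using bal_subset by blast+
  have fin: "finite X" "finite Y"
    using hat.cycle_finite[OF gens_cycle[OF X]] finite_subset[OF Y finite_hat] .
  have "pull_back e X \<in> symm_span \<C>"
  proof -
    consider (old) Z where "Z \<in> \<C>" "X = Old ` Z" | (none) "pull_back e X = {}"
      | (petals) \<P> where "petals G v (pull_back e X) \<P>" "\<P> \<subseteq> \<C>"
      using X unfolding hat_generators_def by blast
    then show ?thesis
    proof cases
      case old
      then show ?thesis
        using pull_back_Old symm_span_superset by metis
    next
      case none
      then show ?thesis
        using symm_span_empty by metis
    next
      case petals
      then show ?thesis
        by (rule petals_symm_span)
    qed
  qed
  then show ?case
    using symm_span_sym_diff sym_diff.IH pull_back_sym_diff[OF fin] by metis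
qed

text \<open>The two edges form a cycle with pull-back \<open>{e i, e j}\<close>. Linearity of
  \<open>\<C>\<close> carries balance from this cycle to the pull-back; conversely the balanced
  pull-back is a single petal.\<close>

lemma gain_eq_iff_balanced:
  assumes i: "i \<in> {1..m}" "j \<in> {1..m}" "k \<in> {1..m}" "distinct [i, j, k]"
    and a: "att i = {a}" "att j = {a}" "att k = {b}" "a \<noteq> b"
  shows "\<gamma> (Hat {i, k}) = \<gamma> (Hat {k, j}) \<longleftrightarrow> {e i, e j} \<in> \<C>"
proof -
  define X :: "'e hat_edge set" where "X = {Hat {k, j}, Hat {i, k}}"
  have new: "Hat {i, k} \<in> new_edges G m e" "Hat {k, j} \<in> new_edges G m e"
    using Hat_new_iff[of i k] Hat_new_iff[of k j] i a by auto
  have ne: "Hat {i, k} \<noteq> Hat {k, j}"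
    using i(4) by (auto simp: doubleton_eq_iff)
  have ends: "ends hat (Hat {i, k}) = {a, b}" "ends hat (Hat {k, j}) = {a, b}"
    using hat_ends_Hat[of i k] hat_ends_Hat[of k j] a by auto
  have "hat.simple_path {Hat {i, k}} a b {Hat {i, k}} {b, a}"
    using hat.simple_path.extend[OF hat.simple_path.start, of "Hat {i, k}" "{Hat {i, k}}" a b] ends a(4)
    by simp
  then have cyc: "cycle hat X"
    using hat.cycle_insert_path[of "{Hat {i, k}}" a b "{Hat {i, k}}" "{b, a}" "Hat {k, j}"] new ends ne
    unfolding X_def by auto
  have X_sub: "X \<subseteq> edges hat" and two: "\<nexists>x. X = {x}"
    using new ne unfolding X_def by auto
  have "e i \<noteq> e k" "e k \<noteq> e j" "e i \<noteq> e j"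
    using e_inj i by auto
  then have pb: "pull_back e X = {e i, e j}"
    using pull_back_insert[of "{Hat {i, k}}" "Hat {k, j}" e] pull_back_single[of e "Hat {i, k}"] ne
    unfolding X_def by auto
  have "sum \<gamma> X = \<gamma> (Hat {k, j}) + \<gamma> (Hat {i, k})"
    using ne unfolding X_def by simp
  then have "\<gamma> (Hat {i, k}) = \<gamma> (Hat {k, j}) \<longleftrightarrow> X \<in> bal"
    using gain_eq_iff[of "\<gamma> (Hat {k, j})" "\<gamma> (Hat {i, k})"] gain_kernel[OF X_sub] by auto
  also have "\<dots> \<longleftrightarrow> {e i, e j} \<in> \<C>"
  proof
    assume "X \<in> bal"
    then have "{e i, e j} \<in> symm_span \<C>"
      using pull_back_bal[of X] unfolding pb by simp
    then show "{e i, e j} \<in> \<C>"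
      using linear_C two_cycle_G[of i j a] i a by simp
  next
    assume C: "{e i, e j} \<in> \<C>"
    then have "petals G v {e i, e j} {{e i, e j}}"
      unfolding petals_def using cycles_C by simp
    then have "X \<in> gens"
      unfolding hat_generators_def using cyc two pb new C unfolding X_def by fastforce
    then show "X \<in> bal"
      using two by (intro symm_span_superset) blast
  qed
  finally show ?thesis .
qed

text \<open>Each of the three edges at \<open>v\<close> occurs twice in the pull-back of the
  triangle, which is therefore empty and makes the triangle a generator.\<close>

lemma gain_triangle:
  assumes i: "i \<in> {1..m}" "j \<in> {1..m}" "k \<in> {1..m}" "distinct [i, j, k]"
    and a: "att i = {a}" "att j = {b}" "att k = {c}" "distinct [a, b, c]"
  shows "\<gamma> (Hat {i, k}) + \<gamma> (Hat {k, j}) = \<gamma> (Hat {i, j})"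
proof -
  define X :: "'e hat_edge set" where "X = {Hat {i, j}, Hat {k, j}, Hat {i, k}}"
  have new: "Hat {i, k} \<in> new_edges G m e" "Hat {k, j} \<in> new_edges G m e" "Hat {i, j} \<in> new_edges G m e"
    using Hat_new_iff[of i k] Hat_new_iff[of k j] Hat_new_iff[of i j] i a by auto
  have ne: "Hat {i, k} \<noteq> Hat {k, j}" "Hat {i, j} \<noteq> Hat {k, j}" "Hat {i, j} \<noteq> Hat {i, k}"
    using i(4) by (auto simp: doubleton_eq_iff)
  have ends: "ends hat (Hat {i, k}) = {a, c}" "ends hat (Hat {k, j}) = {c, b}" "ends hat (Hat {i, j}) = {a, b}"
    using hat_ends_Hat[of i k] hat_ends_Hat[of k j] hat_ends_Hat[of i j] a by auto
  let ?P = "{Hat {k, j}, Hat {i, k}}"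
  have "hat.simple_path ?P a c {Hat {i, k}} {c, a}"
    using hat.simple_path.extend[OF hat.simple_path.start, of "Hat {i, k}" ?P a c] ends a(4)
    by auto
  then have "hat.simple_path ?P a b ?P {b, c, a}"
    using hat.simple_path.extend[of ?P a c "{Hat {i, k}}" "{c, a}" "Hat {k, j}" b] ends a(4) by auto
  then have cyc: "cycle hat X"
    using hat.cycle_insert_path[of ?P a b ?P "{b, c, a}" "Hat {i, j}"] new ends ne
    unfolding X_def by auto
  have X_sub: "X \<subseteq> edges hat" and two: "\<nexists>x. X = {x}"
    using new ne unfolding X_def by auto
  have "e i \<noteq> e k" "e k \<noteq> e j" "e i \<noteq> e j"
    using e_inj i by auto
  then have pb: "pull_back e X = {}"
    using pull_back_insert[of "{Hat {i, k}}" "Hat {k, j}" e] pull_back_single[of e "Hat {i, k}"] ne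
      pull_back_insert[of "{Hat {k, j}, Hat {i, k}}" "Hat {i, j}" e]
    unfolding X_def by auto
  have "X \<in> gens"
    unfolding hat_generators_def using cyc two pb by blast
  then have "X \<in> bal"
    using two by (intro symm_span_superset) blast
  then have "sum \<gamma> X = 0"
    using gain_kernel[OF X_sub] by blast
  then have "\<gamma> (Hat {i, j}) + (\<gamma> (Hat {k, j}) + \<gamma> (Hat {i, k})) = 0"
    using ne unfolding X_def by simp
  then show ?thesis
    using gain_eq_iff[of "\<gamma> (Hat {i, j})" "\<gamma> (Hat {k, j}) + \<gamma> (Hat {i, k})"] by (simp add: add.commute)
qed

text \<open>The claim is that the vertex of the stem loop \<open>Hat {i, j}\<close> is dead. This
  follows from another stem loop, either at the same vertex or at the end of
  \<open>Hat {k, j}\<close>.\<close>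

lemma Hat_triangle_stem:
  assumes i: "i \<in> {1..m}" "j \<in> {1..m}" "k \<in> {1..m}" "distinct [i, j, k]" and a: "att i = {}"
    and ij: "Hat {i, j} \<in> edges del"
    and sat: "Hat {i, k} \<in> edges del \<Longrightarrow> frame.sat \<theta> (Hat {i, k})"
      "Hat {k, j} \<in> edges del \<Longrightarrow> frame.sat \<theta> (Hat {k, j})"
  shows "frame.sat \<theta> (Hat {i, j})"
proof -
  have "att j \<noteq> {}"
    using ij a edges_del_iff[of i j] i by auto
  then obtain b where b: "att j = {b}"
    using att_cases[OF i(2)] by metis
  have "\<theta> b = None"
  using i(3)
  proof (cases rule: att_cases)
    case loop
    then have "Hat {k, j} \<in> edges del"
      using edges_del_iff[of k j] i b by auto
    moreover have "ends del (Hat {k, j}) = {b}"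
      using hat_ends_Hat[of k j] loop b by simp
    ultimately show ?thesis
      using sat(2) by (simp add: satisfies_loop)
  next
    case (link c)
    then have "Hat {i, k} \<in> edges del"
      using edges_del_iff[of i k] i a by auto
    moreover have "ends del (Hat {i, k}) = {c}"
      using hat_ends_Hat[of i k] link a by simp
    ultimately have c: "\<theta> c = None"
      using sat(1) by (simp add: satisfies_loop)
    show ?thesis
    proof (cases "b = c")
      case False
      then have "Hat {k, j} \<in> edges del"
        using edges_del_iff[of k j] i b link by auto
      moreover have "ends del (Hat {k, j}) = {c, b}"
        using hat_ends_Hat[of k j] link b by auto
      ultimately show ?thesis
        using sat(2) c satisfies_None_iff[of \<theta> c b] by simp
    qed (use c in simp)
  qed
  moreover have "ends del (Hat {i, j}) = {b}"
    using hat_ends_Hat[of i j] a b by simp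
  ultimately show ?thesis
    by (simp add: satisfies_loop)
qed

text \<open>The cases depend on which attachments coincide. For links, a missing edge marks a
  balanced parallel pair, whose two indices have equal gains towards any other vertex; an unbalanced
  pair gives a loop and thus a dead vertex.\<close>

lemma Hat_triangle:
  assumes i: "i \<in> {1..m}" "j \<in> {1..m}" "k \<in> {1..m}" "distinct [i, j, k]"
    and ij: "Hat {i, j} \<in> edges del"
    and sat: "Hat {i, k} \<in> edges del \<Longrightarrow> frame.sat \<theta> (Hat {i, k})"
      "Hat {k, j} \<in> edges del \<Longrightarrow> frame.sat \<theta> (Hat {k, j})"
  shows "frame.sat \<theta> (Hat {i, j})"
proof (cases "att i = {} \<or> att j = {}")
  case True
  then show ?thesis
  proof
    assume "att i = {}"
    then show ?thesis
      using Hat_triangle_stem[OF i _ ij sat] by blast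
  next
    assume "att j = {}"
    then have "frame.sat \<theta> (Hat {j, i})"
      using Hat_triangle_stem[of j i k \<theta>] i ij sat by (simp add: insert_commute)
    then show ?thesis
      by (simp add: insert_commute)
  qed
next
  case False
  then obtain a b where a: "att i = {a}" and b: "att j = {b}"
    using att_cases[OF i(1)] att_cases[OF i(2)] by metis
  have ends_ij: "ends del (Hat {i, j}) = {a, b}"
    using hat_ends_Hat[of i j] a b by auto
  show ?thesis
  using i(3)
  proof (cases rule: att_cases)
    case loop
    then have "Hat {i, k} \<in> edges del" "Hat {k, j} \<in> edges del"
      using edges_del_iff[of i k] edges_del_iff[of k j] i a b by auto
    moreover have "ends del (Hat {i, k}) = {a}" "ends del (Hat {k, j}) = {b}"
      using hat_ends_Hat[of i k] hat_ends_Hat[of k j] loop a b by auto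
    ultimately have "\<theta> a = None" "\<theta> b = None"
      using sat by (simp_all add: satisfies_loop)
    then show ?thesis
      unfolding ends_ij by (rule satisfies_None)
  next
    case (link c)
    have ends: "ends del (Hat {i, k}) = {a, c}" "ends del (Hat {k, j}) = {c, b}"
      using hat_ends_Hat[of i k] hat_ends_Hat[of k j] link(1) a b by auto
    have in_del: "Hat {i, k} \<in> edges del \<longleftrightarrow> a \<noteq> c \<or> {e i, e k} \<notin> \<C>"
      "Hat {k, j} \<in> edges del \<longleftrightarrow> c \<noteq> b \<or> {e k, e j} \<notin> \<C>"
      using edges_del_iff[of i k] edges_del_iff[of k j] i a b link(1) by auto
    have not_C: "a \<noteq> b \<or> {e i, e j} \<notin> \<C>"
      using edges_del_iff[of i j] i a b ij by auto
    have sat_ik: "satisfies \<theta> {a, c} (\<gamma> (Hat {i, k}))" if "a \<noteq> c \<or> {e i, e k} \<notin> \<C>"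
      using sat(1) in_del(1) that unfolding ends by blast
    have sat_kj: "satisfies \<theta> {c, b} (\<gamma> (Hat {k, j}))" if "c \<noteq> b \<or> {e k, e j} \<notin> \<C>"
      using sat(2) in_del(2) that unfolding ends by blast
    have "satisfies \<theta> {a, b} (\<gamma> (Hat {i, j}))"
    proof (cases "a = c")
      case ac: True
      show ?thesis
      proof (cases "{e i, e k} \<in> \<C>")
        case False
        then have "\<theta> a = None"
          using sat_ik ac by (simp add: satisfies_loop)
        moreover have "\<theta> b = None"
        proof (cases "c = b")
          case False
          then show ?thesis
            using sat_kj satisfies_None_iff[of \<theta> c b] ac \<open>\<theta> a = None\<close> by blast
        qed (use ac calculation in simp)
        ultimately show ?thesis
          by (rule satisfies_None)
      next
        case ik: True
        show ?thesis
        proof (cases "c = b")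
          case True
          \<comment> \<open>Otherwise linearity would make \<open>{e i, e j}\<close> balanced, and
            \<open>Hat {i, j}\<close> would have been removed with the balanced loops.\<close>
          have "{e k, e j} \<notin> \<C>"
          proof
            assume kj: "{e k, e j} \<in> \<C>"
            have ne: "e i \<noteq> e k" "e k \<noteq> e j" "e i \<noteq> e j"
              using e_inj i by auto
            have "sym_diff {e i, e k} {e k, e j} \<in> symm_span \<C>"
              using symm_span_sym_diff symm_span_superset ik kj by blast
            moreover have "sym_diff {e i, e k} {e k, e j} = {e i, e j}"
              using ne by auto
            ultimately have "{e i, e j} \<in> \<C>"
              using linear_C two_cycle_G[of i j a] i a b ac True by simp
            then show False
              using not_C ac True by simp
          qed
          then have "\<theta> b = None"
            using sat_kj True by (simp add: satisfies_loop)
          then show ?thesis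
            using ac True by (simp add: satisfies_loop)
        next
          case cb: False
          have "\<gamma> (Hat {i, j}) = \<gamma> (Hat {k, j})"
            using gain_eq_iff_balanced[of i k j a b] i a b link(1) ac cb ik by (auto simp: insert_commute)
          then show ?thesis
            using sat_kj cb ac by simp
        qed
      qed
    next
      case ac: False
      show ?thesis
      proof (cases "c = b")
        case cb: True
        show ?thesis
        proof (cases "{e k, e j} \<in> \<C>")
          case True
          then have "\<gamma> (Hat {i, j}) = \<gamma> (Hat {i, k})"
            using gain_eq_iff_balanced[of k j i b a] i a b link(1) ac cb by (auto simp: insert_commute)
          then show ?thesis
            using sat_ik cb ac by simp
        next
          case False
          then have "\<theta> b = None"
            using sat_kj cb by (simp add: satisfies_loop)
          moreover from this have "\<theta> a = None"
            using sat_ik ac cb satisfies_None_iff[of \<theta> a c] by blast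
          ultimately show ?thesis
            by (intro satisfies_None)
        qed
      next
        case cb: False
        note sik = sat_ik[OF disjI1[OF ac], unfolded satisfies_link[OF ac]]
        note skj = sat_kj[OF disjI1[OF cb], unfolded satisfies_link[OF cb]]
        show ?thesis
        proof (cases "\<theta> c")
          case None
          then have "\<theta> a = None" "\<theta> b = None"
            using sik skj by auto
          then show ?thesis
            by (rule satisfies_None)
        next
          case (Some z)
          then obtain x y where xy: "\<theta> a = Some x" "\<theta> b = Some y"
            "x + z = \<gamma> (Hat {i, k})" "z + y = \<gamma> (Hat {k, j})"
            using sik skj by auto
          have sum: "x + y = \<gamma> (Hat {i, k}) + \<gamma> (Hat {k, j})"
          proof -
            have "x + z + (z + y) = x + y"
              by (metis add.assoc frame.add_self_left)
            then show ?thesis using xy by simp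
          qed
          \<comment> \<open>If \<open>a\<close> and \<open>b\<close> coincided, the two gains would
            be equal, \<open>{e i, e j}\<close> balanced and \<open>Hat {i, j}\<close> missing from
            \<open>del\<close>.\<close>
          have ab: "a \<noteq> b"
          proof
            assume "a = b"
            then have "\<gamma> (Hat {i, k}) + \<gamma> (Hat {k, j}) = 0"
              using sum xy frame.char2 by simp
            then have "{e i, e j} \<in> \<C>"
              using gain_eq_iff gain_eq_iff_balanced[of i j k a c] i a b link(1) ac \<open>a = b\<close> by auto
            then show False
              using not_C \<open>a = b\<close> by simp
          qed
          have "x + y = \<gamma> (Hat {i, j})"
            using sum gain_triangle[of i j k a b c] i a b link(1) ac cb ab by auto
          then show ?thesis
            using ab xy by (simp add: satisfies_link)
        qed
      qed
    qed
    then show ?thesis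
      unfolding ends_ij .
  qed
qed

sublocale stubs: stub_frame "ends del" \<gamma> "edges del" "{1..m}" att "\<lambda>i j. Hat {i, j}"
proof
  show "finite (edges del)"
    by (rule frame.finite_edges)
  show "\<exists>u w. ends del x = {u, w}" if "x \<in> edges del" for x
    using frame.edge_ends[OF that] by blast
  show "Hat {i, j} = Hat {j, i}" for i j
    by (simp add: insert_commute)
  show "ends del (Hat {i, j}) = att i \<union> att j" for i j
    using hat_ends_Hat by simp
  show "att i = {} \<or> (\<exists>u. att i = {u})" if "i \<in> {1..m}" for i
    using att_cases[OF that] by metis
  show "frame.sat \<theta> (Hat {i, j})"
    if "distinct [i, j, k]" "{i, j, k} \<subseteq> {1..m}" "Hat {i, j} \<in> edges del"
      "Hat {i, k} \<in> edges del \<Longrightarrow> frame.sat \<theta> (Hat {i, k})"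
      "Hat {k, j} \<in> edges del \<Longrightarrow> frame.sat \<theta> (Hat {k, j})" for i j k \<theta>
    using Hat_triangle[of i j k \<theta>] that by simp
qed

end

section \<open>Switchability\<close>

text \<open>How \<open>c\<close> and \<open>d\<close> are distributed over the two bases is left
  open, so pairs with the same \<open>X\<close> and \<open>Y\<close> can be rerouted to each
  other.\<close>

definition spread :: "'a set set \<Rightarrow> 'a set \<Rightarrow> 'a set \<Rightarrow> 'a set \<Rightarrow> 'a \<Rightarrow> 'a \<Rightarrow> 'a set \<times> 'a set \<Rightarrow> bool" where
  "spread \<B> H X Y c d P \<longleftrightarrow>
     disjoint_bases \<B> P \<and> meets_in H P c d \<and> fst P - H = X \<and> snd P - H = Y"

lemma spread_reroute:
  "spread \<B> H X Y a b P \<Longrightarrow> spread \<B> H X Y c d Q \<Longrightarrow> reroute \<B> H c d P Q"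
  unfolding spread_def reroute_def by blast

text \<open>The step reroutes \<open>P\<close> to \<open>P'\<close>, exchanges, and compares the
  result \<open>Q'\<close> with \<open>Q\<close>. Non-incidence of \<open>c\<close> and
  \<open>d\<close> makes \<open>P'\<close> and \<open>Q'\<close> viable under any
  distribution.\<close>

lemma spread_curve_step:
  assumes "spread \<B> H X Y a b P" "spread \<B> H X Y c d P'" "spread \<B> H X' Y' c d Q'"
    "spread \<B> H X' Y' a' b' Q" "symmetric_exchange \<B> P' Q'" "non_incident c d"
  shows "curve_step \<B> H P Q"
proof -
  have "viable \<B> H P'" "viable \<B> H Q'"
    using assms(2,3,6) unfolding viable_def spread_def by blast+
  then show ?thesis
    unfolding curve_step_def
    using spread_reroute[OF assms(1,2)] spread_reroute[OF assms(4,3)] assms(5) by blast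
qed

lemma spread_switchable:
  assumes "(curve_step \<B> H)\<^sup>*\<^sup>* B P" "spread \<B> H X Y a b P" "spread \<B> H X Y c d Q"
    "c \<in> H - {e, f}" "d \<in> H - {e, f}" "non_incident c d"
  shows "switchable \<B> H e f B"
  unfolding switchable_def amenable_def using spread_reroute[OF assms(2,3)] assms(1,4-6) by blast

lemma spread_pair:
  assumes "c \<in> H" "d \<in> H" "c \<noteq> d" "X \<inter> H = {}" "Y \<inter> H = {}" "X \<inter> Y = {}"
    and "insert c X \<in> \<B>" "insert d Y \<in> \<B>"
  shows "spread \<B> H X Y c d (insert c X, insert d Y)"
  using assms unfolding spread_def disjoint_bases_def meets_in_def by auto

lemma spread_left:
  assumes "c \<in> H" "d \<in> H" "c \<noteq> d" "X \<inter> H = {}" "Y \<inter> H = {}" "X \<inter> Y = {}"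
    and "insert c (insert d X) \<in> \<B>" "Y \<in> \<B>"
  shows "spread \<B> H X Y c d (insert c (insert d X), Y)"
  using assms unfolding spread_def disjoint_bases_def meets_in_def by auto

lemma spread_right:
  assumes "c \<in> H" "d \<in> H" "c \<noteq> d" "X \<inter> H = {}" "Y \<inter> H = {}" "X \<inter> Y = {}"
    and "X \<in> \<B>" "insert c (insert d Y) \<in> \<B>"
  shows "spread \<B> H X Y c d (X, insert c (insert d Y))"
  using assms unfolding spread_def disjoint_bases_def meets_in_def by auto

lemma symmetric_exchangeI:
  assumes "x \<in> P1" "x \<notin> P2" "y \<in> P2" "y \<notin> P1" "Q1 = insert y (P1 - {x})" "Q2 = insert x (P2 - {y})"
    "Q1 \<in> \<B>" "Q2 \<in> \<B>"
  shows "symmetric_exchange \<B> (P1, P2) (Q1, Q2)"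
proof -
  have "x \<in> P1 - P2" "y \<in> P2 - P1" "Q1 = P1 - {x} \<union> {y}" "Q2 = P2 - {y} \<union> {x}"
    using assms(1-6) by simp_all
  then show ?thesis
    unfolding symmetric_exchange_def fst_conv snd_conv using assms(7,8) by blast
qed

text \<open>\<open>c\<close> and \<open>d\<close> stay in place while \<open>x\<close> and
  \<open>y\<close> change sides; rerouting before and after hides which edges of \<open>H\<close>
  the pairs \<open>P\<close> and \<open>Q\<close> contain.\<close>

lemma exchange_curve_step:
  assumes "spread \<B> H X Y a b P" "spread \<B> H (insert y (X - {x})) (insert x (Y - {y})) a' b' Q"
    and xy: "x \<in> X" "y \<in> Y" and XY: "X \<inter> H = {}" "Y \<inter> H = {}" "X \<inter> Y = {}"
    and cd: "c \<in> H" "d \<in> H" "c \<noteq> d" "non_incident c d"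
    and bases: "insert c X \<in> \<B>" "insert d Y \<in> \<B>"
      "insert c (insert y (X - {x})) \<in> \<B>" "insert d (insert x (Y - {y})) \<in> \<B>"
  shows "curve_step \<B> H P Q"
proof -
  have d: "insert y (X - {x}) \<inter> H = {}" "insert x (Y - {y}) \<inter> H = {}"
    "insert y (X - {x}) \<inter> insert x (Y - {y}) = {}"
    using xy XY by blast+
  have "symmetric_exchange \<B> (insert c X, insert d Y)
      (insert c (insert y (X - {x})), insert d (insert x (Y - {y})))"
    using xy XY cd(1,2) bases by (intro symmetric_exchangeI[of x _ _ y]) auto
  then show ?thesis
    using spread_curve_step[OF assms(1) spread_pair[OF cd(1-3) XY bases(1,2)]
      spread_pair[OF cd(1-3) d bases(3,4)] assms(2) _ cd(4)] by blast
qed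

section \<open>Non-switchability for four fixed indices\<close>

locale four_edges = vertex_deletion +
  fixes p q r s :: nat
  assumes distinct: "distinct [p, q, r, s]" and range: "{p, q, r, s} \<subseteq> {1..m}"
begin

abbreviation H where "H \<equiv> hat_subgraph_edges G m e {p, q, r, s}"
abbreviation \<B> where "\<B> \<equiv> frame.bases (edges del)"

text \<open>Interchanging \<open>r\<close> and \<open>s\<close> reduces the second form of
  opposition to the first.\<close>

lemma reordered: "four_edges G \<C> v m e p q s r"
  using distinct range by unfold_locales auto

lemma H_cases:
  assumes "a \<in> H"
  obtains i j where "i \<in> {p, q, r, s}" "j \<in> {p, q, r, s}" "i \<noteq> j" "a = Hat {i, j}"
proof -
  obtain i j k l where "a = Hat {i, j}" "i \<in> {p, q, r, s}" "j \<in> {p, q, r, s}" "a = Hat {k, l}" "k \<noteq> l"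
    using assms unfolding hat_subgraph_edges_def new_edges_def by blast
  moreover from this have "i \<noteq> j"
    by auto
  ultimately show ?thesis
    using that by blast
qed

lemma Hat_in_H:
  assumes "Hat {i, j} \<in> edges del" "i \<in> {p, q, r, s}" "j \<in> {p, q, r, s}"
  shows "Hat {i, j} \<in> H"
proof -
  have "Hat {i, j} \<in> new_edges G m e"
    using assms(1) unfolding edges_del by auto
  then show ?thesis
    using assms(2,3) unfolding hat_subgraph_edges_def by blast
qed

lemma bases_subset: "X \<in> \<B> \<Longrightarrow> X \<subseteq> edges del"
  unfolding frame.bases_def by blast

lemma bases_finite: "X \<in> \<B> \<Longrightarrow> finite X"
  using bases_subset frame.finite_edges finite_subset by blast

lemma bases_card: "X \<in> \<B> \<Longrightarrow> Y \<in> \<B> \<Longrightarrow> card X = card Y"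
  using frame.bases_card_eq frame.finite_edges by blast

definition corank_one :: "'b hat_edge set \<Rightarrow> bool" where
  "corank_one X \<longleftrightarrow> X \<inter> H = {} \<and> (\<exists>c\<in>H. insert c X \<in> \<B>)"

lemma corank_one_separates:
  assumes "corank_one X"
  shows "insert (Hat {i, j}) X \<in> \<B> \<longleftrightarrow> stubs.separates X i j"
proof -
  obtain c where c: "insert c X \<in> \<B>" "c \<notin> X"
    using assms unfolding corank_one_def by blast
  show ?thesis
  proof
    assume b: "insert (Hat {i, j}) X \<in> \<B>"
    then have "Hat {i, j} \<in> edges del"
      using bases_subset by blast
    then show "stubs.separates X i j"
      using frame.insert_in_bases_iff[OF frame.finite_edges c] b unfolding stubs.separates_def by blast
  next
    assume "stubs.separates X i j"
    then show "insert (Hat {i, j}) X \<in> \<B>"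
      using frame.insert_in_bases_iff[OF frame.finite_edges c] unfolding stubs.separates_def by blast
  qed
qed

lemma separates_in_H:
  "stubs.separates X i j \<Longrightarrow> i \<in> {p, q, r, s} \<Longrightarrow> j \<in> {p, q, r, s} \<Longrightarrow> Hat {i, j} \<in> H"
  using Hat_in_H unfolding stubs.separates_def by blast

text \<open>All bases have the same size, so if one element of \<open>H\<close> completes
  \<open>B - H\<close>, then \<open>B\<close> itself has exactly one element in
  \<open>H\<close>.\<close>

lemma base_split:
  assumes B: "B \<in> \<B>" and c: "c \<in> H" "insert c (B - H) \<in> \<B>"
  obtains a where "a \<in> H" "B = insert a (B - H)"
proof -
  have fin: "finite B"
    using bases_finite B .
  have "card B = card (insert c (B - H))"
    using bases_card B c(2) .
  also have "\<dots> = Suc (card (B - H))"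
    using c(1) fin by simp
  moreover have "card B = card (B - H) + card (B \<inter> H)"
    using card_Un_disjoint[of "B - H" "B \<inter> H"] fin by (simp add: Un_Diff_Int Int_Diff_Un disjoint_iff Diff_Int_distrib)
  ultimately have "card (B \<inter> H) = 1"
    by simp
  then obtain a where "B \<inter> H = {a}"
    by (auto simp: card_1_singleton_iff)
  then show ?thesis
    using that[of a] by blast
qed

lemma completions_eq: "completions \<B> H B = {a \<in> H. insert a (B - H) \<in> \<B>}"
  unfolding completions_def by simp

definition pairs :: "(nat \<times> nat) set" where
  "pairs = {(p, q), (p, r), (p, s), (q, r), (q, s), (r, s)}"

lemma completions_separates:
  assumes "corank_one (B - H)"
  shows "completions \<B> H B = (\<lambda>(i, j). Hat {i, j}) ` {(i, j) \<in> pairs. stubs.separates (B - H) i j}"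
proof (intro equalityI subsetI)
  fix a assume "a \<in> completions \<B> H B"
  then have a: "a \<in> H" "insert a (B - H) \<in> \<B>"
    unfolding completions_eq by auto
  obtain i j where ij: "i \<in> {p, q, r, s}" "j \<in> {p, q, r, s}" "i \<noteq> j" "a = Hat {i, j}"
    using H_cases[OF a(1)] .
  then have sep: "stubs.separates (B - H) i j" "stubs.separates (B - H) j i"
    using corank_one_separates[OF assms] a(2) stubs.separates_commute by blast+
  have "(i, j) \<in> pairs \<or> (j, i) \<in> pairs"
    using ij(1-3) unfolding pairs_def by auto
  then obtain k l where kl: "(k, l) \<in> pairs" "(k, l) = (i, j) \<or> (k, l) = (j, i)"
    by blast
  then have "a = Hat {k, l}" "stubs.separates (B - H) k l"
    using sep ij(4) by (auto simp: insert_commute)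
  then show "a \<in> (\<lambda>(i, j). Hat {i, j}) ` {(i, j) \<in> pairs. stubs.separates (B - H) i j}"
    using kl(1) by (intro image_eqI[of _ _ "(k, l)"]) simp_all
next
  fix a :: "'b hat_edge"
  assume "a \<in> (\<lambda>(i, j). Hat {i, j}) ` {(i, j) \<in> pairs. stubs.separates (B - H) i j}"
  then obtain i j where ij: "(i, j) \<in> pairs" "a = Hat {i, j}" "stubs.separates (B - H) i j"
    by auto
  then have "i \<in> {p, q, r, s}" "j \<in> {p, q, r, s}"
    unfolding pairs_def by auto
  then show "a \<in> completions \<B> H B"
    using separates_in_H[OF ij(3)] corank_one_separates[OF assms] ij unfolding completions_eq by blast
qed

lemma opposed_completions:
  assumes "corank_one (B - H)" "corank_one (C - H)" and o: "stubs.opposed (B - H) (C - H) p q r s"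
  shows "completions \<B> H B = {Hat {p, q}, Hat {p, r}, Hat {q, s}, Hat {r, s}}"
    and "completions \<B> H C = {Hat {p, q}, Hat {p, s}, Hat {q, r}, Hat {r, s}}"
proof -
  have "{(i, j) \<in> pairs. stubs.separates (B - H) i j} = {(p, q), (p, r), (q, s), (r, s)}"
    "{(i, j) \<in> pairs. stubs.separates (C - H) i j} = {(p, q), (p, s), (q, r), (r, s)}"
    using o unfolding stubs.opposed_def pairs_def by auto
  then show "completions \<B> H B = {Hat {p, q}, Hat {p, r}, Hat {q, s}, Hat {r, s}}"
    "completions \<B> H C = {Hat {p, q}, Hat {p, s}, Hat {q, r}, Hat {r, s}}"
    unfolding completions_separates[OF assms(1)] completions_separates[OF assms(2)] by simp_all
qed

lemma non_incidents:
  "non_incident (Hat {p, q}) (Hat {r, s})" "non_incident (Hat {r, s}) (Hat {p, q})"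
  "non_incident (Hat {p, r}) (Hat {q, s})" "non_incident (Hat {q, s}) (Hat {p, r})"
  "non_incident (Hat {p, s}) (Hat {q, r})" "non_incident (Hat {q, r}) (Hat {p, s})"
  using distinct unfolding non_incident_def by auto

lemma Hat_distinct:
  "Hat {p, r} \<notin> {Hat {p, q}, Hat {r, s}}" "Hat {q, s} \<notin> {Hat {p, q}, Hat {r, s}}"
  "Hat {p, s} \<notin> {Hat {p, q}, Hat {r, s}}" "Hat {q, r} \<notin> {Hat {p, q}, Hat {r, s}}"
  "Hat {p, r} \<noteq> Hat {q, s}" "Hat {p, s} \<noteq> Hat {q, r}" "Hat {p, q} \<noteq> Hat {r, s}"
  using distinct by (auto simp: doubleton_eq_iff)

abbreviation switch where
  "switch \<equiv> switchable \<B> H (Hat {p, q}) (Hat {r, s})"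

text \<open>The completing edges are \<open>Hat {p, r}\<close>, \<open>Hat {q, s}\<close> or
  \<open>Hat {p, s}\<close>, \<open>Hat {q, r}\<close>; both pairs are non-incident and avoid the
  two given edges.\<close>

lemma crossing_switchable:
  assumes P: "(curve_step \<B> H)\<^sup>*\<^sup>* B P" "spread \<B> H X Y a b P" and XY: "corank_one X" "corank_one Y" "X \<inter> Y = {}"
    and cr: "stubs.crossing X Y p q r s"
  shows "switch B"
proof -
  have XH: "X \<inter> H = {}" "Y \<inter> H = {}"
    using XY unfolding corank_one_def by blast+
  have main: "switch B"
    if c: "stubs.separates X i j" "stubs.separates Y k l"
      and ij: "{i, j, k, l} \<subseteq> {p, q, r, s}" and n: "Hat {i, j} \<noteq> (Hat {k, l} :: 'b hat_edge)"
        "Hat {i, j} \<notin> {Hat {p, q}, Hat {r, s} :: 'b hat_edge}"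
        "Hat {k, l} \<notin> {Hat {p, q}, Hat {r, s} :: 'b hat_edge}"
        "non_incident (Hat {i, j}) (Hat {k, l} :: 'b hat_edge)" for i j k l
  proof -
    have h: "Hat {i, j} \<in> H" "Hat {k, l} \<in> H"
      using separates_in_H c ij by auto
    have b: "insert (Hat {i, j}) X \<in> \<B>" "insert (Hat {k, l}) Y \<in> \<B>"
      using corank_one_separates XY c by blast+
    have sp: "spread \<B> H X Y (Hat {i, j}) (Hat {k, l}) (insert (Hat {i, j}) X, insert (Hat {k, l}) Y)"
      using spread_pair[OF h n(1) XH XY(3) b] .
    show ?thesis
      using spread_switchable[OF P sp DiffI[OF h(1) n(2)] DiffI[OF h(2) n(3)] n(4)] .
  qed
  show ?thesis
    using cr unfolding stubs.crossing_def
  proof (elim disjE conjE)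
    show ?thesis if "stubs.separates X p r" "stubs.separates Y q s"
      by (rule main[OF that _ Hat_distinct(5,1,2) non_incidents(3)]) simp
    show ?thesis if "stubs.separates X q s" "stubs.separates Y p r"
      by (rule main[OF that _ Hat_distinct(5)[symmetric] Hat_distinct(2,1) non_incidents(4)]) simp
    show ?thesis if "stubs.separates X p s" "stubs.separates Y q r"
      by (rule main[OF that _ Hat_distinct(6,3,4) non_incidents(5)]) simp
    show ?thesis if "stubs.separates X q r" "stubs.separates Y p s"
      by (rule main[OF that _ Hat_distinct(6)[symmetric] Hat_distinct(4,3) non_incidents(6)]) simp
  qed
qed

lemma config_if_opposed:
  assumes B: "spread \<B> H A D a b B" and AD: "corank_one A" "corank_one D" "A \<inter> D = {}"
    and o: "stubs.opposed A D p q r s" and ns: "\<not> switch B"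
  shows "exchange_config (ends del) \<gamma> (edges del) {1..m} att (\<lambda>i j. Hat {i, j}) A D p q r s"
proof -
  let ?pq = "Hat {p, q}" and ?rs = "Hat {r, s}"
  have AH: "A \<inter> H = {}" "D \<inter> H = {}"
    using AD unfolding corank_one_def by blast+
  have in_E: "Hat {i, j} \<in> H" if "stubs.separates A i j \<or> stubs.separates D i j" "i \<in> {p, q, r, s}" "j \<in> {p, q, r, s}" for i j
    using separates_in_H that by blast
  have h: "?pq \<in> H" "?rs \<in> H" "Hat {p, r} \<in> H" "Hat {p, s} \<in> H" "Hat {q, r} \<in> H" "Hat {q, s} \<in> H"
    using in_E o unfolding stubs.opposed_def by auto
  note n = Hat_distinct
  have hd: "Hat {p, r} \<in> H - {?pq, ?rs}" "Hat {p, s} \<in> H - {?pq, ?rs}" "Hat {q, r} \<in> H - {?pq, ?rs}"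
    "Hat {q, s} \<in> H - {?pq, ?rs}"
    using h n by blast+
  have b: "insert ?pq A \<in> \<B>" "insert ?rs A \<in> \<B>" "insert ?pq D \<in> \<B>" "insert ?rs D \<in> \<B>"
    using o corank_one_separates AD unfolding stubs.opposed_def by blast+
  have s0: "spread \<B> H A D ?pq ?rs (insert ?pq A, insert ?rs D)"
    using spread_pair[OF h(1,2) n(7) AH AD(3) b(1,4)] .
  have notin: "Hat {i, j} \<notin> A" "Hat {i, j} \<notin> D"
    if ij: "i \<in> {p, q, r, s}" "j \<in> {p, q, r, s}" for i j
  proof -
    have "A \<subseteq> edges del" "D \<subseteq> edges del"
      using bases_subset b by blast+
    then show "Hat {i, j} \<notin> A" "Hat {i, j} \<notin> D"
      using Hat_in_H[OF _ ij] AH by blast+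
  qed
  show ?thesis
  proof unfold_locales
    show "distinct [p, q, r, s]" "{p, q, r, s} \<subseteq> {1..m}"
      using distinct range .
    show "stubs.opposed A D p q r s" "insert ?pq A \<in> \<B>" "insert ?rs D \<in> \<B>"
      using o b by auto
    show "Hat {i, j} \<notin> A" "Hat {i, j} \<notin> D" if "i \<in> {p, q, r, s}" "j \<in> {p, q, r, s}" for i j
      using notin that by blast+
    show "insert (Hat {p, r}) (insert (Hat {q, s}) (A - {z})) \<notin> \<B> \<and>
        insert (Hat {p, s}) (insert (Hat {q, r}) (A - {z})) \<notin> \<B>"
      if z: "z \<in> A" "insert ?pq (insert ?rs (A - {z})) \<in> \<B>" "insert z D \<in> \<B>" for z
    proof -
      have d: "(A - {z}) \<inter> H = {}" "insert z D \<inter> H = {}" "(A - {z}) \<inter> insert z D = {}"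
        using AH AD(3) z(1) by blast+
      have s': "spread \<B> H (A - {z}) (insert z D) ?pq ?rs (insert ?pq (insert ?rs (A - {z})), insert z D)"
        using spread_left[OF h(1,2) n(7) d z(2,3)] .
      \<comment> \<open>Exchanging \<open>z\<close> with \<open>Hat {r, s}\<close> brings both edges
        of \<open>H\<close> into the first basis, from where they could be rerouted
        together.\<close>
      have ex: "symmetric_exchange \<B> (insert ?pq A, insert ?rs D) (insert ?pq (insert ?rs (A - {z})), insert z D)"
        using z notin[of p q] notin[of r s] n(7) h AH AD(3)
        by (intro symmetric_exchangeI[of z _ _ ?rs]) auto
      have step: "(curve_step \<B> H)\<^sup>*\<^sup>* B (insert ?pq (insert ?rs (A - {z})), insert z D)"
        using spread_curve_step[OF B s0 s' s' ex non_incidents(1)] by blast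
      show ?thesis
        using spread_switchable[OF step s' spread_left[OF h(3,6) n(5) d _ z(3)] hd(1,4) non_incidents(3)]
          spread_switchable[OF step s' spread_left[OF h(4,5) n(6) d _ z(3)] hd(2,3) non_incidents(5)] ns
        by blast
    qed
    show "insert (Hat {p, r}) (insert (Hat {q, s}) (D - {z})) \<notin> \<B> \<and>
        insert (Hat {p, s}) (insert (Hat {q, r}) (D - {z})) \<notin> \<B>"
      if z: "z \<in> D" "insert ?pq (insert ?rs (D - {z})) \<in> \<B>" "insert z A \<in> \<B>" for z
    proof -
      have d: "insert z A \<inter> H = {}" "(D - {z}) \<inter> H = {}" "insert z A \<inter> (D - {z}) = {}"
        using AH AD(3) z(1) by blast+
      have s': "spread \<B> H (insert z A) (D - {z}) ?pq ?rs (insert z A, insert ?pq (insert ?rs (D - {z})))"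
        using spread_right[OF h(1,2) n(7) d z(3,2)] .
      \<comment> \<open>Here \<open>Hat {p, q}\<close> leaves the first basis in return for
        \<open>z\<close>, so both edges of \<open>H\<close> meet in the second one.\<close>
      have ex: "symmetric_exchange \<B> (insert ?pq A, insert ?rs D) (insert z A, insert ?pq (insert ?rs (D - {z})))"
        using z notin[of p q] notin[of r s] n(7) h AH AD(3)
        by (intro symmetric_exchangeI[of ?pq _ _ z]) auto
      have step: "(curve_step \<B> H)\<^sup>*\<^sup>* B (insert z A, insert ?pq (insert ?rs (D - {z})))"
        using spread_curve_step[OF B s0 s' s' ex non_incidents(1)] by blast
      show ?thesis
        using spread_switchable[OF step s' spread_right[OF h(3,6) n(5) d z(3)] hd(1,4) non_incidents(3)]
          spread_switchable[OF step s' spread_right[OF h(4,5) n(6) d z(3)] hd(2,3) non_incidents(5)] ns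
        by blast
    qed
    show "\<not> stubs.crossing (insert y (A - {x})) (insert x (D - {y})) p q r s"
      if x: "x \<in> A" and y: "y \<in> D"
        and xy: "insert ?pq (insert y (A - {x})) \<in> \<B> \<and> insert ?rs (insert x (D - {y})) \<in> \<B> \<or>
          insert ?rs (insert y (A - {x})) \<in> \<B> \<and> insert ?pq (insert x (D - {y})) \<in> \<B>" for x y
    proof -
      let ?A = "insert y (A - {x})" and ?D = "insert x (D - {y})"
      have d: "?A \<inter> H = {}" "?D \<inter> H = {}" "?A \<inter> ?D = {}"
        using AH AD(3) x y by blast+
      have co: "corank_one ?A" "corank_one ?D"
        using d xy h unfolding corank_one_def by blast+
      \<comment> \<open>Either placement of the two edges makes the exchange a chain step, after
        which a crossing would witness switchability.\<close>
      have "\<exists>Q. (curve_step \<B> H)\<^sup>*\<^sup>* B Q \<and> (\<exists>a b. spread \<B> H ?A ?D a b Q)"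
        using xy
      proof
        assume *: "insert ?pq ?A \<in> \<B> \<and> insert ?rs ?D \<in> \<B>"
        then have s': "spread \<B> H ?A ?D ?pq ?rs (insert ?pq ?A, insert ?rs ?D)"
          using spread_pair[OF h(1,2) n(7) d] by blast
        then show ?thesis
          using exchange_curve_step[OF B s' x y AH AD(3) h(1,2) n(7) non_incidents(1) b(1,4)] * by blast
      next
        assume *: "insert ?rs ?A \<in> \<B> \<and> insert ?pq ?D \<in> \<B>"
        then have s': "spread \<B> H ?A ?D ?rs ?pq (insert ?rs ?A, insert ?pq ?D)"
          using spread_pair[OF h(2,1) n(7)[symmetric] d] by blast
        then show ?thesis
          using exchange_curve_step[OF B s' x y AH AD(3) h(2,1) n(7)[symmetric] non_incidents(2) b(2,3)] *
          by blast
      qed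
      then show ?thesis
        using crossing_switchable[OF _ _ co d(3)] ns by blast
    qed
  qed
qed

lemma opposed_exchange:
  assumes B: "spread \<B> H A D a b B" and AD: "corank_one A" "corank_one D" "A \<inter> D = {}"
    and o: "stubs.opposed A D p q r s" and ns: "\<not> switch B"
    and x: "x \<in> A" and y: "y \<in> D"
    and c: "corank_one (insert y (A - {x}))" "corank_one (insert x (D - {y}))"
  shows "insert (Hat {p, q}) (insert y (A - {x})) \<in> \<B> \<and> insert (Hat {r, s}) (insert x (D - {y})) \<in> \<B> \<or>
     insert (Hat {r, s}) (insert y (A - {x})) \<in> \<B> \<and> insert (Hat {p, q}) (insert x (D - {y})) \<in> \<B>"
proof -
  interpret exchange_config "ends del" \<gamma> "edges del" "{1..m}" att "\<lambda>i j. Hat {i, j}" A D p q r s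
    using config_if_opposed[OF B AD o ns] .
  obtain a' b' where ab: "a' \<in> H" "insert a' (insert y (A - {x})) \<in> \<B>" "b' \<in> H" "insert b' (insert x (D - {y})) \<in> \<B>"
    using c unfolding corank_one_def by blast
  obtain i j where ij: "i \<in> {p, q, r, s}" "j \<in> {p, q, r, s}" "i \<noteq> j" "a' = Hat {i, j}"
    using H_cases[OF ab(1)] .
  obtain k l where kl: "k \<in> {p, q, r, s}" "l \<in> {p, q, r, s}" "k \<noteq> l" "b' = Hat {k, l}"
    using H_cases[OF ab(3)] .
  show ?thesis
    using exchange_keeps_bases[OF x y ij(1-3) _ kl(1-3)] ab ij(4) kl(4) by blast
qed

text \<open>The two forms of opposition interchange the two sets of completions, which is why only
  the unordered pair is the same for both.\<close>

lemma opposed_completions_pair: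
  assumes BC: "corank_one (B - H)" "corank_one (C - H)"
    and o: "stubs.opposed (B - H) (C - H) p q r s \<or> stubs.opposed (B - H) (C - H) p q s r"
  shows "{completions \<B> H B, completions \<B> H C} =
    {{Hat {p, q}, Hat {p, r}, Hat {q, s}, Hat {r, s}}, {Hat {p, q}, Hat {p, s}, Hat {q, r}, Hat {r, s}}}"
  using o
proof
  assume "stubs.opposed (B - H) (C - H) p q r s"
  then show ?thesis
    using opposed_completions[OF BC] by simp
next
  interpret R: four_edges G \<C> v m e p q s r
    by (rule reordered)
  have H: "R.H = H"
    by (simp add: insert_commute)
  assume "stubs.opposed (B - H) (C - H) p q s r"
  moreover have "R.corank_one (B - H)" "R.corank_one (C - H)"
    using BC unfolding R.corank_one_def corank_one_def H .
  ultimately show ?thesis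
    using R.opposed_completions[of B C] unfolding H by (simp add: insert_commute)
qed

lemma exchange_outside:
  assumes B: "spread \<B> H A D a b B" and AD: "corank_one A" "corank_one D" "A \<inter> D = {}"
    and o: "stubs.opposed A D p q r s \<or> stubs.opposed A D p q s r" and ns: "\<not> switch B"
    and x: "x \<in> A" and y: "y \<in> D"
    and c: "corank_one (insert y (A - {x}))" "corank_one (insert x (D - {y}))"
  shows "insert (Hat {p, q}) (insert y (A - {x})) \<in> \<B> \<and> insert (Hat {r, s}) (insert x (D - {y})) \<in> \<B> \<or>
     insert (Hat {r, s}) (insert y (A - {x})) \<in> \<B> \<and> insert (Hat {p, q}) (insert x (D - {y})) \<in> \<B>"
  using o
proof
  assume "stubs.opposed A D p q r s"
  then show ?thesis
    using opposed_exchange[OF B AD _ ns x y c] by blast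
next
  interpret R: four_edges G \<C> v m e p q s r
    by (rule reordered)
  have H: "R.H = H"
    by (simp add: insert_commute)
  have sr: "Hat {s, r} = Hat {r, s}"
    by (simp add: insert_commute)
  have co: "R.corank_one X \<longleftrightarrow> corank_one X" for X
    unfolding R.corank_one_def corank_one_def H ..
  assume "stubs.opposed A D p q s r"
  then show ?thesis
    using R.opposed_exchange[of A D a b B x y] B AD ns x y c unfolding H sr co by blast
qed

lemma completions_inter:
  assumes "B \<in> \<B>" "completions \<B> H B \<noteq> {}"
  obtains a where "B \<inter> H = {a}" "B = insert a (B - H)"
proof -
  obtain c where "c \<in> H" "insert c (B - H) \<in> \<B>"
    using assms(2) unfolding completions_eq by blast
  then obtain a where a: "a \<in> H" "B = insert a (B - H)"
    using base_split assms(1) by blast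
  then have "B \<inter> H = {a}"
    by blast
  then show ?thesis
    using that a(2) by blast
qed

lemma completions_empty:
  assumes "B \<in> \<B>" "\<And>a. B \<inter> H \<noteq> {a}"
  shows "completions \<B> H B = {}"
  by (rule ccontr) (use completions_inter[OF assms(1)] assms(2) in metis)

text \<open>If both exchanged elements lie in \<open>H\<close>, the outside parts do not change. If
  only one does, one basis gets two elements of \<open>H\<close> and the other none, and by
  cardinality neither outside part can be completed. If none does, the old pair is opposed, the
  exchange is a chain step, and so the new pair is opposed as well.\<close>

lemma exchange_completions:
  assumes B: "disjoint_bases \<B> (B\<^sub>1, B\<^sub>2)"
    and F: "Hat {p, q} \<in> completions \<B> H B\<^sub>1" "Hat {r, s} \<in> completions \<B> H B\<^sub>2"
    and ns: "\<not> switch (B\<^sub>1, B\<^sub>2)" and ex: "symmetric_exchange \<B> (B\<^sub>1, B\<^sub>2) (B\<^sub>1', B\<^sub>2')"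
  shows "{completions \<B> H B\<^sub>1', completions \<B> H B\<^sub>2'} = {completions \<B> H B\<^sub>1, completions \<B> H B\<^sub>2} \<or>
         (completions \<B> H B\<^sub>1' = {} \<and> completions \<B> H B\<^sub>2' = {})"
proof -
  have b: "B\<^sub>1 \<in> \<B>" "B\<^sub>2 \<in> \<B>" "B\<^sub>1 \<inter> B\<^sub>2 = {}"
    using B unfolding disjoint_bases_def by auto
  obtain x y where xy: "x \<in> B\<^sub>1" "x \<notin> B\<^sub>2" "y \<in> B\<^sub>2" "y \<notin> B\<^sub>1"
    and B': "B\<^sub>1' = insert y (B\<^sub>1 - {x})" "B\<^sub>2' = insert x (B\<^sub>2 - {y})" "B\<^sub>1' \<in> \<B>" "B\<^sub>2' \<in> \<B>"
    using ex unfolding symmetric_exchange_def by auto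
  define A D where "A = B\<^sub>1 - H" and "D = B\<^sub>2 - H"
  obtain a where a: "B\<^sub>1 \<inter> H = {a}" "B\<^sub>1 = insert a A"
    using completions_inter[OF b(1)] F(1) unfolding A_def by blast
  obtain c where c: "B\<^sub>2 \<inter> H = {c}" "B\<^sub>2 = insert c D"
    using completions_inter[OF b(2)] F(2) unfolding D_def by blast
  have ac: "a \<in> H" "c \<in> H" "a \<noteq> c"
    using a c b(3) by blast+
  have AD: "corank_one A" "corank_one D" "A \<inter> D = {}"
    using F b(3) unfolding corank_one_def completions_eq A_def D_def by blast+
  have AH: "A \<inter> H = {}" "D \<inter> H = {}"
    unfolding A_def D_def by blast+
  have spread: "spread \<B> H A D a c (B\<^sub>1, B\<^sub>2)"
    using B ac a c unfolding spread_def meets_in_def A_def D_def by auto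
  consider (both) "x \<in> H" "y \<in> H" | (left) "x \<in> H" "y \<notin> H" | (right) "x \<notin> H" "y \<in> H"
    | (none) "x \<notin> H" "y \<notin> H"
    by blast
  then show ?thesis
  proof cases
    case both
    then have "B\<^sub>1' - H = B\<^sub>1 - H" "B\<^sub>2' - H = B\<^sub>2 - H"
      unfolding B' by blast+
    then show ?thesis
      unfolding completions_eq by simp
  next
    case left
    then have "x = a"
      using a(1) xy(1) by blast
    have "B\<^sub>1' \<inter> H = {}"
      using left a(1) \<open>x = a\<close> unfolding B' by blast
    then have 0: "B\<^sub>1' \<inter> H \<noteq> {z}" for z
      by simp
    have "{a, c} \<subseteq> B\<^sub>2' \<inter> H"
      using left ac c(1) \<open>x = a\<close> unfolding B' by blast
    then have "B\<^sub>2' \<inter> H \<noteq> {z}" for z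
      using ac(3) by (metis insert_subset singletonD)
    then show ?thesis
      using completions_empty[OF B'(3) 0] completions_empty[OF B'(4)] by simp
  next
    case right
    then have "y = c"
      using c(1) xy(3) by blast
    have "B\<^sub>2' \<inter> H = {}"
      using right c(1) \<open>y = c\<close> unfolding B' by blast
    then have 0: "B\<^sub>2' \<inter> H \<noteq> {z}" for z
      by simp
    have "{a, c} \<subseteq> B\<^sub>1' \<inter> H"
      using right ac a(1) \<open>y = c\<close> unfolding B' by blast
    then have "B\<^sub>1' \<inter> H \<noteq> {z}" for z
      using ac(3) by (metis insert_subset singletonD)
    then show ?thesis
      using completions_empty[OF B'(3)] completions_empty[OF B'(4) 0] by simp
  next
    case none
    define A' D' where "A' = insert y (A - {x})" and "D' = insert x (D - {y})"
    have x: "x \<in> A" and y: "y \<in> D"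
      using none xy unfolding A_def D_def by blast+
    have B1': "B\<^sub>1' = insert a A'" and B2': "B\<^sub>2' = insert c D'"
      using a(2) c(2) none ac unfolding B' A'_def D'_def by auto
    have AH': "A' \<inter> H = {}" "D' \<inter> H = {}" "A' \<inter> D' = {}"
      using none AH AD(3) x y unfolding A'_def D'_def by blast+
    have outside: "B\<^sub>1' - H = A'" "B\<^sub>2' - H = D'"
      using ac AH' unfolding B1' B2' by blast+
    have AD': "corank_one A'" "corank_one D'"
      using AH' B'(3,4) ac unfolding corank_one_def B1' B2' by blast+
    have spread': "spread \<B> H A' D' a c (B\<^sub>1', B\<^sub>2')"
      using spread_pair[OF ac AH' B'(3,4)[unfolded B1' B2']] unfolding B1' B2' .
    have pq: "insert (Hat {p, q}) A \<in> \<B>" "insert (Hat {r, s}) D \<in> \<B>" "Hat {p, q} \<in> H" "Hat {r, s} \<in> H"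
      using F unfolding completions_eq A_def D_def by auto
    have "\<not> stubs.crossing A D p q r s"
      using crossing_switchable[OF rtranclp.rtrancl_refl spread AD] ns by blast
    then have o: "stubs.opposed A D p q r s \<or> stubs.opposed A D p q s r"
      using stubs.not_crossing_opposed[OF distinct range] pq(1,2) corank_one_separates AD(1,2) by blast
    have new: "insert (Hat {p, q}) A' \<in> \<B> \<and> insert (Hat {r, s}) D' \<in> \<B> \<or>
        insert (Hat {r, s}) A' \<in> \<B> \<and> insert (Hat {p, q}) D' \<in> \<B>"
      using exchange_outside[OF spread AD o ns x y] AD' unfolding A'_def D'_def by blast
    \<comment> \<open>Opposition lets the two edges trade places in the old pair, so that either
      placement in the new pair has a counterpart.\<close>
    have old: "insert (Hat {r, s}) A \<in> \<B>" "insert (Hat {p, q}) D \<in> \<B>"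
      using o corank_one_separates AD(1,2) stubs.separates_commute[of _ r s]
      unfolding stubs.opposed_def by blast+
    have "curve_step \<B> H (B\<^sub>1, B\<^sub>2) (B\<^sub>1', B\<^sub>2')"
      using new
    proof
      assume "insert (Hat {p, q}) A' \<in> \<B> \<and> insert (Hat {r, s}) D' \<in> \<B>"
      then show ?thesis
        using exchange_curve_step[OF spread spread'[unfolded A'_def D'_def] x y AH AD(3) pq(3,4)
          Hat_distinct(7) non_incidents(1) pq(1,2)] unfolding A'_def D'_def by blast
    next
      assume "insert (Hat {r, s}) A' \<in> \<B> \<and> insert (Hat {p, q}) D' \<in> \<B>"
      then show ?thesis
        using exchange_curve_step[OF spread spread'[unfolded A'_def D'_def] x y AH AD(3) pq(4,3)
          Hat_distinct(7)[symmetric] non_incidents(2) old] unfolding A'_def D'_def by blast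
    qed
    then have "\<not> stubs.crossing A' D' p q r s"
      using crossing_switchable[OF r_into_rtranclp spread' AD' AH'(3)] ns by blast
    then have nc: "\<not> stubs.crossing A' D' p q r s" "\<not> stubs.crossing D' A' p q r s"
      unfolding stubs.crossing_def by blast+
    have "{completions \<B> H B\<^sub>1', completions \<B> H B\<^sub>2'} =
      {{Hat {p, q}, Hat {p, r}, Hat {q, s}, Hat {r, s}}, {Hat {p, q}, Hat {p, s}, Hat {q, r}, Hat {r, s}}}"
      using new
    proof
      assume "insert (Hat {p, q}) A' \<in> \<B> \<and> insert (Hat {r, s}) D' \<in> \<B>"
      then have "stubs.separates A' p q" "stubs.separates D' r s"
        using corank_one_separates[OF AD'(1)] corank_one_separates[OF AD'(2)] by simp_all
      then show ?thesis
        using opposed_completions_pair[of "B\<^sub>1'" "B\<^sub>2'", unfolded outside, OF AD'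
          stubs.not_crossing_opposed[OF distinct range _ _ nc(1)]] by simp
    next
      assume "insert (Hat {r, s}) A' \<in> \<B> \<and> insert (Hat {p, q}) D' \<in> \<B>"
      then have "stubs.separates D' p q" "stubs.separates A' r s"
        using corank_one_separates[OF AD'(1)] corank_one_separates[OF AD'(2)] by simp_all
      then show ?thesis
        using opposed_completions_pair[of "B\<^sub>2'" "B\<^sub>1'", unfolded outside, OF AD'(2,1)
          stubs.not_crossing_opposed[OF distinct range _ _ nc(2)]]
          insert_commute[of "completions \<B> H B\<^sub>1'" "completions \<B> H B\<^sub>2'" "{}"] by simp
    qed
    moreover have "{completions \<B> H B\<^sub>1, completions \<B> H B\<^sub>2} =
      {{Hat {p, q}, Hat {p, r}, Hat {q, s}, Hat {r, s}}, {Hat {p, q}, Hat {p, s}, Hat {q, r}, Hat {r, s}}}"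
      using opposed_completions_pair[of "B\<^sub>1" "B\<^sub>2", folded A_def D_def, OF AD(1,2) o] .
    ultimately show ?thesis
      by simp
  qed
qed

end

theorem theorem5p5:
  fixes G :: "('v, 'e) mgraph" and \<C> :: "'e set set" and v :: 'v
    and m :: nat and e :: "nat \<Rightarrow> 'e" and i\<^sub>1 i\<^sub>2 i\<^sub>3 i\<^sub>4 :: nat
    and B\<^sub>1 B\<^sub>2 B\<^sub>1' B\<^sub>2' :: "'e hat_edge set"
  defines "\<B> \<equiv> hat_bases G \<C> v m e"
    and "H \<equiv> hat_subgraph_edges G m e {i\<^sub>1, i\<^sub>2, i\<^sub>3, i\<^sub>4}"
  assumes "linear_biased_graph G \<C>"
    and "\<forall>x\<in>edges G. {x} \<notin> \<C>"
    and "v \<in> verts G"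
    and "bij_betw e {1..m} (edges_at G v)"
    and "disjoint_bases \<B> (B\<^sub>1, B\<^sub>2)"
    and "distinct [i\<^sub>1, i\<^sub>2, i\<^sub>3, i\<^sub>4]" and "{i\<^sub>1, i\<^sub>2, i\<^sub>3, i\<^sub>4} \<subseteq> {1..m}"
    and "Hat {i\<^sub>1, i\<^sub>2} \<in> completions \<B> H B\<^sub>1"
    and "Hat {i\<^sub>3, i\<^sub>4} \<in> completions \<B> H B\<^sub>2"
    and "\<not> switchable \<B> H (Hat {i\<^sub>1, i\<^sub>2}) (Hat {i\<^sub>3, i\<^sub>4}) (B\<^sub>1, B\<^sub>2)"
    and "symmetric_exchange \<B> (B\<^sub>1, B\<^sub>2) (B\<^sub>1', B\<^sub>2')"
  shows "{completions \<B> H B\<^sub>1', completions \<B> H B\<^sub>2'} = {completions \<B> H B\<^sub>1, completions \<B> H B\<^sub>2} \<or>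
         (completions \<B> H B\<^sub>1' = {} \<and> completions \<B> H B\<^sub>2' = {})"
proof -
  interpret four_edges G \<C> v m e i\<^sub>1 i\<^sub>2 i\<^sub>3 i\<^sub>4
    by unfold_locales (use assms in auto)
  show ?thesis
    using exchange_completions assms(7,10-) unfolding \<B>_def H_def hat_bases_eq by blast
qed

end
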